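(* Let $k,\ell\ge1$, let $S=(V_1,\dots,V_k)$ and $T=(W_1,\dots,W_\ell)$ be tuples of modules in $\mathcal M_{\mathrm{fd}}$, fix weight vectors $v_i\in V_i[\nu_i]$, and let $\lambda\in\mathfrak h^*_{\mathrm{reg}}$. Let $A:V_1\otimes\cdots\otimes V_k\to W_1\otimes\cdots\otimes W_\ell$ be $U_q$-linear, and put $\overline A(\lambda):=j_T(\lambda)^{-1}\circ A\circ j_S(\lambda)$. Then $$\bigl(\mathrm{id}_{M_{\lambda-\sum_i\nu_i}}\otimes A\bigr)\circ\Phi_\lambda^{v_1,\dots,v_k}=\sum_n\Phi_\lambda^{w_1^n,\dots,w_\ell^n}$$ as maps $M_\lambda\to M_{\lambda-\sum_i\nu_i}\otimes W_1\otimes\cdots\otimes W_\ell$, where $w_j^n\in W_j$ are homogeneous (weight) vectors such that $$\overline A(\lambda)(v_1\otimes\cdots\otimes v_k)=\sum_n w_1^n\otimes\cdots\otimes w_\ell^n .$$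
   Context: $\mathfrak g$ is a complex semisimple Lie algebra with Cartan subalgebra $\mathfrak h$, weight lattice $\Lambda$, roots $\Phi$, $\langle\cdot,\cdot\rangle$ the form on $\mathfrak h^*$ with $\langle\alpha_i,\alpha_j\rangle=d_ia_{ij}$ (symmetrized Cartan matrix), used to identify $\mathfrak h^*\cong\mathfrak h$; $0<q<1$; $U_q=U_q(\mathfrak g)$ with generators $E_i,F_i,q^h$ ($h\in\mathfrak h$), standard relations and coproduct $\Delta(q^h)=q^h\otimes q^h$, $\Delta(E_i)=E_i\otimes q^{\alpha_i}+1\otimes E_i$, $\Delta(F_i)=F_i\otimes1+q^{-\alpha_i}\otimes F_i$. $\mathcal M_{\mathrm{fd}}$: category of finite-dimensional $U_q$-modules that are direct sums of weight spaces $V[\mu]$ ($q^h$ acts by $q^{\mu(h)}$), with weights in $\Lambda$. Tensor products are treated as associative. $M_\lambda$: Verma module with highest weight vector $\mathbf m_\lambda$; $\mathbf m_\lambda^*$ the functional with $\mathbf m^*_\lambda(\mathbf m_\lambda)=1$, vanishing on the other weight spaces. $\mathfrak h^*_{\mathrm{reg}}$: weights $\lambda$ with $\langle\lambda,2\alpha/\langle\alpha,\alpha\rangle\rangle\notin\mathbb Z$ for all roots $\alpha$ and $M_{\lambda+\nu}$ irreducible for all $\nu\in\Lambda$. For $\lambda\in\mathfrak h^*_{\mathrm{reg}}$ and $v\in V[\nu]$, $\phi_\lambda^v:M_\lambda\to M_{\lambda-\nu}\otimes V$ is the unique $U_q$-linear map with $(\mathbf m^*_{\lambda-\nu}\otimes\mathrm{id})\phi^v_\lambda(\mathbf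 m_\lambda)=v$. For $v_j\in V_j[\nu_j]$ and $\lambda_j=\lambda-\nu_{j+1}-\cdots-\nu_k$, the $k$-point quantum vertex operator is $$\Phi_\lambda^{v_1,\dots,v_k}=(\phi^{v_1}_{\lambda_1}\otimes\mathrm{id}_{V_2\otimes\cdots\otimes V_k})\cdots(\phi^{v_{k-1}}_{\lambda_{k-1}}\otimes\mathrm{id}_{V_k})\phi^{v_k}_{\lambda_k}:M_\lambda\to M_{\lambda_0}\otimes V_1\otimes\cdots\otimes V_k.$$ The dynamical fusion operator $j_S(\lambda)$ is the weight-preserving automorphism of $V_1\otimes\cdots\otimes V_k$ determined by $j_S(\lambda)(v_1\otimes\cdots\otimes v_k)=(\mathbf m^*_{\lambda_0}\otimes\mathrm{id})\Phi_\lambda^{v_1,\dots,v_k}(\mathbf m_\lambda)$. *)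

theory Defs
  imports "HOL-Analysis.Analysis" "HOL-Library.Function_Algebras" "HOL-Library.Poly_Mapping"
begin

section \<open>Complex vector spaces\<close>

class cvec = ab_group_add +
  fixes scaleC :: "complex \<Rightarrow> 'a \<Rightarrow> 'a"  (infixr "*\<^sub>C" 75)
  assumes scaleC_right_distrib: "a *\<^sub>C (x + y) = a *\<^sub>C x + a *\<^sub>C y"
    and scaleC_left_distrib: "(a + b) *\<^sub>C x = a *\<^sub>C x + b *\<^sub>C x"
    and scaleC_scaleC: "a *\<^sub>C (b *\<^sub>C x) = (a * b) *\<^sub>C x"
    and scaleC_one: "1 *\<^sub>C x = x"

interpretation cvec: vector_space "scaleC :: complex \<Rightarrow> 'a \<Rightarrow> 'a::cvec"
  by unfold_locales
    (simp_all add: scaleC_right_distrib scaleC_left_distrib scaleC_scaleC scaleC_one)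

instantiation complex :: cvec
begin
definition scaleC_complex :: "complex \<Rightarrow> complex \<Rightarrow> complex" where
  "scaleC_complex c x = c * x"
instance by standard (simp_all add: scaleC_complex_def algebra_simps)
end

instantiation "fun" :: (type, cvec) cvec
begin
definition scaleC_fun :: "complex \<Rightarrow> ('a \<Rightarrow> 'b) \<Rightarrow> 'a \<Rightarrow> 'b" where
  "scaleC_fun c f = (\<lambda>x. c *\<^sub>C f x)"
instance
  by standard (simp_all add: scaleC_fun_def fun_eq_iff scaleC_right_distrib
      scaleC_left_distrib scaleC_scaleC scaleC_one)
end

text \<open>Modules below are subspaces of an ambient space, so linearity is relative to a subspace.\<close>

definition linear_on :: "'a::cvec set \<Rightarrow> ('a \<Rightarrow> 'b::cvec) \<Rightarrow> bool" where
  "linear_on X f \<longleftrightarrow> (\<forall>x\<in>X. \<forall>y\<in>X. f (x + y) = f x + f y) \<and> (\<forall>c. \<forall>x\<in>X. f (c *\<^sub>C x) = c *\<^sub>C f x)"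


section \<open>The Cartan datum\<close>

text \<open>
  A complex semisimple Lie algebra enters only through its Cartan matrix \<open>cmat\<close> (of finite type),
  with symmetrizing numbers \<open>dsym\<close>. As the simple roots form a basis of the dual \<open>h*\<close> of the Cartan
  subalgebra, \<open>h*\<close> is \<open>complex ^ 'i\<close>, with coordinates taken with respect to the simple roots;
  \<open>h\<close> is identified with \<open>h*\<close> by the form \<open>bil\<close>, so that the value of a weight \<open>\<mu>\<close>
  at \<open>h\<close> is \<open>bil D \<mu> h\<close>.
\<close>

record 'i qdatum =
  cmat :: "'i \<Rightarrow> 'i \<Rightarrow> int"
  dsym :: "'i \<Rightarrow> real"
  qpar :: real

definition qdatum :: "'i::finite qdatum \<Rightarrow> bool" where
  "qdatum D \<longleftrightarrow>
     (\<forall>i. cmat D i i = 2) \<and>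
     (\<forall>i j. i \<noteq> j \<longrightarrow> cmat D i j \<le> 0) \<and>
     (\<forall>i. dsym D i > 0) \<and>
     (\<forall>i j. dsym D i * of_int (cmat D i j) = dsym D j * of_int (cmat D j i)) \<and>
     (\<forall>x :: real ^ 'i. x \<noteq> 0 \<longrightarrow>
        (\<Sum>i\<in>UNIV. \<Sum>j\<in>UNIV. x $ i * x $ j * dsym D i * of_int (cmat D i j)) > 0) \<and>
     0 < qpar D \<and> qpar D < 1"

type_synonym 'i weight = "complex ^ 'i"

definition bil :: "'i::finite qdatum \<Rightarrow> 'i weight \<Rightarrow> 'i weight \<Rightarrow> complex" where
  "bil D lam \<mu> =
     (\<Sum>i\<in>UNIV. \<Sum>j\<in>UNIV. lam $ i * \<mu> $ j * of_real (dsym D i) * of_int (cmat D i j))"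

definition alpha :: "'i::finite \<Rightarrow> 'i weight" where
  "alpha i = axis i 1"

definition coroot_pairing :: "'i::finite qdatum \<Rightarrow> 'i weight \<Rightarrow> 'i weight \<Rightarrow> complex" where
  "coroot_pairing D lam \<beta> = 2 * bil D lam \<beta> / bil D \<beta> \<beta>"

text \<open>The roots are the orbit of the simple roots under the Weyl group.\<close>

inductive_set roots :: "'i::finite qdatum \<Rightarrow> 'i weight set" for D where
  simple: "alpha i \<in> roots D"
| reflect: "\<beta> \<in> roots D \<Longrightarrow> \<beta> - coroot_pairing D \<beta> (alpha i) *s alpha i \<in> roots D"

definition weight_lattice :: "'i::finite qdatum \<Rightarrow> 'i weight set" where
  "weight_lattice D = {\<mu>. \<forall>i. coroot_pairing D \<mu> (alpha i) \<in> \<int>}"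


section \<open>The quantum group by generators and relations\<close>

text \<open>\<open>GK h\<close> is the generator \<open>q\<^sup>h\<close>.\<close>

datatype 'i gen = GE 'i | GF 'i | GK "'i weight"

text \<open>Words form a monoid under concatenation, so \<open>'i gen list \<Rightarrow>\<^sub>0 complex\<close>, with the convolution
  product of \<open>Poly_Mapping\<close>, is the free unital associative algebra on the generators.\<close>

instantiation list :: (type) monoid_add
begin
definition zero_list :: "'a list" where "zero_list = []"
definition plus_list :: "'a list \<Rightarrow> 'a list \<Rightarrow> 'a list" where "plus_list xs ys = xs @ ys"
instance by standard (simp_all add: zero_list_def plus_list_def)
end

type_synonym 'i free_alg = "'i gen list \<Rightarrow>\<^sub>0 complex"

definition cst :: "complex \<Rightarrow> 'i free_alg" where
  "cst c = Poly_Mapping.single [] c"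

definition gE :: "'i \<Rightarrow> 'i free_alg" where
  "gE i = Poly_Mapping.single [GE i] 1"

definition gF :: "'i \<Rightarrow> 'i free_alg" where
  "gF i = Poly_Mapping.single [GF i] 1"

definition gK :: "'i weight \<Rightarrow> 'i free_alg" where
  "gK h = Poly_Mapping.single [GK h] 1"

text \<open>As \<open>q\<close> is a positive real, the complex power is \<open>exp (z * ln q)\<close> with the real logarithm.\<close>

definition qpow :: "'i qdatum \<Rightarrow> complex \<Rightarrow> complex" where
  "qpow D z = of_real (qpar D) powr z"

definition q_i :: "'i qdatum \<Rightarrow> 'i \<Rightarrow> complex" where
  "q_i D i = qpow D (of_real (dsym D i))"

definition qint :: "complex \<Rightarrow> nat \<Rightarrow> complex" where
  "qint p n = (p ^ n - inverse p ^ n) / (p - inverse p)"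

definition qfact :: "complex \<Rightarrow> nat \<Rightarrow> complex" where
  "qfact p n = (\<Prod>k=1..n. qint p k)"

definition qbinom :: "complex \<Rightarrow> nat \<Rightarrow> nat \<Rightarrow> complex" where
  "qbinom p n k = qfact p n / (qfact p k * qfact p (n - k))"

definition serre :: "'i qdatum \<Rightarrow> ('i \<Rightarrow> 'i free_alg) \<Rightarrow> 'i \<Rightarrow> 'i \<Rightarrow> 'i free_alg" where
  "serre D x i j = (let n = nat (1 - cmat D i j) in
     \<Sum>r\<le>n. cst ((- 1) ^ r * qbinom (q_i D i) n r) * x i ^ (n - r) * x j * x i ^ r)"

text \<open>\<open>U\<^sub>q\<close> is the quotient of the free algebra by the two-sided ideal generated by these elements.\<close>

inductive_set uq_rels :: "'i::finite qdatum \<Rightarrow> 'i free_alg set" for D where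
  K_zero: "gK 0 - 1 \<in> uq_rels D"
| K_add: "gK (h + h') - gK h * gK h' \<in> uq_rels D"
| K_E: "gK h * gE i - cst (qpow D (bil D (alpha i) h)) * gE i * gK h \<in> uq_rels D"
| K_F: "gK h * gF i - cst (qpow D (- bil D (alpha i) h)) * gF i * gK h \<in> uq_rels D"
| E_F: "gE i * gF i - gF i * gE i
          - cst (1 / (q_i D i - inverse (q_i D i))) * (gK (alpha i) - gK (- alpha i)) \<in> uq_rels D"
| E_F_ne: "i \<noteq> j \<Longrightarrow> gE i * gF j - gF j * gE i \<in> uq_rels D"
| serre_E: "i \<noteq> j \<Longrightarrow> serre D gE i j \<in> uq_rels D"
| serre_F: "i \<noteq> j \<Longrightarrow> serre D gF i j \<in> uq_rels D"


section \<open>Modules\<close>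

text \<open>A module is a subspace of an ambient complex vector space with an operator for each generator;
  the operators are irrelevant outside the carrier.\<close>

record ('i, 'v) uqmod =
  car :: "'v set"
  act :: "'i gen \<Rightarrow> 'v \<Rightarrow> 'v"

definition act_alg :: "('i, 'v::cvec) uqmod \<Rightarrow> 'i free_alg \<Rightarrow> 'v \<Rightarrow> 'v" where
  "act_alg V x v =
     (\<Sum>w\<in>Poly_Mapping.keys x. Poly_Mapping.lookup x w *\<^sub>C foldr (act V) w v)"

definition uq_module :: "'i::finite qdatum \<Rightarrow> ('i, 'v::cvec) uqmod \<Rightarrow> bool" where
  "uq_module D V \<longleftrightarrow>
     cvec.subspace (car V) \<and>
     (\<forall>g. linear_on (car V) (act V g) \<and> act V g ` car V \<subseteq> car V) \<and>
     (\<forall>r\<in>uq_rels D. \<forall>v\<in>car V. act_alg V r v = 0)"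

definition uq_linear :: "('i, 'v::cvec) uqmod \<Rightarrow> ('i, 'w::cvec) uqmod \<Rightarrow> ('v \<Rightarrow> 'w) \<Rightarrow> bool" where
  "uq_linear V W f \<longleftrightarrow>
     f ` car V \<subseteq> car W \<and> linear_on (car V) f \<and>
     (\<forall>g. \<forall>v\<in>car V. f (act V g v) = act W g (f v))"

definition uq_irreducible :: "('i, 'v::cvec) uqmod \<Rightarrow> bool" where
  "uq_irreducible V \<longleftrightarrow> car V \<noteq> {0} \<and>
     (\<forall>N. cvec.subspace N \<and> N \<subseteq> car V \<and> (\<forall>g. act V g ` N \<subseteq> N) \<longrightarrow> N = {0} \<or> N = car V)"

definition wspace :: "'i::finite qdatum \<Rightarrow> ('i, 'v::cvec) uqmod \<Rightarrow> 'i weight \<Rightarrow> 'v set" where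
  "wspace D V \<mu> = {v \<in> car V. \<forall>h. act V (GK h) v = qpow D (bil D \<mu> h) *\<^sub>C v}"

text \<open>The sum of the weight spaces is automatically direct, since distinct weights
  give distinct characters \<open>h \<mapsto> q\<^bsup>\<mu>(h)\<^esup>\<close>.\<close>

definition M_fd :: "'i::finite qdatum \<Rightarrow> ('i, 'v::cvec) uqmod set" where
  "M_fd D = {V. uq_module D V \<and> (\<exists>B. finite B \<and> car V = cvec.span B) \<and>
     car V = cvec.span (\<Union>\<mu>\<in>weight_lattice D. wspace D V \<mu>)}"


section \<open>Verma modules\<close>

text \<open>The preimage in the free algebra of the left ideal of \<open>U\<^sub>q\<close> generated by all \<open>E\<^sub>i\<close>
  and all \<open>q\<^sup>h - q\<^bsup>lam(h)\<^esup>\<close>.\<close>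

inductive_set verma_ideal :: "'i::finite qdatum \<Rightarrow> 'i weight \<Rightarrow> 'i free_alg set" for D lam where
  zero: "0 \<in> verma_ideal D lam"
| add: "x \<in> verma_ideal D lam \<Longrightarrow> y \<in> verma_ideal D lam \<Longrightarrow> x + y \<in> verma_ideal D lam"
| mult: "x \<in> verma_ideal D lam \<Longrightarrow> a * x \<in> verma_ideal D lam"
| rel: "r \<in> uq_rels D \<Longrightarrow> r * b \<in> verma_ideal D lam"
| E: "gE i \<in> verma_ideal D lam"
| K: "gK h - cst (qpow D (bil D lam h)) \<in> verma_ideal D lam"

text \<open>\<open>M\<close> is a realization of the Verma module \<open>U\<^sub>q / (\<Sum>\<^sub>i U\<^sub>q E\<^sub>i + \<Sum>\<^sub>h U\<^sub>q (q\<^sup>h - q\<^bsup>lam(h)\<^esup>))\<close>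
  in which \<open>m\<close> corresponds to the class of 1, that is, \<open>u \<mapsto> u m\<close> induces an isomorphism from that
  quotient onto \<open>M\<close>.\<close>

definition verma_module ::
    "'i::finite qdatum \<Rightarrow> 'i weight \<Rightarrow> ('i, 'v::cvec) uqmod \<Rightarrow> 'v \<Rightarrow> bool" where
  "verma_module D lam M m \<longleftrightarrow>
     uq_module D M \<and> m \<in> car M \<and> car M = range (\<lambda>x. act_alg M x m) \<and>
     (\<forall>x. act_alg M x m = 0 \<longleftrightarrow> x \<in> verma_ideal D lam)"

definition mstar :: "'i::finite qdatum \<Rightarrow> 'i weight \<Rightarrow> ('i, 'v::cvec) uqmod \<Rightarrow> 'v \<Rightarrow> 'v \<Rightarrow> complex" where
  "mstar D lam M m = (THE f. f \<in> extensional (car M) \<and> linear_on (car M) f \<and>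
     f m = 1 \<and> (\<forall>\<mu>. \<mu> \<noteq> lam \<longrightarrow> (\<forall>x\<in>wspace D M \<mu>. f x = 0)))"

definition h_reg :: "'i::finite qdatum \<Rightarrow> ('i weight \<Rightarrow> ('i, 'v::cvec) uqmod) \<Rightarrow> 'i weight set" where
  "h_reg D M = {lam. (\<forall>\<beta>\<in>roots D. coroot_pairing D lam \<beta> \<notin> \<int>) \<and>
     (\<forall>\<nu>\<in>weight_lattice D. uq_irreducible (M (lam + \<nu>)))}"


section \<open>Tensor products\<close>

text \<open>
  The tensor product of subspaces of \<open>'v\<close> is realized strictly associatively inside the
  functions of lists of linear functionals on \<open>'v\<close>: the pure tensor of \<open>v\<^sub>1, \<dots>, v\<^sub>k\<close> is the function
  sending \<open>[f\<^sub>1, \<dots>, f\<^sub>k]\<close> to \<open>f\<^sub>1 v\<^sub>1 \<cdots> f\<^sub>k v\<^sub>k\<close> and every other list to 0. Since linear functionals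
  separate points, the span of these functions is the algebraic tensor product over \<open>\<complex>\<close>.
\<close>

type_synonym 'v tens = "('v \<Rightarrow> complex) list \<Rightarrow> complex"
type_synonym ('i, 'v) tens_uqmod = "('i, 'v tens) uqmod"

definition tunit :: "'v tens" where
  "tunit fs = (if fs = [] then 1 else 0)"

definition tcons :: "'v::cvec \<Rightarrow> 'v tens \<Rightarrow> 'v tens"  (infixr "\<otimes>" 72) where
  "(v \<otimes> x) fs = (case fs of [] \<Rightarrow> 0 | f # fs' \<Rightarrow> if linear_on UNIV f then f v * x fs' else 0)"

text \<open>\<open>tapp k\<close> is the tensor product of a \<open>k\<close>-fold tensor with a further tensor.\<close>

definition tapp :: "nat \<Rightarrow> 'v tens \<Rightarrow> 'v tens \<Rightarrow> 'v tens" where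
  "tapp k x y fs = x (take k fs) * y (drop k fs)"

definition pure_tensor :: "'v::cvec list \<Rightarrow> 'v tens" where
  "pure_tensor vs = foldr (\<otimes>) vs tunit"

definition tens_space :: "'v::cvec set \<Rightarrow> 'v tens set \<Rightarrow> 'v tens set" where
  "tens_space X Y = cvec.span {x \<otimes> y | x y. x \<in> X \<and> y \<in> Y}"

text \<open>The linear map on \<open>X \<otimes> Y\<close> induced by a bilinear map \<open>b\<close> on \<open>X \<times> Y\<close>.\<close>

definition tens_lift ::
    "'v::cvec set \<Rightarrow> 'v tens set \<Rightarrow> ('v \<Rightarrow> 'v tens \<Rightarrow> 'w::cvec) \<Rightarrow> 'v tens \<Rightarrow> 'w" where
  "tens_lift X Y b = (THE h. h \<in> extensional (tens_space X Y) \<and> linear_on (tens_space X Y) h \<and>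
     (\<forall>x\<in>X. \<forall>y\<in>Y. h (x \<otimes> y) = b x y))"

text \<open>The coproduct is \<open>\<Delta>(E\<^sub>i) = E\<^sub>i \<otimes> q\<^bsup>\<alpha>\<^sub>i\<^esup> + 1 \<otimes> E\<^sub>i\<close>, \<open>\<Delta>(F\<^sub>i) = F\<^sub>i \<otimes> 1 + q\<^bsup>-\<alpha>\<^sub>i\<^esup> \<otimes> F\<^sub>i\<close>,
  \<open>\<Delta>(q\<^sup>h) = q\<^sup>h \<otimes> q\<^sup>h\<close>.\<close>

fun coproduct_act ::
    "('i::finite, 'v::cvec) uqmod \<Rightarrow> ('i, 'v) tens_uqmod \<Rightarrow> 'i gen \<Rightarrow> 'v \<Rightarrow> 'v tens \<Rightarrow> 'v tens" where
  "coproduct_act V X (GE i) v x = act V (GE i) v \<otimes> act X (GK (alpha i)) x + v \<otimes> act X (GE i) x"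
| "coproduct_act V X (GF i) v x = act V (GF i) v \<otimes> x + act V (GK (- alpha i)) v \<otimes> act X (GF i) x"
| "coproduct_act V X (GK h) v x = act V (GK h) v \<otimes> act X (GK h) x"

definition tens_mod ::
    "('i::finite, 'v::cvec) uqmod \<Rightarrow> ('i, 'v) tens_uqmod \<Rightarrow> ('i, 'v) tens_uqmod" where
  "tens_mod V X =
     \<lparr> car = tens_space (car V) (car X),
       act = (\<lambda>g. tens_lift (car V) (car X) (coproduct_act V X g)) \<rparr>"

text \<open>The trivial module, on which the generators act through the counit.\<close>

definition unit_mod :: "('i, 'v::cvec) tens_uqmod" where
  "unit_mod =
     \<lparr> car = cvec.span {tunit},
       act = (\<lambda>g x. case g of GE i \<Rightarrow> 0 | GF i \<Rightarrow> 0 | GK h \<Rightarrow> x) \<rparr>"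

definition tensor :: "('i::finite, 'v::cvec) uqmod list \<Rightarrow> ('i, 'v) tens_uqmod" where
  "tensor Vs = foldr tens_mod Vs unit_mod"

text \<open>\<open>mstar_id D lam M m X\<close> is \<open>m* \<otimes> id\<close> on \<open>M \<otimes> X\<close>,
  where \<open>M\<close> is the Verma module of highest weight \<open>lam\<close>.\<close>

definition mstar_id ::
    "'i::finite qdatum \<Rightarrow> 'i weight \<Rightarrow> ('i, 'v::cvec) uqmod \<Rightarrow> 'v \<Rightarrow> ('i, 'v) tens_uqmod \<Rightarrow>
       'v tens \<Rightarrow> 'v tens" where
  "mstar_id D lam M m X = tens_lift (car M) (car X) (\<lambda>x t. mstar D lam M m x *\<^sub>C t)"

definition id_tens ::
    "('i::finite, 'v::cvec) uqmod \<Rightarrow> ('i, 'v) tens_uqmod \<Rightarrow> ('v tens \<Rightarrow> 'v tens) \<Rightarrow>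
       'v tens \<Rightarrow> 'v tens" where
  "id_tens M X A = tens_lift (car M) (car X) (\<lambda>x t. x \<otimes> A t)"

text \<open>\<open>tens_id M X f\<close> is \<open>f \<otimes> id\<close> on \<open>M \<otimes> X\<close>, for a map \<open>f\<close> from \<open>M\<close> to a twofold tensor product.\<close>

definition tens_id ::
    "('i::finite, 'v::cvec) uqmod \<Rightarrow> ('i, 'v) tens_uqmod \<Rightarrow> ('v \<Rightarrow> 'v tens) \<Rightarrow>
       'v tens \<Rightarrow> 'v tens" where
  "tens_id M X f = tens_lift (car M) (car X) (\<lambda>x t. tapp 2 (f x) t)"


section \<open>Vertex operators and the fusion operator\<close>

text \<open>Below, \<open>M \<mu>\<close> is a realization of the Verma module of highest weight \<open>\<mu>\<close> with highest weight vector \<open>m \<mu>\<close>,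
  for all weights \<open>\<mu>\<close>.\<close>

definition phi ::
    "'i::finite qdatum \<Rightarrow> ('i weight \<Rightarrow> ('i, 'v::cvec) uqmod) \<Rightarrow> ('i weight \<Rightarrow> 'v) \<Rightarrow>
       'i weight \<Rightarrow> ('i, 'v) uqmod \<Rightarrow> 'i weight \<Rightarrow> 'v \<Rightarrow> 'v \<Rightarrow> 'v tens" where
  "phi D M m lam V \<nu> v = (THE f. f \<in> extensional (car (M lam)) \<and>
     uq_linear (M lam) (tensor [M (lam - \<nu>), V]) f \<and>
     mstar_id D (lam - \<nu>) (M (lam - \<nu>)) (m (lam - \<nu>)) (tensor [V]) (f (m lam)) = pure_tensor [v])"

text \<open>The weight \<open>\<nu>\<^sub>j\<close> is an explicit argument since it is not determined by \<open>v\<^sub>j\<close> if \<open>v\<^sub>j = 0\<close>. Without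
  modules, the operator is the identification of \<open>M lam\<close> with the onefold tensor product.\<close>

fun vertex_op ::
    "'i::finite qdatum \<Rightarrow> ('i weight \<Rightarrow> ('i, 'v::cvec) uqmod) \<Rightarrow> ('i weight \<Rightarrow> 'v) \<Rightarrow>
       'i weight \<Rightarrow> ('i, 'v) uqmod list \<Rightarrow> 'i weight list \<Rightarrow> 'v list \<Rightarrow> 'v \<Rightarrow> 'v tens" where
  "vertex_op D M m lam [] [] [] x = pure_tensor [x]"
| "vertex_op D M m lam (V # Vs) (\<nu> # \<nu>s) (v # vs) x =
     (let lam1 = lam - sum_list \<nu>s in
      tens_id (M lam1) (tensor Vs) (phi D M m lam1 V \<nu> v) (vertex_op D M m lam Vs \<nu>s vs x))"

definition weight_vectors ::
    "'i::finite qdatum \<Rightarrow> ('i, 'v::cvec) uqmod list \<Rightarrow> 'i weight list \<Rightarrow> 'v list \<Rightarrow> bool" where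
  "weight_vectors D Vs \<nu>s vs \<longleftrightarrow> length \<nu>s = length Vs \<and> length vs = length Vs \<and>
     (\<forall>i<length Vs. \<nu>s ! i \<in> weight_lattice D \<and> vs ! i \<in> wspace D (Vs ! i) (\<nu>s ! i))"

definition fusion ::
    "'i::finite qdatum \<Rightarrow> ('i weight \<Rightarrow> ('i, 'v::cvec) uqmod) \<Rightarrow> ('i weight \<Rightarrow> 'v) \<Rightarrow>
       ('i, 'v) uqmod list \<Rightarrow> 'i weight \<Rightarrow> 'v tens \<Rightarrow> 'v tens" where
  "fusion D M m Vs lam = (THE j. j \<in> extensional (car (tensor Vs)) \<and> linear_on (car (tensor Vs)) j \<and>
     (\<forall>\<nu>s vs. weight_vectors D Vs \<nu>s vs \<longrightarrow>
        j (pure_tensor vs) =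
          (let lam0 = lam - sum_list \<nu>s in
           mstar_id D lam0 (M lam0) (m lam0) (tensor Vs) (vertex_op D M m lam Vs \<nu>s vs (m lam)))))"

definition conj_fusion ::
    "'i::finite qdatum \<Rightarrow> ('i weight \<Rightarrow> ('i, 'v::cvec) uqmod) \<Rightarrow> ('i weight \<Rightarrow> 'v) \<Rightarrow>
       ('i, 'v) uqmod list \<Rightarrow> ('i, 'v) uqmod list \<Rightarrow> ('v tens \<Rightarrow> 'v tens) \<Rightarrow>
       'i weight \<Rightarrow> 'v tens \<Rightarrow> 'v tens" where
  "conj_fusion D M m Vs Ws A lam =
     inv_into (car (tensor Ws)) (fusion D M m Ws lam) \<circ> A \<circ> fusion D M m Vs lam"

text \<open>An expansion of the tensor \<open>t\<close> of weight \<open>\<nu>\<close> as a finite sum of pure tensors of weight vectors,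
  each of total weight \<open>\<nu>\<close>; \<open>\<eta> n\<close> lists the weights of the vectors \<open>w n\<close>.\<close>

definition homogeneous_expansion ::
    "'i::finite qdatum \<Rightarrow> ('i, 'v::cvec) uqmod list \<Rightarrow> 'i weight \<Rightarrow> 'v tens \<Rightarrow>
       nat \<Rightarrow> (nat \<Rightarrow> 'i weight list) \<Rightarrow> (nat \<Rightarrow> 'v list) \<Rightarrow> bool" where
  "homogeneous_expansion D Ws \<nu> t N \<eta> w \<longleftrightarrow>
     (\<forall>n<N. weight_vectors D Ws (\<eta> n) (w n) \<and> sum_list (\<eta> n) = \<nu>) \<and>
     t = (\<Sum>n<N. pure_tensor (w n))"

end

theory Submission
  imports Defs
begin

text \<open>
  A homomorphism from the Verma module \<open>M\<^bsub>lam\<^esub>\<close> to \<open>M\<^bsub>\<mu>\<^esub> \<otimes> X\<close> with \<open>M\<^bsub>\<mu>\<^esub>\<close> irreducible is determined by its leading term, the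
  image of the highest weight vector under \<open>m* \<otimes> id\<close>. Both sides of the theorem are such homomorphisms
  with the same leading term \<open>A (j\<^sub>S(lam) (v\<^sub>1 \<otimes> \<dots> \<otimes> v\<^sub>k))\<close>, once \<open>j\<^sub>T(lam)\<close> is known to be invertible; this holds because
  \<open>j\<^sub>T(lam)\<close> is triangular with respect to the weights.

  The intertwiners \<open>\<phi>\<^sub>\<lambda>\<^sup>v\<close> exist because a vector of \<open>M\<^bsub>\<mu>\<^esub> \<otimes> V\<close> may be prescribed through its contractions with the
  functionals \<open>x \<mapsto> m*(E\<^sub>w x)\<close>, \<open>w\<close> a word in the simple roots, as long as all linear relations between these
  functionals are respected. The contravariance of \<open>m*(E\<^sub>w F\<^sub>u m)\<close>, the irreducibility of \<open>M\<^bsub>\<mu>\<^esub>\<close> and the freeness of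
  \<open>M\<^bsub>\<mu>\<^esub>\<close> over the negative part show that all these relations come from the Serre relations.
\<close>

section \<open>Linear maps and tensors\<close>

text \<open>By the coproduct of \<open>E_i\<close>, the equation \<open>E_i s = 0\<close> says that
  the contraction of s with the word \<open>w @ [i]\<close> is \<open>-q^(-alpha_i) E_i\<close>
  applied to its contraction with w. So all contractions of a singular vector are forced by its
  leading term, and existence becomes the question whether the forced values respect the relations
  between the functionals. A basis of the negative part and the coproduct of a Serre element are
  both replaced by one computation, \<open>E_serre\<close>: wherever the other defining relations
  hold, every \<open>E_k\<close> commutes with the Serre elements in the \<open>F_i\<close>. It
  makes the Serre ideal in the free module on words stable under the \<open>E_k\<close>, which
  yields freeness, and it lets the Serre relations of a tensor product be checked on leading terms.
  The fusion operator is prescribed on pure tensors of weight vectors only, so a linear map with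
  these values has to be constructed. It exists because intertwiners, being determined by leading
  terms, depend linearly on each vector. Triangularity yields surjectivity; finite dimension then
  yields injectivity.\<close>

definition bilinear_on :: "'a::cvec set \<Rightarrow> 'b::cvec set \<Rightarrow> ('a \<Rightarrow> 'b \<Rightarrow> 'c::cvec) \<Rightarrow> bool" where
  "bilinear_on X Y b \<longleftrightarrow> (\<forall>x\<in>X. linear_on Y (b x)) \<and> (\<forall>y\<in>Y. linear_on X (\<lambda>x. b x y))"

lemma linear_onI:
  assumes "\<And>x y. x \<in> X \<Longrightarrow> y \<in> X \<Longrightarrow> f (x + y) = f x + f y"
    and "\<And>c x. x \<in> X \<Longrightarrow> f (c *\<^sub>C x) = c *\<^sub>C f x"
  shows "linear_on X f"
  using assms by (auto simp: linear_on_def)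

lemma linear_on_add: "linear_on X f \<Longrightarrow> x \<in> X \<Longrightarrow> y \<in> X \<Longrightarrow> f (x + y) = f x + f y"
  by (auto simp: linear_on_def)

lemma linear_on_scale: "linear_on X f \<Longrightarrow> x \<in> X \<Longrightarrow> f (c *\<^sub>C x) = c *\<^sub>C f x"
  by (auto simp: linear_on_def)

lemma linear_on_zero: "linear_on X f \<Longrightarrow> cvec.subspace X \<Longrightarrow> f 0 = 0"
  using linear_on_scale[of X f 0 0] by (auto simp: cvec.subspace_0)

lemma linear_on_uminus: "linear_on X f \<Longrightarrow> x \<in> X \<Longrightarrow> f (- x) = - f x"
  using linear_on_scale[of X f x "-1"] by simp

lemma linear_on_diff:
  "linear_on X f \<Longrightarrow> cvec.subspace X \<Longrightarrow> x \<in> X \<Longrightarrow> y \<in> X \<Longrightarrow> f (x - y) = f x - f y"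
  using linear_on_add[of X f x "- y"] linear_on_uminus[of X f y] cvec.subspace_neg[of X y] by simp

lemma linear_on_sum:
  assumes "linear_on X f" "cvec.subspace X" "\<And>a. a \<in> A \<Longrightarrow> g a \<in> X"
  shows "f (\<Sum>a\<in>A. g a) = (\<Sum>a\<in>A. f (g a))"
proof (cases "finite A")
  case True
  then show ?thesis using assms(3)
  proof (induction A rule: finite_induct)
    case empty
    show ?case using linear_on_zero[OF assms(1,2)] by simp
  next
    case (insert a A)
    then show ?case
      by (simp add: linear_on_add[OF assms(1)] cvec.subspace_sum[OF assms(2)])
  qed
next
  case False
  then show ?thesis using linear_on_zero[OF assms(1,2)] by simp
qed

lemma linear_on_subset: "linear_on X f \<Longrightarrow> Y \<subseteq> X \<Longrightarrow> linear_on Y f"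
  unfolding linear_on_def by blast

lemma linear_on_compose:
  "linear_on X f \<Longrightarrow> f ` X \<subseteq> Y \<Longrightarrow> linear_on Y g \<Longrightarrow> linear_on X (\<lambda>x. g (f x))"
  by (auto simp: linear_on_def image_subset_iff)

lemma linear_on_cong:
  assumes "cvec.subspace X" "\<And>x. x \<in> X \<Longrightarrow> f x = g x"
  shows "linear_on X f = linear_on X g"
  using assms by (auto simp: linear_on_def cvec.subspace_add cvec.subspace_scale)

lemma linear_on_id: "linear_on X (\<lambda>x. x)"
  by (simp add: linear_on_def)

lemma linear_on_0: "linear_on X (\<lambda>x. 0)"
  by (simp add: linear_on_def)

lemma linear_on_plus:
  "linear_on X f \<Longrightarrow> linear_on X g \<Longrightarrow> linear_on X (\<lambda>x. f x + g x)"
  by (auto simp: linear_on_def scaleC_right_distrib)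

lemma linear_on_minus:
  "linear_on X f \<Longrightarrow> linear_on X g \<Longrightarrow> linear_on X (\<lambda>x. f x - g x)"
  by (auto simp: linear_on_def cvec.scale_right_diff_distrib)

lemma linear_on_cmult: "linear_on X f \<Longrightarrow> linear_on X (\<lambda>x. c *\<^sub>C f x)"
  by (auto simp: linear_on_def scaleC_right_distrib scaleC_scaleC mult.commute)

lemma linear_on_scaled: "linear_on X (f :: _ \<Rightarrow> complex) \<Longrightarrow> linear_on X (\<lambda>x. f x *\<^sub>C v)"
  by (auto simp: linear_on_def scaleC_left_distrib scaleC_scaleC scaleC_complex_def)

lemma linear_on_setsum:
  "(\<And>a. a \<in> A \<Longrightarrow> linear_on X (f a)) \<Longrightarrow> linear_on X (\<lambda>x. \<Sum>a\<in>A. f a x)"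
  by (induction A rule: infinite_finite_induct) (auto intro: linear_on_0 linear_on_plus)

text \<open>The add and scale cases keep membership in the span, because \<open>linear_on\<close>
  says nothing about arguments outside the carrier.\<close>

lemma cvec_span_induct [consumes 1, case_names zero add scale base]:
  assumes "x \<in> cvec.span G" and "P 0"
    and "\<And>x y. x \<in> cvec.span G \<Longrightarrow> y \<in> cvec.span G \<Longrightarrow> P x \<Longrightarrow> P y \<Longrightarrow> P (x + y)"
    and "\<And>c x. x \<in> cvec.span G \<Longrightarrow> P x \<Longrightarrow> P (c *\<^sub>C x)"
    and "\<And>x. x \<in> G \<Longrightarrow> P x"
  shows "P x"
proof -
  have "cvec.subspace {x \<in> cvec.span G. P x}"
    using assms(2-4) by (auto simp: cvec.subspace_def cvec.span_zero cvec.span_add cvec.span_scale)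
  then have "cvec.span G \<subseteq> {x \<in> cvec.span G. P x}"
    using assms(5) by (intro cvec.span_minimal) (auto intro: cvec.span_base)
  then show ?thesis using assms(1) by auto
qed

lemma linear_on_span_eqI:
  assumes "linear_on (cvec.span G) f" "linear_on (cvec.span G) g"
    and "\<And>x. x \<in> G \<Longrightarrow> f x = g x" and "x \<in> cvec.span G"
  shows "f x = g x"
  using assms(4)
proof (induction rule: cvec_span_induct)
  case zero
  show ?case
    using linear_on_zero[OF assms(1) cvec.subspace_span] linear_on_zero[OF assms(2) cvec.subspace_span]
    by simp
next
  case (add x y)
  then show ?case by (simp add: linear_on_add[OF assms(1)] linear_on_add[OF assms(2)])
next
  case (scale c x)
  then show ?case by (simp add: linear_on_scale[OF assms(1)] linear_on_scale[OF assms(2)])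
next
  case (base x)
  then show ?case by (rule assms(3))
qed

lemma linear_on_span_image:
  assumes "linear_on (cvec.span G) f" "f ` G \<subseteq> Y" "cvec.subspace Y"
  shows "f ` cvec.span G \<subseteq> Y"
proof (rule image_subsetI)
  fix x assume "x \<in> cvec.span G"
  then show "f x \<in> Y"
  proof (induction rule: cvec_span_induct)
    case zero
    show ?case using linear_on_zero[OF assms(1) cvec.subspace_span] assms(3) by (simp add: cvec.subspace_0)
  next
    case (add x y)
    then show ?case by (simp add: linear_on_add[OF assms(1)] cvec.subspace_add[OF assms(3)])
  next
    case (scale c x)
    then show ?case by (simp add: linear_on_scale[OF assms(1)] cvec.subspace_scale[OF assms(3)])
  next
    case (base x)
    then show ?case using assms(2) by auto
  qed
qed

lemma linear_on_image_span:
  assumes "linear_on (cvec.span G) f"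
  shows "f ` cvec.span G = cvec.span (f ` G)"
proof
  show "f ` cvec.span G \<subseteq> cvec.span (f ` G)"
    by (rule linear_on_span_image[OF assms]) (auto intro: cvec.span_base)
  have "cvec.subspace (f ` cvec.span G)"
    unfolding cvec.subspace_def
  proof (intro conjI allI ballI)
    show "0 \<in> f ` cvec.span G"
      using linear_on_zero[OF assms cvec.subspace_span] cvec.span_zero by (metis imageI)
    show "x + y \<in> f ` cvec.span G" if "x \<in> f ` cvec.span G" "y \<in> f ` cvec.span G" for x y
      using that by (auto simp: linear_on_add[OF assms, symmetric] intro: cvec.span_add)
    show "c *\<^sub>C x \<in> f ` cvec.span G" if "x \<in> f ` cvec.span G" for c x
      using that by (auto simp: linear_on_scale[OF assms, symmetric] intro: cvec.span_scale)
  qed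
  then show "cvec.span (f ` G) \<subseteq> f ` cvec.span G"
    by (intro cvec.span_minimal image_mono) (auto intro: cvec.span_base)
qed

lemma bilinear_on_left: "bilinear_on X Y b \<Longrightarrow> y \<in> Y \<Longrightarrow> linear_on X (\<lambda>x. b x y)"
  and bilinear_on_right: "bilinear_on X Y b \<Longrightarrow> x \<in> X \<Longrightarrow> linear_on Y (b x)"
  by (auto simp: bilinear_on_def)

lemma scaleC_fun_apply: "(c *\<^sub>C f) x = c *\<^sub>C f x"
  by (simp add: scaleC_fun_def)

lemma scaleC_complex: "c *\<^sub>C (x :: complex) = c * x"
  by (simp add: scaleC_complex_def)

lemma sum_fun_apply: "(\<Sum>a\<in>A. f a) x = (\<Sum>a\<in>A. f a x)"
  by (induction A rule: infinite_finite_induct) auto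

section \<open>Pure tensors and the universal property of the tensor space\<close>

lemma tcons_add_left: "(x + y) \<otimes> t = x \<otimes> t + y \<otimes> t"
  by (rule ext) (auto simp: scaleC_fun_apply scaleC_complex tcons_def linear_on_add algebra_simps split: list.splits)

lemma tcons_scale_left: "(c *\<^sub>C x) \<otimes> t = c *\<^sub>C (x \<otimes> t)"
  by (rule ext) (auto simp: scaleC_fun_apply scaleC_complex tcons_def linear_on_scale split: list.splits)

lemma tcons_add_right: "x \<otimes> (s + t) = x \<otimes> s + x \<otimes> t"
  by (rule ext) (auto simp: scaleC_fun_apply scaleC_complex tcons_def algebra_simps split: list.splits)

lemma tcons_scale_right: "x \<otimes> (c *\<^sub>C t) = c *\<^sub>C (x \<otimes> t)"
  by (rule ext) (auto simp: scaleC_fun_apply scaleC_complex tcons_def split: list.splits)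

lemma bilinear_on_tcons: "bilinear_on X Y (\<otimes>)"
  by (auto simp: bilinear_on_def linear_on_def tcons_add_left tcons_add_right tcons_scale_left
    tcons_scale_right)

lemma tcons_zero_left [simp]: "0 \<otimes> t = 0"
  using tcons_scale_left[of 0 0 t] by simp

lemma tcons_zero_right [simp]: "x \<otimes> 0 = 0"
  using tcons_scale_right[of x 0 0] by simp

lemma tens_space_tcons: "x \<in> X \<Longrightarrow> y \<in> Y \<Longrightarrow> x \<otimes> y \<in> tens_space X Y"
  unfolding tens_space_def by (rule cvec.span_base) auto

lemma subspace_tens_space: "cvec.subspace (tens_space X Y)"
  unfolding tens_space_def by (rule cvec.subspace_span)

lemma linear_on_tens_space_eqI:
  assumes "linear_on (tens_space X Y) f" "linear_on (tens_space X Y) g"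
    and "\<And>x y. x \<in> X \<Longrightarrow> y \<in> Y \<Longrightarrow> f (x \<otimes> y) = g (x \<otimes> y)" and "t \<in> tens_space X Y"
  shows "f t = g t"
proof (rule linear_on_span_eqI[where f = f and g = g])
  let ?G = "{x \<otimes> y | x y. x \<in> X \<and> y \<in> Y}"
  show "linear_on (cvec.span ?G) f" "linear_on (cvec.span ?G) g" "t \<in> cvec.span ?G"
    using assms(1,2,4) by (simp_all only: tens_space_def)
qed (use assms(3) in blast)

lemma tens_space_induct [consumes 1, case_names subspace tcons]:
  assumes "t \<in> tens_space X Y" "cvec.subspace {t. P t}"
    and "\<And>x y. x \<in> X \<Longrightarrow> y \<in> Y \<Longrightarrow> P (x \<otimes> y)"
  shows "P t"
proof -
  have "tens_space X Y \<subseteq> {t. P t}"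
    unfolding tens_space_def using assms(2,3) by (intro cvec.span_minimal) auto
  then show ?thesis using assms(1) by auto
qed

text \<open>A tensor is evaluated only at functionals that are linear on the whole ambient space. A
  basis of X is therefore extended to the ambient space before its coordinate functions are
  taken.\<close>

lemma separating_coordinates:
  fixes X :: "'v::cvec set"
  assumes X: "cvec.subspace X"
  shows "\<exists>B (r :: 'v \<Rightarrow> 'v \<Rightarrow> complex). B \<subseteq> X \<and> (\<forall>b. linear_on UNIV (r b)) \<and>
    (\<forall>x\<in>X. finite {b \<in> B. r b x \<noteq> 0} \<and> (\<Sum>b | b \<in> B \<and> r b x \<noteq> 0. r b x *\<^sub>C b) = x)"
proof -
  obtain B where B: "B \<subseteq> X" "cvec.independent B" "X \<subseteq> cvec.span B"
    using cvec.basis_exists[of X] by metis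
  define E where "E = cvec.extend_basis B"
  have E: "cvec.independent E" "cvec.span E = UNIV" "B \<subseteq> E"
    using cvec.independent_extend_basis[OF B(2)] cvec.span_extend_basis[OF B(2)]
      cvec.extend_basis_superset[OF B(2)] by (auto simp: E_def)
  define r where "r b x = cvec.representation E x b" for b x
  have rB: "r b x = cvec.representation B x b" if "x \<in> X" for b x
    using cvec.representation_extend[OF E(1) _ E(3), of x] that B(3) by (auto simp: r_def)
  have ne: "{b \<in> B. r b x \<noteq> 0} = {b. cvec.representation B x b \<noteq> 0}" if "x \<in> X" for x
    using rB[OF that] cvec.representation_ne_zero[of B x] by auto
  show ?thesis
  proof (intro exI[of _ B] exI[of _ r] conjI allI ballI)
    show "linear_on UNIV (r b)" for b
      unfolding linear_on_def r_def
      using E cvec.representation_add[OF E(1)] cvec.representation_scale[OF E(1)] by (auto simp: scaleC_complex)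
    show "finite {b \<in> B. r b x \<noteq> 0}" if "x \<in> X" for x
      using ne[OF that] cvec.finite_representation by auto
    show "(\<Sum>b | b \<in> B \<and> r b x \<noteq> 0. r b x *\<^sub>C b) = x" if "x \<in> X" for x
      using cvec.sum_nonzero_representation_eq[OF B(2), of x] that B(3) ne[OF that] rB[OF that]
      by (simp add: subset_iff)
  qed (fact B)
qed

text \<open>Slicing a tensor at the coordinate functional \<open>r c\<close> gives its Y-valued
  coefficient at the basis vector c of X. The induced map sends t to the sum over c of b applied to
  c and this coefficient, so well-definedness costs nothing.\<close>

lemma tens_lift_exists:
  fixes b :: "'v::cvec \<Rightarrow> 'v tens \<Rightarrow> 'w::cvec"
  assumes X: "cvec.subspace X" and Y: "cvec.subspace Y" and b: "bilinear_on X Y b"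
  shows "\<exists>h. linear_on (tens_space X Y) h \<and> (\<forall>x\<in>X. \<forall>y\<in>Y. h (x \<otimes> y) = b x y)"
proof -
  obtain B and r :: "'v \<Rightarrow> 'v \<Rightarrow> complex" where r: "B \<subseteq> X" "\<forall>b. linear_on UNIV (r b)"
    "\<forall>x\<in>X. finite {b \<in> B. r b x \<noteq> 0} \<and> (\<Sum>b | b \<in> B \<and> r b x \<noteq> 0. r b x *\<^sub>C b) = x"
    using separating_coordinates[OF X] by blast
  then have B: "B \<subseteq> X" "\<And>b. linear_on UNIV (r b)"
    "\<And>x. x \<in> X \<Longrightarrow> finite {b \<in> B. r b x \<noteq> 0}"
    "\<And>x. x \<in> X \<Longrightarrow> (\<Sum>b | b \<in> B \<and> r b x \<noteq> 0. r b x *\<^sub>C b) = x"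
    by blast+
  define sl where "sl c t = (\<lambda>fs. t (r c # fs))" for c and t :: "'v tens"
  have sl_tcons: "sl c (x \<otimes> y) = r c x *\<^sub>C y" for c x y
    by (rule ext) (simp add: scaleC_fun_apply scaleC_complex sl_def tcons_def B(2))
  have sl_add: "sl c (s + t) = sl c s + sl c t" for c s t
    by (rule ext) (simp add: scaleC_fun_apply scaleC_complex sl_def)
  have sl_scale: "sl c (a *\<^sub>C t) = a *\<^sub>C sl c t" for c a t
    by (rule ext) (simp add: scaleC_fun_apply scaleC_complex sl_def)
  have slY: "sl c t \<in> Y" if "t \<in> tens_space X Y" for c t
    using that
  proof (induction rule: tens_space_induct)
    case subspace
    have "sl c 0 = 0" by (rule ext) (simp add: scaleC_fun_apply scaleC_complex sl_def)
    then show ?case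
      by (intro cvec.subspaceI)
        (simp_all add: sl_add sl_scale cvec.subspace_0[OF Y] cvec.subspace_add[OF Y] cvec.subspace_scale[OF Y])
  next
    case (tcons x y)
    then show ?case unfolding sl_tcons by (intro cvec.subspace_scale[OF Y])
  qed
  \<comment> \<open>Verma modules are infinite-dimensional, so B may be infinite and the sum
    defining h needs finite support.\<close>
  have slfin: "finite {c \<in> B. sl c t \<noteq> 0}" if "t \<in> tens_space X Y" for t
    using that
  proof (induction rule: tens_space_induct)
    case subspace
    have z: "sl c 0 = 0" for c by (rule ext) (simp add: scaleC_fun_apply scaleC_complex sl_def)
    have "finite {c \<in> B. sl c (s + t) \<noteq> 0}"
      if "finite {c \<in> B. sl c s \<noteq> 0}" "finite {c \<in> B. sl c t \<noteq> 0}" for s t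
      by (rule finite_subset[OF _ finite_UnI[OF that]]) (auto simp: sl_add)
    moreover have "finite {c \<in> B. sl c (a *\<^sub>C t) \<noteq> 0}" if "finite {c \<in> B. sl c t \<noteq> 0}" for a t
      by (rule finite_subset[OF _ that]) (auto simp: sl_scale)
    moreover have "finite {c \<in> B. sl c 0 \<noteq> 0}" unfolding z by simp
    ultimately show ?case by (intro cvec.subspaceI) blast+
  next
    case (tcons x y)
    show ?case by (rule finite_subset[OF _ B(3)[OF tcons(1)]]) (auto simp: sl_tcons)
  qed
  define h where "h t = (\<Sum>c | c \<in> B \<and> sl c t \<noteq> 0. b c (sl c t))" for t
  have b0: "b c 0 = 0" if "c \<in> B" for c
    using linear_on_zero[OF bilinear_on_right[OF b] Y] that B(1) by auto
  have hS: "h t = (\<Sum>c\<in>S. b c (sl c t))" if "finite S" "S \<subseteq> B" "{c \<in> B. sl c t \<noteq> 0} \<subseteq> S" for S t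
    unfolding h_def using that b0 by (intro sum.mono_neutral_left) (auto simp: subset_iff)
  have "linear_on (tens_space X Y) h"
  proof (rule linear_onI)
    fix s t assume st: "s \<in> tens_space X Y" "t \<in> tens_space X Y"
    define S where "S = {c \<in> B. sl c s \<noteq> 0} \<union> {c \<in> B. sl c t \<noteq> 0}"
    have S: "finite S" "S \<subseteq> B" using slfin[OF st(1)] slfin[OF st(2)] by (auto simp: S_def)
    have "b c (sl c (s + t)) = b c (sl c s) + b c (sl c t)" if "c \<in> S" for c
      using linear_on_add[OF bilinear_on_right[OF b], of c "sl c s" "sl c t"] that S(2) B(1) slY[OF st(1)] slY[OF st(2)]
      by (auto simp: sl_add)
    moreover have "{c \<in> B. sl c (s + t) \<noteq> 0} \<subseteq> S" by (auto simp: S_def sl_add)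
    moreover have "{c \<in> B. sl c s \<noteq> 0} \<subseteq> S" "{c \<in> B. sl c t \<noteq> 0} \<subseteq> S" by (auto simp: S_def)
    ultimately show "h (s + t) = h s + h t" using hS[OF S] by (simp add: sum.distrib)
  next
    fix a t assume t: "t \<in> tens_space X Y"
    have "b c (sl c (a *\<^sub>C t)) = a *\<^sub>C b c (sl c t)" if "c \<in> B" for c
      using linear_on_scale[OF bilinear_on_right[OF b], of c "sl c t"] that B(1) slY[OF t]
      by (auto simp: sl_scale)
    moreover have "{c \<in> B. sl c (a *\<^sub>C t) \<noteq> 0} \<subseteq> {c \<in> B. sl c t \<noteq> 0}" by (auto simp: sl_scale)
    ultimately show "h (a *\<^sub>C t) = a *\<^sub>C h t"
      using hS[OF slfin[OF t]] by (simp add: cvec.scale_sum_right)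
  qed
  moreover have "h (x \<otimes> y) = b x y" if xy: "x \<in> X" "y \<in> Y" for x y
  proof -
    let ?S = "{c \<in> B. r c x \<noteq> 0}"
    have "h (x \<otimes> y) = (\<Sum>c\<in>?S. b c (sl c (x \<otimes> y)))"
      using B(3)[OF xy(1)] by (intro hS) (auto simp: sl_tcons)
    also have "\<dots> = (\<Sum>c\<in>?S. b (r c x *\<^sub>C c) y)"
    proof (rule sum.cong)
      fix c assume "c \<in> ?S"
      then have "c \<in> X" using B(1) by auto
      then show "b c (sl c (x \<otimes> y)) = b (r c x *\<^sub>C c) y"
        using linear_on_scale[OF bilinear_on_right[OF b]] linear_on_scale[OF bilinear_on_left[OF b]] xy
        by (simp add: sl_tcons)
    qed simp
    also have "\<dots> = b (\<Sum>c\<in>?S. r c x *\<^sub>C c) y"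
      using B(1) by (intro linear_on_sum[OF bilinear_on_left[OF b xy(2)] X, symmetric])
        (auto intro!: cvec.subspace_scale[OF X])
    finally show ?thesis using B(4)[OF xy(1)] by simp
  qed
  ultimately show ?thesis by blast
qed

lemma tens_lift_spec:
  assumes X: "cvec.subspace X" and Y: "cvec.subspace Y" and b: "bilinear_on X Y b"
  shows "tens_lift X Y b \<in> extensional (tens_space X Y)" (is ?A)
    and linear_on_tens_lift: "linear_on (tens_space X Y) (tens_lift X Y b)" (is ?B)
    and tens_lift_tcons: "x \<in> X \<Longrightarrow> y \<in> Y \<Longrightarrow> tens_lift X Y b (x \<otimes> y) = b x y"
proof -
  let ?P = "\<lambda>h. h \<in> extensional (tens_space X Y) \<and> linear_on (tens_space X Y) h \<and>
     (\<forall>x\<in>X. \<forall>y\<in>Y. h (x \<otimes> y) = b x y)"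
  obtain h where h: "linear_on (tens_space X Y) h" "\<forall>x\<in>X. \<forall>y\<in>Y. h (x \<otimes> y) = b x y"
    using tens_lift_exists[OF assms] by blast
  let ?h = "restrict h (tens_space X Y)"
  have "linear_on (tens_space X Y) ?h"
    using h(1) linear_on_cong[OF subspace_tens_space, of X Y ?h h] by simp
  then have Ph: "?P ?h" using h(2) by (auto simp: tens_space_tcons)
  have uniq: "f = ?h" if Pf: "?P f" for f
  proof (rule extensionalityI[of f "tens_space X Y"])
    show "f t = ?h t" if t: "t \<in> tens_space X Y" for t
      by (rule linear_on_tens_space_eqI[where g = ?h, OF _ _ _ t]) ((use Pf Ph in blast)+, use Pf Ph in metis)
  qed (use Pf Ph in blast)+
  have "?P (tens_lift X Y b)"
    unfolding tens_lift_def by (rule theI[of ?P ?h]) (fact Ph, fact uniq)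
  then show ?A ?B "x \<in> X \<Longrightarrow> y \<in> Y \<Longrightarrow> tens_lift X Y b (x \<otimes> y) = b x y" by blast+
qed

section \<open>Powers of q and q-binomial coefficients\<close>

lemma qpow_exp: "qdatum D \<Longrightarrow> qpow D z = exp (z * of_real (ln (qpar D)))"
  by (auto simp: qpow_def powr_def qdatum_def Ln_of_real)

lemma qpow_add: "qdatum D \<Longrightarrow> qpow D (y + z) = qpow D y * qpow D z"
  by (simp add: qpow_exp distrib_right exp_add)

lemma qpow_0: "qdatum D \<Longrightarrow> qpow D 0 = 1"
  by (simp add: qpow_exp)

lemma qpow_minus: "qdatum D \<Longrightarrow> qpow D (- z) = inverse (qpow D z)"
  by (simp add: qpow_exp exp_minus)

lemma qpow_nonzero: "qdatum D \<Longrightarrow> qpow D z \<noteq> 0"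
  by (simp add: qpow_exp)

lemma qpow_power: "qdatum D \<Longrightarrow> qpow D (of_nat n * z) = qpow D z ^ n"
  by (induction n) (simp_all add: qpow_0 qpow_add distrib_right)

lemma bil_add_left: "bil D (x + y) z = bil D x z + bil D y z"
  by (simp add: bil_def distrib_right sum.distrib)

lemma bil_add_right: "bil D x (y + z) = bil D x y + bil D x z"
  by (simp add: bil_def distrib_right distrib_left sum.distrib)

lemma bil_minus_left: "bil D (- x) z = - bil D x z"
  by (simp add: bil_def sum_negf)

lemma bil_minus_right: "bil D x (- z) = - bil D x z"
  by (simp add: bil_def sum_negf)

lemma bil_zero_left: "bil D 0 z = 0"
  by (simp add: bil_def)

lemma bil_zero_right: "bil D z 0 = 0"
  by (simp add: bil_def)

lemma bil_scale_right: "bil D x (c *s y) = c * bil D x y"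
  by (simp add: bil_def sum_distrib_left mult_ac)

lemma bil_commute:
  assumes "qdatum D" shows "bil D x y = bil D y x"
proof -
  have s: "dsym D i * of_int (cmat D i j) = dsym D j * of_int (cmat D j i)" for i j
    using assms by (simp add: qdatum_def)
  have s': "(of_real (dsym D i) * of_int (cmat D i j) :: complex) = of_real (dsym D j) * of_int (cmat D j i)" for i j
    using arg_cong[OF s[of i j], of "of_real :: real \<Rightarrow> complex"] by simp
  have "bil D x y = (\<Sum>i\<in>UNIV. \<Sum>j\<in>UNIV. y $ j * x $ i * of_real (dsym D j) * of_int (cmat D j i))"
    unfolding bil_def by (intro sum.cong refl) (use s' in \<open>simp add: mult.assoc mult.left_commute\<close>)
  also have "\<dots> = bil D y x"
    unfolding bil_def by (rule sum.swap)
  finally show ?thesis .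
qed

lemma bil_alpha: "bil D (alpha i) (alpha j) = of_real (dsym D i) * of_int (cmat D i j)"
  by (simp add: bil_def alpha_def axis_def if_distrib [of "\<lambda>x. x * _"] if_distrib [of "\<lambda>x. _ * x"]
    cong: if_cong)

definition qw :: "'i::finite qdatum \<Rightarrow> 'i weight \<Rightarrow> 'i weight \<Rightarrow> complex" where
  "qw D \<mu> h = qpow D (bil D \<mu> h)"

context
  fixes D :: "'i::finite qdatum"
  assumes D: "qdatum D"
begin

lemma qw_add_left: "qw D (x + y) h = qw D x h * qw D y h"
  by (simp add: qw_def bil_add_left qpow_add D)

lemma qw_add_right: "qw D x (h + k) = qw D x h * qw D x k"
  by (simp add: qw_def bil_add_right qpow_add D)

lemma qw_minus_left: "qw D (- x) h = inverse (qw D x h)"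
  by (simp add: qw_def bil_minus_left qpow_minus D)

lemma qw_minus_right: "qw D x (- h) = inverse (qw D x h)"
  by (simp add: qw_def bil_minus_right qpow_minus D)

lemma qw_diff_left: "qw D (x - y) h = qw D x h / qw D y h"
  using qw_add_left[of x "- y" h] by (simp add: qw_minus_left divide_inverse)

lemma qw_zero_left [simp]: "qw D 0 h = 1"
  by (simp add: qw_def bil_zero_left qpow_0 D)

lemma qw_zero_right [simp]: "qw D x 0 = 1"
  by (simp add: qw_def bil_zero_right qpow_0 D)

lemma qw_nonzero [simp]: "qw D x h \<noteq> 0"
  by (simp add: qw_def qpow_nonzero D)

lemma qw_commute: "qw D x h = qw D h x"
  by (simp add: qw_def bil_commute[OF D, of x h])

text \<open>Two facts enter: the exponential detects a nonzero linear form on a complex space,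
  although it is periodic, and the form is nondegenerate because its real version is positive
  definite.\<close>

lemma qw_eqD:
  assumes "\<And>h. qw D \<mu> h = qw D \<kappa> h"
  shows "\<mu> = \<kappa>"
proof (rule ccontr)
  assume ne: "\<mu> \<noteq> \<kappa>"
  define \<delta> where "\<delta> = \<mu> - \<kappa>"
  have one: "qw D \<delta> h = 1" for h using assms[of h] by (simp add: \<delta>_def qw_diff_left)
  have q: "0 < qpar D" "qpar D < 1" using D by (auto simp: qdatum_def)
  define L where "L = (of_real (ln (qpar D)) :: complex)"
  have "L \<noteq> 0" using q by (simp add: L_def)
  have z: "bil D \<delta> h = 0" for h
  proof (rule ccontr)
    assume nz: "bil D \<delta> h \<noteq> 0"
    \<comment> \<open>Rescaling h by a complex number makes the exponent exactly 1, which is not a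
      period of exp.\<close>
    have "qw D \<delta> ((1 / (bil D \<delta> h * L)) *s h) = exp 1"
      using nz \<open>L \<noteq> 0\<close> by (simp add: qw_def qpow_exp[OF D] bil_scale_right L_def[symmetric])
    moreover have "exp (1 :: complex) \<noteq> 1"
    proof
      assume "exp (1 :: complex) = 1"
      then have "norm (exp (1 :: complex)) = 1" by simp
      then show False by simp
    qed
    ultimately show False using one by simp
  qed
  define Q where "Q x = (\<Sum>i\<in>UNIV. \<Sum>j\<in>UNIV. x $ i * x $ j * dsym D i * of_int (cmat D i j))"
    for x :: "real ^ 'i"
  have Qpos: "x \<noteq> 0 \<Longrightarrow> Q x > 0" for x using D by (auto simp: qdatum_def Q_def)
  have Q0: "Q x \<ge> 0" for x using Qpos[of x] by (cases "x = 0") (auto simp: Q_def)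
  have Q00: "Q x = 0 \<Longrightarrow> x = 0" for x using Qpos[of x] by fastforce
  \<comment> \<open>Pairing \<delta> with its complex conjugate turns the bilinear form into a sum
    of two values of the positive definite real form Q.\<close>
  let ?R = "\<chi> i. Re (\<delta> $ i)" and ?I = "\<chi> i. Im (\<delta> $ i)"
  have "Re (bil D \<delta> (\<chi> i. cnj (\<delta> $ i))) = Q ?R + Q ?I"
    unfolding bil_def Q_def by (simp add: sum.distrib[symmetric] algebra_simps)
  then have "Q ?R = 0" "Q ?I = 0" using z Q0[of ?R] Q0[of ?I] by simp_all
  then have "?R = 0" "?I = 0" using Q00 by blast+
  then have "\<delta> = 0" by (auto simp: vec_eq_iff complex_eq_iff)
  then show False using ne by (simp add: \<delta>_def)
qed

lemma qpar_q_i: "q_i D i = of_real (exp (dsym D i * ln (qpar D)))"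
  by (simp add: q_i_def qpow_exp[OF D] exp_of_real[symmetric])

text \<open>\<open>q_i\<close> is a real number strictly between 0 and 1, so its positive powers lie
  below 1 and their inverses above. Hence no nonzero q-integer vanishes and the q-binomials have no
  zero denominators.\<close>

lemma q_i_power_neq: "k \<noteq> 0 \<Longrightarrow> q_i D i ^ k \<noteq> inverse (q_i D i) ^ k"
proof
  assume k: "k \<noteq> 0" and eq: "q_i D i ^ k = inverse (q_i D i) ^ k"
  define x where "x = exp (dsym D i * ln (qpar D))"
  have x: "0 < x" "x < 1" using D by (auto simp: x_def qdatum_def mult_pos_neg)
  have "of_real (x ^ k) = (of_real (inverse x ^ k) :: complex)"
    using eq unfolding qpar_q_i x_def[symmetric] by (simp add: power_inverse)
  then have "x ^ k = inverse x ^ k" using of_real_eq_iff by blast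
  moreover have "x ^ k < 1" using x k by (simp add: power_less_one_iff)
  moreover have "inverse x ^ k > 1" using x k by (simp add: one_less_inverse power_inverse power_less_one_iff)
  ultimately show False by simp
qed

lemma q_i_nonzero [simp]: "q_i D i \<noteq> 0"
  by (simp add: q_i_def qpow_nonzero D)

lemma qw_alpha_self: "qw D (alpha i) (alpha i) = q_i D i ^ 2"
proof -
  have "cmat D i i = 2" using D by (simp add: qdatum_def)
  then show ?thesis
    using qpow_power[OF D, of 2 "of_real (dsym D i)"] by (simp add: qw_def bil_alpha q_i_def mult.commute)
qed

lemma qw_alpha_neq:
  assumes "i \<noteq> j"
  shows "qw D (alpha i) (alpha j) = inverse (q_i D i ^ nat (- cmat D i j))"
    and "qw D (alpha j) (alpha i) = inverse (q_i D i ^ nat (- cmat D i j))"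
proof -
  define n where "n = nat (- cmat D i j)"
  have "cmat D i j = - int n" using D assms by (simp add: qdatum_def n_def)
  then have "qw D (alpha i) (alpha j) = qpow D (- (of_nat n * of_real (dsym D i)))"
    by (simp add: qw_def bil_alpha mult.commute)
  then show "qw D (alpha i) (alpha j) = inverse (q_i D i ^ nat (- cmat D i j))"
    by (simp add: qpow_minus[OF D] qpow_power[OF D] q_i_def n_def)
  then show "qw D (alpha j) (alpha i) = inverse (q_i D i ^ nat (- cmat D i j))"
    using qw_commute[of "alpha i" "alpha j"] by simp
qed

end

section \<open>q-integers and alternating sums of q-binomial coefficients\<close>

lemma qint_inverse: "p \<noteq> 0 \<Longrightarrow> qint (inverse p) n = qint p n"
  using minus_divide_divide[of "p ^ n - inverse p ^ n" "p - inverse p"] by (simp add: qint_def)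

lemma qbinom_inverse: "p \<noteq> 0 \<Longrightarrow> qbinom (inverse p) n k = qbinom p n k"
  by (simp add: qbinom_def qfact_def qint_inverse)

lemma qint_0 [simp]: "qint p 0 = 0"
  by (simp add: qint_def)

lemma qfact_0 [simp]: "qfact p 0 = 1"
  by (simp add: qfact_def)

lemma qfact_Suc: "qfact p (Suc n) = qint p (Suc n) * qfact p n"
  by (simp add: qfact_def)

context
  fixes p :: complex
  assumes p0: "p \<noteq> 0" and pk: "\<And>k. k \<noteq> 0 \<Longrightarrow> p ^ k \<noteq> inverse p ^ k"
begin

lemma p_diff: "p - inverse p \<noteq> 0"
  using pk[of 1] by simp

lemma qint_nonzero: "k \<noteq> 0 \<Longrightarrow> qint p k \<noteq> 0"
  using p_diff pk[of k] by (simp add: qint_def)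

lemma qfact_nonzero: "qfact p k \<noteq> 0"
  by (induction k) (simp_all add: qfact_Suc qint_nonzero)

lemma qint_add: "qint p (k + l) = p ^ k * qint p l + inverse p ^ l * qint p k"
  using p_diff by (simp add: qint_def add_divide_distrib[symmetric] algebra_simps power_add)

lemma qint_Suc: "qint p (Suc k) = p * qint p k + inverse p ^ k"
  and qint_Suc': "qint p (Suc k) = inverse p * qint p k + p ^ k"
proof -
  have 1: "qint p 1 = 1" using p_diff by (simp add: qint_def)
  show "qint p (Suc k) = p * qint p k + inverse p ^ k" using qint_add[of 1 k] 1 by simp
  show "qint p (Suc k) = inverse p * qint p k + p ^ k" using qint_add[of k 1] 1 by simp
qed

lemma qbinom_0: "qbinom p n 0 = 1"
  using qfact_nonzero by (simp add: qbinom_def)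

lemma qbinom_self: "qbinom p n n = 1"
  using qfact_nonzero by (simp add: qbinom_def)

text \<open>This identity cancels neighbouring terms when \<open>E_i\<close> is commuted with a
  Serre element in \<open>E_serre\<close>.\<close>

lemma qbinom_step: "r < n \<Longrightarrow> qbinom p n r * qint p (n - r) = qbinom p n (Suc r) * qint p (Suc r)"
proof -
  assume "r < n"
  then obtain l where l: "n = Suc (r + l)" using less_imp_Suc_add by blast
  show ?thesis
    using qfact_nonzero[of r] qfact_nonzero[of l] qint_nonzero[of "Suc r"] qint_nonzero[of "Suc l"]
    by (simp add: qbinom_def l Suc_diff_le qfact_Suc)
qed

lemma qbinom_Pascal:
  assumes "k < m"
  shows "qbinom p (Suc m) (Suc k) = p ^ Suc k * qbinom p m (Suc k) + inverse p ^ (m - k) * qbinom p m k"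
proof -
  obtain l where m: "m = Suc (k + l)" using assms less_imp_Suc_add by blast
  have *: "qint p (Suc m) = p ^ Suc k * qint p (Suc l) + inverse p ^ Suc l * qint p (Suc k)"
    using qint_add[of "Suc k" "Suc l"] by (simp add: m)
  have d: "m - k = Suc l" "m - Suc k = l" by (simp_all add: m)
  have nz: "qfact p k \<noteq> 0" "qfact p l \<noteq> 0" "qint p (Suc k) \<noteq> 0" "qint p (Suc l) \<noteq> 0"
    using qfact_nonzero qint_nonzero by auto
  have "qbinom p (Suc m) (Suc k) = qint p (Suc m) * qfact p m / (qint p (Suc k) * qfact p k * (qint p (Suc l) * qfact p l))"
    by (simp add: qbinom_def d qfact_Suc)
  also have "\<dots> = p ^ Suc k * (qfact p m / (qint p (Suc k) * qfact p k * qfact p l))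
      + inverse p ^ Suc l * (qfact p m / (qfact p k * (qint p (Suc l) * qfact p l)))"
    unfolding * using nz by (simp add: field_simps del: power_Suc)
  also have "\<dots> = p ^ Suc k * qbinom p m (Suc k) + inverse p ^ (m - k) * qbinom p m k"
    by (simp add: qbinom_def d qfact_Suc del: power_Suc)
  finally show ?thesis .
qed

text \<open>The partial sums telescope by the Pascal identity.\<close>

lemma qbinom_alternating_partial:
  "k \<le> m \<Longrightarrow> (\<Sum>r\<le>k. (- 1) ^ r * qbinom p (Suc m) r * (p ^ m) ^ r) = (- 1) ^ k * qbinom p m k * (p ^ Suc m) ^ k"
proof (induction k)
  case 0
  show ?case by (simp add: qbinom_0)
next
  case (Suc k)
  define x y z where "x = (p ^ m) ^ Suc k" and "y = (p ^ Suc m) ^ Suc k" and "z = (p ^ Suc m) ^ k"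
  define B where "B = qbinom p (Suc m) (Suc k)"
  have e: "m * Suc k = (m - k) + Suc m * k" using Suc.prems by simp
  have "x = p ^ (m - k) * z"
    unfolding x_def z_def power_mult[symmetric] e by (rule power_add)
  then have xz: "inverse p ^ (m - k) * x = z" using p0 by (simp add: power_inverse)
  have xy: "p ^ Suc k * x = y"
    unfolding x_def y_def power_mult_distrib[symmetric] by (simp only: power_Suc)
  have "B * x = qbinom p m (Suc k) * (p ^ Suc k * x) + qbinom p m k * (inverse p ^ (m - k) * x)"
    unfolding B_def qbinom_Pascal[OF Suc_le_lessD[OF Suc.prems]] by (simp only: algebra_simps)
  then have B: "B * x = qbinom p m (Suc k) * y + qbinom p m k * z"
    by (simp only: xz xy)
  have "(\<Sum>r\<le>Suc k. (- 1) ^ r * qbinom p (Suc m) r * (p ^ m) ^ r) =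
      (- 1) ^ k * qbinom p m k * z + (- 1) ^ Suc k * (B * x)"
    using Suc unfolding x_def z_def B_def by (simp only: sum.atMost_Suc mult.assoc)
  then show ?case unfolding B y_def[symmetric] by (simp add: algebra_simps)
qed

text \<open>By the q-binomial theorem the sum is the value at z = 1 of the product of the factors 1
  - p^(2k) z for 0 \<le> k \<le> m, and the factor with k = 0 vanishes. It settles the commutator
  with \<open>E_j\<close> in \<open>E_serre\<close>.\<close>

lemma qbinom_alternating: "(\<Sum>r\<le>Suc m. (- 1) ^ r * qbinom p (Suc m) r * (p ^ m) ^ r) = 0"
proof -
  have "(p ^ Suc m) ^ m = (p ^ m) ^ Suc m"
    by (simp add: power_mult[symmetric] mult.commute del: power_Suc)
  then show ?thesis using qbinom_alternating_partial[of m m]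
    by (simp add: qbinom_self mult.assoc)
qed

end

lemma qbinom_alternating_inverse:
  assumes "p \<noteq> 0" and "\<And>k. k \<noteq> 0 \<Longrightarrow> p ^ k \<noteq> inverse p ^ k"
  shows "(\<Sum>r\<le>Suc m. (- 1) ^ r * qbinom p (Suc m) r * (inverse p ^ m) ^ r) = 0"
proof -
  have "(\<Sum>r\<le>Suc m. (- 1) ^ r * qbinom (inverse p) (Suc m) r * (inverse p ^ m) ^ r) = 0"
  proof (rule qbinom_alternating)
    show "inverse p \<noteq> 0" using assms(1) by simp
    show "inverse p ^ k \<noteq> inverse (inverse p) ^ k" if "k \<noteq> 0" for k
      using assms(2)[OF that] by simp
  qed
  then show ?thesis by (simp add: qbinom_inverse[OF assms(1)])
qed

section \<open>Modules without Serre relations\<close>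

lemma free_alg_induct [case_names zero single add]:
  fixes x :: "'i free_alg"
  assumes "P 0" and "\<And>w c. P (Poly_Mapping.single w c)" and "\<And>x y. P x \<Longrightarrow> P y \<Longrightarrow> P (x + y)"
  shows "P x"
proof -
  have "x = (\<Sum>w\<in>Poly_Mapping.keys x. Poly_Mapping.single w (Poly_Mapping.lookup x w))"
    by (rule poly_mapping_eqI)
      (auto simp: lookup_sum lookup_single when_def in_keys_iff sum.If_cases)
  moreover have "P (\<Sum>w\<in>S. Poly_Mapping.single w (Poly_Mapping.lookup x w))" if "finite S" for S
    using that by induction (auto intro: assms)
  ultimately show ?thesis by (metis finite_keys)
qed

lemma act_alg_sum:
  assumes "finite S" "Poly_Mapping.keys x \<subseteq> S"
  shows "act_alg V x v = (\<Sum>w\<in>S. Poly_Mapping.lookup x w *\<^sub>C foldr (act V) w v)"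
  unfolding act_alg_def using assms by (intro sum.mono_neutral_left) (auto simp: in_keys_iff)

lemma act_alg_add: "act_alg V (x + y) v = act_alg V x v + act_alg V y v"
proof -
  let ?S = "Poly_Mapping.keys x \<union> Poly_Mapping.keys y"
  have "act_alg V z v = (\<Sum>w\<in>?S. Poly_Mapping.lookup z w *\<^sub>C foldr (act V) w v)"
    if "Poly_Mapping.keys z \<subseteq> ?S" for z
    using that by (intro act_alg_sum) auto
  from this[of "x + y"] this[of x] this[of y] show ?thesis
    by (simp add: Poly_Mapping.keys_add lookup_add scaleC_left_distrib sum.distrib)
qed

lemma act_alg_single: "act_alg V (Poly_Mapping.single w c) v = c *\<^sub>C foldr (act V) w v"
  by (subst act_alg_sum[of "{w}"]) auto

lemma act_alg_zero [simp]: "act_alg V 0 v = 0"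
  by (simp add: act_alg_def)

lemma act_alg_uminus: "act_alg V (- x) v = - act_alg V x v"
  using act_alg_add[of V x "- x" v] by (simp add: eq_neg_iff_add_eq_0 add.commute)

lemma act_alg_diff: "act_alg V (x - y) v = act_alg V x v - act_alg V y v"
  using act_alg_add[of V x "- y" v] by (simp add: act_alg_uminus)

lemma act_alg_setsum: "act_alg V (\<Sum>a\<in>A. f a) v = (\<Sum>a\<in>A. act_alg V (f a) v)"
  by (induction A rule: infinite_finite_induct) (simp_all add: act_alg_add)

lemma act_alg_one [simp]:
  fixes V :: "('i, 'v::cvec) uqmod"
  shows "act_alg V 1 v = v"
proof -
  have "(1 :: 'i free_alg) = Poly_Mapping.single [] 1" by (simp add: zero_list_def[symmetric])
  then show ?thesis using act_alg_single[of V "[]" 1 v] by (simp only: scaleC_one foldr.simps id_apply)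
qed

lemma act_alg_cst [simp]: "act_alg V (cst c) v = c *\<^sub>C v"
  by (simp add: cst_def act_alg_single)

lemma act_alg_gen [simp]:
  "act_alg V (gE i) v = act V (GE i) v" "act_alg V (gF i) v = act V (GF i) v"
  "act_alg V (gK h) v = act V (GK h) v"
  by (simp_all add: gE_def gF_def gK_def act_alg_single scaleC_one)

lemma act_alg_mult_linear:
  assumes X: "cvec.subspace (car V)"
    and act: "\<And>g. linear_on (car V) (act V g)" "\<And>g. act V g ` car V \<subseteq> car V"
    and v: "v \<in> car V"
  shows "foldr (act V) w v \<in> car V" and "linear_on (car V) (foldr (act V) w)"
    and "act_alg V x v \<in> car V" and "linear_on (car V) (act_alg V x)"
    and "act_alg V (x * y) v = act_alg V x (act_alg V y v)"
proof -
  have word: "foldr (act V) w v \<in> car V" if "v \<in> car V" for w v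
    using that act(2) by (induction w) (auto simp: image_subset_iff)
  then show "foldr (act V) w v \<in> car V" using v .
  have lin: "linear_on (car V) (foldr (act V) w)" for w
  proof (induction w)
    case Nil
    show ?case by (simp add: linear_on_def)
  next
    case (Cons g w)
    have "linear_on (car V) (\<lambda>v. act V g (foldr (act V) w v))"
      by (rule linear_on_compose[OF Cons _ act(1)]) (use word in auto)
    then show ?case by (simp add: o_def)
  qed
  show "linear_on (car V) (foldr (act V) w)" by (rule lin)
  have alg: "act_alg V x v \<in> car V" if "v \<in> car V" for x v
    unfolding act_alg_def by (intro cvec.subspace_sum[OF X] cvec.subspace_scale[OF X] word that)
  then show "act_alg V x v \<in> car V" using v .
  show "linear_on (car V) (act_alg V x)"
    unfolding act_alg_def by (intro linear_on_setsum linear_on_cmult lin)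
  show "act_alg V (x * y) v = act_alg V x (act_alg V y v)"
  proof (induction x rule: free_alg_induct)
    case (single w c)
    show ?case
    proof (induction y rule: free_alg_induct)
      case (single u d)
      show ?case
        using linear_on_scale[OF lin word[OF v], of w d u]
        by (simp add: mult_single act_alg_single plus_list_def scaleC_scaleC)
    next
      case (add y z)
      then show ?case
        using linear_on_add[OF lin alg[OF v] alg[OF v], of w y z]
        by (simp add: distrib_left act_alg_add act_alg_single scaleC_right_distrib)
    qed (use linear_on_zero[OF lin X, of w] in \<open>simp add: act_alg_single\<close>)
  next
    case (add x y)
    then show ?case by (simp add: distrib_right act_alg_add)
  qed simp
qed

definition wt :: "'i::finite list \<Rightarrow> 'i weight" where
  "wt w = sum_list (map alpha w)"

lemma wt_simps [simp]: "wt [] = 0" "wt (i # w) = alpha i + wt w" "wt (u @ w) = wt u + wt w"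
  by (simp_all add: wt_def)

lemma wt_rev [simp]: "wt (rev w) = wt w"
  by (induction w) (simp_all add: add.commute)

lemma wt_replicate: "wt (replicate n i) = of_nat n *s alpha i"
  by (induction n) (simp_all add: vec_eq_iff algebra_simps)

lemma wt_coordinate_sum: "(\<Sum>i\<in>UNIV. wt w $ i) = of_nat (length w)"
  by (induction w) (simp_all add: sum.distrib alpha_def axis_def)

lemma wt_eq_0_iff [simp]: "wt w = 0 \<longleftrightarrow> w = []"
proof
  assume "wt w = 0"
  then show "w = []" using wt_coordinate_sum[of w] by simp
qed simp

text \<open>The family f is arbitrary because the same expression is applied to the
  \<open>E_i\<close>, to the \<open>F_i\<close>, to their actions on the word model and to the
  rescaled operators \<open>twisted_E\<close>.\<close>

definition serre_op :: "'i qdatum \<Rightarrow> ('i \<Rightarrow> 'v \<Rightarrow> 'v::cvec) \<Rightarrow> 'i \<Rightarrow> 'i \<Rightarrow> 'v \<Rightarrow> 'v" where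
  "serre_op D f i j v = (let n = nat (1 - cmat D i j) in
     \<Sum>r\<le>n. ((- 1) ^ r * qbinom (q_i D i) n r) *\<^sub>C (f i ^^ (n - r)) (f j ((f i ^^ r) v)))"

text \<open>A module over the algebra with all defining relations except the Serre relations. Tensor
  products satisfy these axioms by a check on generators, and so does the free module on words;
  Serre relations are then treated as separate facts about such modules.\<close>

locale premodule =
  fixes D :: "'i::finite qdatum" and X :: "('i, 'v::cvec) uqmod"
  assumes D: "qdatum D"
    and subspace_car: "cvec.subspace (car X)"
    and linear_act: "\<And>g. linear_on (car X) (act X g)"
    and act_subset: "\<And>g. act X g ` car X \<subseteq> car X"
    and K_zero: "\<And>v. v \<in> car X \<Longrightarrow> act X (GK 0) v = v"
    and K_add: "\<And>h k v. v \<in> car X \<Longrightarrow> act X (GK (h + k)) v = act X (GK h) (act X (GK k) v)"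
    and K_E: "\<And>h i v. v \<in> car X \<Longrightarrow>
      act X (GK h) (act X (GE i) v) = qw D (alpha i) h *\<^sub>C act X (GE i) (act X (GK h) v)"
    and K_F: "\<And>h i v. v \<in> car X \<Longrightarrow>
      act X (GK h) (act X (GF i) v) = qw D (- alpha i) h *\<^sub>C act X (GF i) (act X (GK h) v)"
    and E_F: "\<And>i j v. v \<in> car X \<Longrightarrow> act X (GE i) (act X (GF j) v) = act X (GF j) (act X (GE i) v) +
      (if i = j then (1 / (q_i D i - inverse (q_i D i))) *\<^sub>C
         (act X (GK (alpha i)) v - act X (GK (- alpha i)) v) else 0)"
begin

abbreviation "E i \<equiv> act X (GE i)"
abbreviation "F i \<equiv> act X (GF i)"
abbreviation "K h \<equiv> act X (GK h)"

lemma act_in [simp, intro]: "v \<in> car X \<Longrightarrow> act X g v \<in> car X"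
  using act_subset by auto

lemma word_map_in [simp, intro]: "v \<in> car X \<Longrightarrow> foldr (\<lambda>i. act X (f i)) w v \<in> car X"
  by (induction w) auto

lemma funpow_in [simp, intro]: "v \<in> car X \<Longrightarrow> (act X g ^^ n) v \<in> car X"
  by (induction n) auto

lemma alg_in [simp, intro]: "v \<in> car X \<Longrightarrow> act_alg X x v \<in> car X"
  by (intro act_alg_mult_linear subspace_car linear_act act_subset)

lemma act_alg_mult: "v \<in> car X \<Longrightarrow> act_alg X (x * y) v = act_alg X x (act_alg X y v)"
  by (intro act_alg_mult_linear subspace_car linear_act act_subset)

lemma zero_in [simp]: "0 \<in> car X"
  by (rule cvec.subspace_0[OF subspace_car])

lemma add_in [simp, intro]: "u \<in> car X \<Longrightarrow> v \<in> car X \<Longrightarrow> u + v \<in> car X"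
  by (rule cvec.subspace_add[OF subspace_car])

lemma diff_in [simp, intro]: "u \<in> car X \<Longrightarrow> v \<in> car X \<Longrightarrow> u - v \<in> car X"
  by (rule cvec.subspace_diff[OF subspace_car])

lemma scale_in [simp, intro]: "v \<in> car X \<Longrightarrow> c *\<^sub>C v \<in> car X"
  by (rule cvec.subspace_scale[OF subspace_car])

lemma sum_in [intro]: "(\<And>a. a \<in> A \<Longrightarrow> f a \<in> car X) \<Longrightarrow> sum f A \<in> car X"
  by (rule cvec.subspace_sum[OF subspace_car])

lemma act_zero [simp]: "act X g 0 = 0"
  by (rule linear_on_zero[OF linear_act subspace_car])

lemma act_add: "u \<in> car X \<Longrightarrow> v \<in> car X \<Longrightarrow> act X g (u + v) = act X g u + act X g v"
  by (rule linear_on_add[OF linear_act])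

lemma act_diff: "u \<in> car X \<Longrightarrow> v \<in> car X \<Longrightarrow> act X g (u - v) = act X g u - act X g v"
  by (rule linear_on_diff[OF linear_act subspace_car])

lemma act_scale: "v \<in> car X \<Longrightarrow> act X g (c *\<^sub>C v) = c *\<^sub>C act X g v"
  by (rule linear_on_scale[OF linear_act])

lemma act_sum: "(\<And>a. a \<in> A \<Longrightarrow> f a \<in> car X) \<Longrightarrow> act X g (sum f A) = (\<Sum>a\<in>A. act X g (f a))"
  by (rule linear_on_sum[OF linear_act subspace_car])

lemma linear_word: "linear_on (car X) (foldr (\<lambda>i. act X (f i)) w)"
proof (induction w)
  case Nil
  show ?case by (simp add: linear_on_def)
next
  case (Cons g w)
  have "linear_on (car X) (\<lambda>v. act X (f g) (foldr (\<lambda>i. act X (f i)) w v))"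
    by (rule linear_on_compose[OF Cons _ linear_act]) auto
  then show ?case by (simp add: o_def)
qed

lemma linear_funpow: "linear_on (car X) (act X g ^^ n)"
proof (induction n)
  case 0
  show ?case by (simp add: linear_on_def)
next
  case (Suc n)
  have "linear_on (car X) (\<lambda>v. act X g ((act X g ^^ n) v))"
    by (rule linear_on_compose[OF Suc _ linear_act]) auto
  then show ?case by (simp add: o_def)
qed

lemmas act_funpow_add = linear_on_add[OF linear_funpow]
  and act_funpow_diff = linear_on_diff[OF linear_funpow subspace_car]
  and act_funpow_scale = linear_on_scale[OF linear_funpow]

lemma K_minus: "v \<in> car X \<Longrightarrow> K (- h) (K h v) = v" "v \<in> car X \<Longrightarrow> K h (K (- h) v) = v"
  using K_add[of v "- h" h] K_add[of v h "- h"] K_zero by simp_all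

lemma K_commute: "v \<in> car X \<Longrightarrow> K h (K k v) = K k (K h v)"
  using K_add[of v h k] K_add[of v k h] by (simp add: add.commute)

lemma K_eq_0_iff: "v \<in> car X \<Longrightarrow> K h v = 0 \<longleftrightarrow> v = 0"
  using K_minus(1)[of v h] by auto

lemma K_F_funpow: "v \<in> car X \<Longrightarrow> K h ((F i ^^ r) v) = qw D (- alpha i) h ^ r *\<^sub>C (F i ^^ r) (K h v)"
  by (induction r) (simp_all add: scaleC_one K_F act_scale scaleC_scaleC)

lemma E_F_funpow_neq: "v \<in> car X \<Longrightarrow> i \<noteq> k \<Longrightarrow> E k ((F i ^^ r) v) = (F i ^^ r) (E k v)"
  by (induction r) (simp_all add: E_F)

text \<open>The rank one commutation formula, with the factors
  \<open>q^(\<plusminus>alpha_i)\<close> collected to the right of the powers of \<open>F_i\<close>.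
  The truncated subtraction at s = 0 is harmless because \<open>qint p 0 = 0\<close>.\<close>

lemma E_F_funpow:
  fixes i
  assumes "v \<in> car X"
  defines "p \<equiv> q_i D i"
  shows "E i ((F i ^^ s) v) = (F i ^^ s) (E i v) + (qint p s / (p - inverse p)) *\<^sub>C
    (F i ^^ (s - 1)) (inverse p ^ (s - 1) *\<^sub>C K (alpha i) v - p ^ (s - 1) *\<^sub>C K (- alpha i) v)"
proof (induction s)
  case 0
  show ?case by simp
next
  case (Suc s)
  define c where "c = 1 / (p - inverse p)"
  define a b where "a = (F i ^^ s) (K (alpha i) v)" and "b = (F i ^^ s) (K (- alpha i) v)"
  have ab: "a \<in> car X" "b \<in> car X" using assms(1) by (auto simp: a_def b_def)
  have p: "p \<noteq> 0" by (simp add: p_def D)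
  note pk = q_i_power_neq[OF D, of _ i, folded p_def]
  have qSuc: "qint p (Suc s) = p * qint p s + inverse p ^ s"
    "qint p (Suc s) = inverse p * qint p s + p ^ s"
    by (rule qint_Suc[OF p pk] qint_Suc'[OF p pk]; assumption)+
  have qF: "qw D (- alpha i) (alpha i) = inverse p ^ 2" "qw D (- alpha i) (- alpha i) = p ^ 2"
    by (simp_all add: qw_minus_left qw_minus_right D qw_alpha_self p_def power_inverse)
  have Kab: "K (alpha i) ((F i ^^ s) v) = (inverse p ^ 2) ^ s *\<^sub>C a"
    "K (- alpha i) ((F i ^^ s) v) = (p ^ 2) ^ s *\<^sub>C b"
    using assms(1) by (simp_all add: K_F_funpow qF a_def b_def)
  have F1: "F i ((qint p s / (p - inverse p)) *\<^sub>C (F i ^^ (s - 1)) (inverse p ^ (s - 1) *\<^sub>C K (alpha i) v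
      - p ^ (s - 1) *\<^sub>C K (- alpha i) v))
    = (c * qint p s) *\<^sub>C (inverse p ^ (s - 1) *\<^sub>C a - p ^ (s - 1) *\<^sub>C b)"
  proof (cases s)
    case (Suc t)
    show ?thesis unfolding Suc using assms(1)
      by (simp add: Suc a_def b_def c_def act_scale act_diff act_funpow_diff act_funpow_scale)
  qed simp
  have "E i ((F i ^^ Suc s) v) = F i (E i ((F i ^^ s) v)) +
      c *\<^sub>C (K (alpha i) ((F i ^^ s) v) - K (- alpha i) ((F i ^^ s) v))"
    using assms(1) by (simp add: E_F c_def p_def)
  also have "F i (E i ((F i ^^ s) v)) = (F i ^^ Suc s) (E i v) +
      (c * qint p s) *\<^sub>C (inverse p ^ (s - 1) *\<^sub>C a - p ^ (s - 1) *\<^sub>C b)"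
    unfolding Suc.IH using assms(1) by (subst act_add) (auto simp: F1[simplified])
  also have "(F i ^^ Suc s) (E i v) + (c * qint p s) *\<^sub>C (inverse p ^ (s - 1) *\<^sub>C a - p ^ (s - 1) *\<^sub>C b)
      + c *\<^sub>C (K (alpha i) ((F i ^^ s) v) - K (- alpha i) ((F i ^^ s) v))
    = (F i ^^ Suc s) (E i v) + ((c * (qint p s * inverse p ^ (s - 1) + (inverse p ^ 2) ^ s)) *\<^sub>C a
      - (c * (qint p s * p ^ (s - 1) + (p ^ 2) ^ s)) *\<^sub>C b)"
    unfolding Kab by (simp add: cvec.scale_right_diff_distrib scaleC_scaleC cvec.scale_left_distrib distrib_left mult.assoc)
  also have "qint p s * inverse p ^ (s - 1) + (inverse p ^ 2) ^ s = qint p (Suc s) * inverse p ^ s"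
  proof (cases s)
    case (Suc t)
    have "qint p (Suc s) * inverse p ^ s = qint p s * (p * inverse p ^ s) + inverse p ^ s * inverse p ^ s"
      unfolding qSuc(1) by (simp add: algebra_simps)
    moreover have "p * inverse p ^ s = inverse p ^ (s - 1)" using p Suc by simp
    ultimately show ?thesis by (simp add: power2_eq_square power_mult_distrib)
  qed (use p pk[of 1] in \<open>simp add: qint_def\<close>)
  also have "qint p s * p ^ (s - 1) + (p ^ 2) ^ s = qint p (Suc s) * p ^ s"
  proof (cases s)
    case (Suc t)
    have "qint p (Suc s) * p ^ s = qint p s * (inverse p * p ^ s) + p ^ s * p ^ s"
      unfolding qSuc(2) by (simp add: algebra_simps)
    moreover have "inverse p * p ^ s = p ^ (s - 1)" using p Suc by simp
    ultimately show ?thesis by (simp add: power2_eq_square power_mult_distrib)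
  qed (use p pk[of 1] in \<open>simp add: qint_def\<close>)
  also have "(c * (qint p (Suc s) * inverse p ^ s)) *\<^sub>C a - (c * (qint p (Suc s) * p ^ s)) *\<^sub>C b
    = (qint p (Suc s) / (p - inverse p)) *\<^sub>C
      (F i ^^ (Suc s - 1)) (inverse p ^ (Suc s - 1) *\<^sub>C K (alpha i) v - p ^ (Suc s - 1) *\<^sub>C K (- alpha i) v)"
    using assms(1) by (simp add: a_def b_def c_def act_funpow_diff act_funpow_scale
      cvec.scale_right_diff_distrib scaleC_scaleC)
  finally show ?case .
qed

end

section \<open>Serre elements\<close>

context premodule
begin

lemma serre_in [simp, intro]:
  "v \<in> car X \<Longrightarrow> serre_op D F i j v \<in> car X" "v \<in> car X \<Longrightarrow> serre_op D E i j v \<in> car X"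
  by (auto simp: serre_op_def Let_def intro!: sum_in)

lemma linear_serre: "linear_on (car X) (serre_op D (\<lambda>i. act X (f i)) i j)"
  unfolding serre_op_def Let_def
proof (intro linear_on_setsum linear_on_cmult)
  fix r
  let ?n = "nat (1 - cmat D i j)"
  have "linear_on (car X) (\<lambda>v. act X (f j) ((act X (f i) ^^ r) v))"
    by (rule linear_on_compose[OF linear_funpow _ linear_act]) auto
  then show "linear_on (car X) (\<lambda>v. (act X (f i) ^^ (?n - r)) (act X (f j) ((act X (f i) ^^ r) v)))"
    by (rule linear_on_compose[OF _ _ linear_funpow]) auto
qed

lemma K_serre_F:
  assumes v: "v \<in> car X"
  shows "K h (serre_op D F i j v) = serre_op D F i j
    ((qw D (- alpha i) h ^ nat (1 - cmat D i j) * qw D (- alpha j) h) *\<^sub>C K h v)"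
  unfolding linear_on_scale[OF linear_serre act_in[OF v]] unfolding serre_op_def Let_def using v
  by (subst act_sum)
    (auto simp: act_scale K_F_funpow K_F act_funpow_scale scaleC_scaleC cvec.scale_sum_right mult_ac
      power_add[symmetric] intro!: sum.cong)

text \<open>Each commutator \<open>[E_k, F_k]\<close> only leaves factors
  \<open>q^(\<plusminus>alpha_k)\<close>. For k = j the leftover terms are multiples of one vector
  with vanishing alternating coefficient sum; for k = i they cancel in neighbouring pairs; for other
  k there are none.\<close>

lemma E_serre:
  assumes ij: "i \<noteq> j" and v: "v \<in> car X"
  shows "E k (serre_op D F i j v) = serre_op D F i j (E k v)"
proof -
  define p where "p = q_i D i"
  define m where "m = nat (- cmat D i j)"
  define c where "c r = (- 1) ^ r * qbinom p (Suc m) r" for r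
  have "cmat D i j \<le> 0" using D ij by (simp add: qdatum_def)
  then have n: "nat (1 - cmat D i j) = Suc m" by (simp add: m_def)
  have p: "p \<noteq> 0" by (simp add: p_def D)
  note pk = q_i_power_neq[OF D, of _ i, folded p_def]
  have S: "serre_op D F i j u = (\<Sum>r\<le>Suc m. c r *\<^sub>C (F i ^^ (Suc m - r)) (F j ((F i ^^ r) u)))" for u
    by (simp only: serre_op_def Let_def n p_def[symmetric] c_def[symmetric])
  have ES: "E k (serre_op D F i j v) = (\<Sum>r\<le>Suc m. c r *\<^sub>C E k ((F i ^^ (Suc m - r)) (F j ((F i ^^ r) v))))"
    unfolding S using v by (subst act_sum) (auto simp: act_scale)
  consider "k \<noteq> i" "k \<noteq> j" | "k = j" | "k = i" by blast
  then show ?thesis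
  proof cases
    case 1
    then show ?thesis unfolding ES unfolding S using v by (simp add: E_F_funpow_neq E_F)
  next
    case 2
    define d where "d = 1 / (q_i D j - inverse (q_i D j))"
    define a b where "a = K (alpha j) v" and "b = K (- alpha j) v"
    have ab: "a \<in> car X" "b \<in> car X" using v by (auto simp: a_def b_def)
    have u: "qw D (- alpha i) (alpha j) = p ^ m" "qw D (- alpha i) (- alpha j) = inverse p ^ m"
      using qw_alpha_neq[OF D ij] by (simp_all add: qw_minus_left qw_minus_right D p_def m_def power_inverse)
    \<comment> \<open>Moving \<open>q^(\<plusminus>alpha_j)\<close> past \<open>F_i^r\<close>
      contributes the r-th power of \<open>p^(\<plusminus>m)\<close>. The remaining vector is the
      same for all r.\<close>
    have "E k ((F i ^^ (Suc m - r)) (F j ((F i ^^ r) v))) = (F i ^^ (Suc m - r)) (F j ((F i ^^ r) (E k v)))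
        + (d * (p ^ m) ^ r) *\<^sub>C (F i ^^ Suc m) a - (d * (inverse p ^ m) ^ r) *\<^sub>C (F i ^^ Suc m) b"
      if "r \<le> Suc m" for r
    proof -
      have f: "(F i ^^ (Suc m - r)) ((F i ^^ r) w) = (F i ^^ Suc m) w" for w
        using that by (metis comp_apply funpow_add le_add_diff_inverse2)
      have "E k ((F i ^^ (Suc m - r)) (F j ((F i ^^ r) v))) = (F i ^^ (Suc m - r)) (E j (F j ((F i ^^ r) v)))"
        using v ij 2 by (simp add: E_F_funpow_neq)
      also have "E j (F j ((F i ^^ r) v)) = F j ((F i ^^ r) (E k v)) +
          (d * (p ^ m) ^ r) *\<^sub>C (F i ^^ r) a - (d * (inverse p ^ m) ^ r) *\<^sub>C (F i ^^ r) b"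
        using v ij 2 by (simp add: E_F E_F_funpow_neq K_F_funpow u d_def[symmetric] a_def b_def
          cvec.scale_right_diff_distrib scaleC_scaleC)
      finally show ?thesis using ab v
        by (simp add: act_funpow_add act_funpow_diff act_funpow_scale f del: funpow.simps)
    qed
    then have "E k (serre_op D F i j v) = (\<Sum>r\<le>Suc m. c r *\<^sub>C (F i ^^ (Suc m - r)) (F j ((F i ^^ r) (E k v)))
        + (d * (c r * (p ^ m) ^ r)) *\<^sub>C (F i ^^ Suc m) a - (d * (c r * (inverse p ^ m) ^ r)) *\<^sub>C (F i ^^ Suc m) b)"
      unfolding ES by (intro sum.cong refl)
        (simp add: scaleC_right_distrib cvec.scale_right_diff_distrib scaleC_scaleC mult.left_commute del: funpow.simps)
    also have "\<dots> = serre_op D F i j (E k v) + (d * (\<Sum>r\<le>Suc m. c r * (p ^ m) ^ r)) *\<^sub>C (F i ^^ Suc m) a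
        - (d * (\<Sum>r\<le>Suc m. c r * (inverse p ^ m) ^ r)) *\<^sub>C (F i ^^ Suc m) b"
      unfolding S by (simp only: sum.distrib sum_subtractf cvec.scale_sum_left[symmetric] sum_distrib_left)
    also have "(\<Sum>r\<le>Suc m. c r * (p ^ m) ^ r) = 0"
      unfolding c_def by (rule qbinom_alternating[OF p pk])
    also have "(\<Sum>r\<le>Suc m. c r * (inverse p ^ m) ^ r) = 0"
      unfolding c_def by (rule qbinom_alternating_inverse[OF p pk])
    finally show ?thesis by simp
  next
    case 3
    define d where "d = 1 / (p - inverse p)"
    define a b where "a = K (alpha i) v" and "b = K (- alpha i) v"
    have ab: "a \<in> car X" "b \<in> car X" using v by (auto simp: a_def b_def)
    have u: "qw D (- alpha j) (alpha i) = p ^ m" "qw D (- alpha j) (- alpha i) = inverse p ^ m"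
      "qw D (- alpha i) (alpha i) = inverse p ^ 2" "qw D (- alpha i) (- alpha i) = p ^ 2"
      using qw_alpha_neq[OF D ij]
      by (simp_all add: qw_minus_left qw_minus_right D p_def m_def power_inverse qw_alpha_self)
    define z where "z r s t = (F i ^^ r) (F j ((F i ^^ s) (inverse p ^ t *\<^sub>C a - p ^ t *\<^sub>C b)))" for r s t
    have EF: "E i ((F i ^^ s) w) = (F i ^^ s) (E i w) + (qint p s * d) *\<^sub>C
        (F i ^^ (s - 1)) (inverse p ^ (s - 1) *\<^sub>C K (alpha i) w - p ^ (s - 1) *\<^sub>C K (- alpha i) w)"
      if "w \<in> car X" for s w
      using E_F_funpow[OF that, of i s] by (simp add: p_def d_def)
    have term_r: "E k ((F i ^^ (Suc m - r)) (F j ((F i ^^ r) v))) = (F i ^^ (Suc m - r)) (F j ((F i ^^ r) (E k v)))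
        + (qint p (Suc m - r) * d) *\<^sub>C z (m - r) r r + (qint p r * d) *\<^sub>C z (Suc m - r) (r - 1) (r - 1)"
      if r: "r \<le> Suc m" for r
    proof -
      let ?w = "F j ((F i ^^ r) v)"
      have w: "?w \<in> car X" using v by auto
      have "E i ?w = F j (E i ((F i ^^ r) v))" using v ij by (simp add: E_F)
      also have "\<dots> = F j ((F i ^^ r) (E k v)) +
          (qint p r * d) *\<^sub>C F j ((F i ^^ (r - 1)) (inverse p ^ (r - 1) *\<^sub>C a - p ^ (r - 1) *\<^sub>C b))"
        unfolding EF[OF v] a_def[symmetric] b_def[symmetric] 3 using v ab by (subst act_add) (auto simp: act_scale)
      finally have Ew: "(F i ^^ (Suc m - r)) (E i ?w) = (F i ^^ (Suc m - r)) (F j ((F i ^^ r) (E k v)))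
          + (qint p r * d) *\<^sub>C z (Suc m - r) (r - 1) (r - 1)"
        using v ab by (simp add: z_def act_funpow_add act_funpow_scale)
      have Kw: "K (alpha i) ?w = (p ^ m * (inverse p ^ 2) ^ r) *\<^sub>C F j ((F i ^^ r) a)"
        "K (- alpha i) ?w = (inverse p ^ m * (p ^ 2) ^ r) *\<^sub>C F j ((F i ^^ r) b)"
        using v by (simp_all add: K_F K_F_funpow u a_def b_def act_scale scaleC_scaleC)
      have "(qint p (Suc m - r) * d) *\<^sub>C (F i ^^ (Suc m - r - 1)) (inverse p ^ (Suc m - r - 1) *\<^sub>C K (alpha i) ?w
          - p ^ (Suc m - r - 1) *\<^sub>C K (- alpha i) ?w) = (qint p (Suc m - r) * d) *\<^sub>C z (m - r) r r"
      proof (cases "r = Suc m")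
        case False
        then obtain l where l: "m = r + l" using r le_Suc_eq nat_le_iff_add by auto
        \<comment> \<open>Passing \<open>F_j F_i^r\<close> changes the exponent -(m - r) of p into
          -r, and likewise with opposite signs. This gives the terms from the left of
          \<open>F_j\<close> the same shape z as those from its right.\<close>
        have e: "inverse p ^ l * (p ^ m * (inverse p ^ 2) ^ r) = inverse p ^ r"
          "p ^ l * (inverse p ^ m * (p ^ 2) ^ r) = p ^ r"
          using p by (simp_all add: l power_add power_mult[symmetric] power_inverse mult_2 field_simps power2_eq_square power_mult_distrib)
        have d': "Suc m - r - 1 = l" "m - r = l" using l by auto
        show ?thesis unfolding Kw z_def d' scaleC_scaleC e
          using ab by (simp add: act_diff act_scale act_funpow_diff act_funpow_scale)
      qed simp
      then show ?thesis unfolding 3 EF[OF w] using Ew 3 by simp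
    qed
    \<comment> \<open>\<open>A r\<close> arises from an \<open>F_i\<close> to the left of
      \<open>F_j\<close>, \<open>B r\<close> from one to its right. Both \<open>A r\<close> and
      \<open>B (Suc r)\<close> are multiples of \<open>z (m - r) r r\<close>, with opposite
      coefficients by \<open>qbinom_step\<close>.\<close>
    define A where "A r = (c r * (qint p (Suc m - r) * d)) *\<^sub>C z (m - r) r r" for r
    define B where "B r = (c r * (qint p r * d)) *\<^sub>C z (Suc m - r) (r - 1) (r - 1)" for r
    have "E k (serre_op D F i j v) = (\<Sum>r\<le>Suc m. c r *\<^sub>C (F i ^^ (Suc m - r)) (F j ((F i ^^ r) (E k v))) + A r + B r)"
      unfolding ES by (intro sum.cong refl)
        (simp add: term_r scaleC_right_distrib scaleC_scaleC A_def B_def)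
    also have "\<dots> = serre_op D F i j (E k v) + ((\<Sum>r\<le>Suc m. A r) + (\<Sum>r\<le>Suc m. B r))"
      unfolding S by (simp only: sum.distrib add.assoc)
    also have "(\<Sum>r\<le>Suc m. A r) = (\<Sum>r\<le>m. A r)" by (simp add: A_def)
    also have "(\<Sum>r\<le>Suc m. B r) = (\<Sum>r\<le>m. B (Suc r))"
      by (subst sum.atMost_Suc_shift) (simp add: B_def)
    also have "(\<Sum>r\<le>m. A r) + (\<Sum>r\<le>m. B (Suc r)) = (\<Sum>r\<le>m. A r + B (Suc r))"
      by (simp add: sum.distrib)
    also have "\<dots> = 0"
    proof (intro sum.neutral ballI)
      fix r assume "r \<in> {..m}"
      then have "qbinom p (Suc m) r * qint p (Suc m - r) = qbinom p (Suc m) (Suc r) * qint p (Suc r)"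
        by (intro qbinom_step[OF p pk]) auto
      then have "c r * (qint p (Suc m - r) * d) + c (Suc r) * (qint p (Suc r) * d) = 0"
        by (simp add: c_def algebra_simps)
      then show "A r + B (Suc r) = 0"
        by (simp add: A_def B_def scaleC_left_distrib[symmetric])
    qed
    finally show ?thesis by simp
  qed
qed

end

text \<open>The Chevalley involution.\<close>

definition swap_gen :: "'i::finite gen \<Rightarrow> 'i gen" where
  "swap_gen g = (case g of GE i \<Rightarrow> GF i | GF i \<Rightarrow> GE i | GK h \<Rightarrow> GK (- h))"

definition swap_mod :: "('i::finite, 'v) uqmod \<Rightarrow> ('i, 'v) uqmod" where
  "swap_mod X = \<lparr>car = car X, act = (\<lambda>g. act X (swap_gen g))\<rparr>"

lemma (in premodule) premodule_swap: "premodule D (swap_mod X)"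
proof
  fix i j v assume "v \<in> car (swap_mod X)"
  then have v: "v \<in> car X" by (simp add: swap_mod_def)
  show "act (swap_mod X) (GE i) (act (swap_mod X) (GF j) v) =
      act (swap_mod X) (GF j) (act (swap_mod X) (GE i) v) +
      (if i = j then (1 / (q_i D i - inverse (q_i D i))) *\<^sub>C
         (act (swap_mod X) (GK (alpha i)) v - act (swap_mod X) (GK (- alpha i)) v) else 0)"
    using v E_F[of v j i] by (auto simp: swap_mod_def swap_gen_def cvec.scale_right_diff_distrib)
qed (auto simp: swap_mod_def swap_gen_def D subspace_car linear_act K_zero K_add K_E K_F
    qw_minus_right qw_minus_left K_add[of _ "- _" "- _", simplified])

lemma (in premodule) F_serre:
  assumes "i \<noteq> j" "v \<in> car X"
  shows "F k (serre_op D E i j v) = serre_op D E i j (F k v)"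
  using premodule.E_serre[OF premodule_swap assms(1), of v k] assms(2)
  by (simp add: swap_mod_def swap_gen_def)

section \<open>Freeness of Verma modules\<close>

context premodule
begin

lemma act_alg_power: "v \<in> car X \<Longrightarrow> act_alg X (gE i ^ n) v = (E i ^^ n) v"
    "v \<in> car X \<Longrightarrow> act_alg X (gF i ^ n) v = (F i ^^ n) v"
  by (induction n) (simp_all add: act_alg_mult)

lemma act_alg_serre:
  assumes "v \<in> car X"
  shows "act_alg X (serre D gE i j) v = serre_op D E i j v"
    and "act_alg X (serre D gF i j) v = serre_op D F i j v"
  using assms by (simp_all add: serre_def serre_op_def Let_def act_alg_setsum act_alg_mult act_alg_power)

text \<open>The axioms of \<open>premodule\<close> make every other relation act as 0, so only Serre
  elements have to be examined when a map out of the quantum group is checked.\<close>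

lemma act_alg_rel:
  assumes "r \<in> uq_rels D" "v \<in> car X"
  shows "act_alg X r v = 0 \<or> (\<exists>i j. i \<noteq> j \<and>
    (act_alg X r v = serre_op D E i j v \<or> act_alg X r v = serre_op D F i j v))"
proof -
  note EF = E_F
  from assms(1) show ?thesis
  proof cases
    case (E_F i)
    then show ?thesis using assms(2) EF[of v i i] by (simp add: act_alg_diff act_alg_mult)
  next
    case (E_F_ne i j)
    then show ?thesis using assms(2) EF[of v i j] by (simp add: act_alg_diff act_alg_mult)
  qed (use assms(2) in \<open>auto simp: act_alg_diff act_alg_mult act_alg_serre K_zero K_add K_E K_F qw_def bil_minus_left\<close>)
qed

end

lemma
  assumes D: "qdatum D" and V: "uq_module D V"
  shows uq_module_premodule: "premodule D V"
    and uq_module_serre: "i \<noteq> j \<Longrightarrow> v \<in> car V \<Longrightarrow> serre_op D (\<lambda>i. act V (GE i)) i j v = 0"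
      "i \<noteq> j \<Longrightarrow> v \<in> car V \<Longrightarrow> serre_op D (\<lambda>i. act V (GF i)) i j v = 0"
proof -
  have V': "cvec.subspace (car V)" "\<And>g. linear_on (car V) (act V g)" "\<And>g. act V g ` car V \<subseteq> car V"
    and rel: "\<And>r v. r \<in> uq_rels D \<Longrightarrow> v \<in> car V \<Longrightarrow> act_alg V r v = 0"
    using V by (auto simp: uq_module_def)
  have m: "v \<in> car V \<Longrightarrow> act_alg V (x * y) v = act_alg V x (act_alg V y v)" for x y v
    using act_alg_mult_linear(5)[OF V'] .
  have [simp]: "v \<in> car V \<Longrightarrow> act V g v \<in> car V" for g v
    using V'(3) by auto
  show P: "premodule D V"
  proof
    fix v h k i assume v: "v \<in> car V"
    show "act V (GK 0) v = v"
      using rel[OF uq_rels.K_zero v] by (simp add: act_alg_diff)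
    show "act V (GK (h + k)) v = act V (GK h) (act V (GK k) v)"
      using rel[OF uq_rels.K_add v, of h k] v by (simp add: act_alg_diff m)
    show "act V (GK h) (act V (GE i) v) = qw D (alpha i) h *\<^sub>C act V (GE i) (act V (GK h) v)"
      using rel[OF uq_rels.K_E v, of h i] v by (simp add: act_alg_diff m qw_def)
    show "act V (GK h) (act V (GF i) v) = qw D (- alpha i) h *\<^sub>C act V (GF i) (act V (GK h) v)"
      using rel[OF uq_rels.K_F v, of h i] v by (simp add: act_alg_diff m qw_def bil_minus_left)
    show "act V (GE i) (act V (GF j) v) = act V (GF j) (act V (GE i) v) +
      (if i = j then (1 / (q_i D i - inverse (q_i D i))) *\<^sub>C
         (act V (GK (alpha i)) v - act V (GK (- alpha i)) v) else 0)" for j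
    proof (cases "i = j")
      case True
      have "act V (GE i) (act V (GF i) v) - act V (GF i) (act V (GE i) v) -
          (1 / (q_i D i - inverse (q_i D i))) *\<^sub>C (act V (GK (alpha i)) v - act V (GK (- alpha i)) v) = 0"
        using rel[OF uq_rels.E_F v, of i] v by (simp add: act_alg_diff m)
      then show ?thesis using True by (simp add: diff_diff_eq eq_diff_eq)
    next
      case False
      then show ?thesis using rel[OF uq_rels.E_F_ne[OF False] v] v by (simp add: act_alg_diff m)
    qed
  qed (use D V' in auto)
  show "i \<noteq> j \<Longrightarrow> v \<in> car V \<Longrightarrow> serre_op D (\<lambda>i. act V (GE i)) i j v = 0"
    using premodule.act_alg_serre(1)[OF P] rel[OF uq_rels.serre_E] by metis
  show "i \<noteq> j \<Longrightarrow> v \<in> car V \<Longrightarrow> serre_op D (\<lambda>i. act V (GF i)) i j v = 0"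
    using premodule.act_alg_serre(2)[OF P] rel[OF uq_rels.serre_F] by metis
qed

text \<open>A concrete Verma module of highest weight \<open>\<mu>\<close> for the algebra without Serre relations: the function \<open>\<phi>\<close>
  on words stands for \<open>\<Sum>\<^sub>w \<phi>(w) F\<^sub>w m\<close>, so that \<open>E\<^sub>i\<close> sums over the positions at which a letter \<open>i\<close> can be deleted.\<close>

definition model_coeff :: "'i::finite qdatum \<Rightarrow> 'i weight \<Rightarrow> 'i \<Rightarrow> 'i list \<Rightarrow> complex" where
  "model_coeff D \<mu> i u = (1 / (q_i D i - inverse (q_i D i))) *
     (qw D (\<mu> - wt u) (alpha i) - qw D (\<mu> - wt u) (- alpha i))"

text \<open>Read at the word u, deletion of a letter becomes insertion: \<phi> is evaluated at the
  words obtained from u by inserting i, each weighted by the commutator scalar on the part to the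
  right of the inserted letter.\<close>

fun model_E :: "'i::finite qdatum \<Rightarrow> 'i weight \<Rightarrow> 'i \<Rightarrow> ('i list \<Rightarrow> complex) \<Rightarrow> 'i list \<Rightarrow> complex" where
  "model_E D \<mu> i \<phi> [] = model_coeff D \<mu> i [] * \<phi> [i]"
| "model_E D \<mu> i \<phi> (j # u) = model_coeff D \<mu> i (j # u) * \<phi> (i # j # u) + model_E D \<mu> i (\<lambda>w. \<phi> (j # w)) u"

fun model_F :: "'i \<Rightarrow> ('i list \<Rightarrow> complex) \<Rightarrow> 'i list \<Rightarrow> complex" where
  "model_F i \<phi> [] = 0"
| "model_F i \<phi> (j # u) = (if i = j then \<phi> u else 0)"

definition model_K :: "'i::finite qdatum \<Rightarrow> 'i weight \<Rightarrow> 'i weight \<Rightarrow> ('i list \<Rightarrow> complex) \<Rightarrow> 'i list \<Rightarrow> complex" where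
  "model_K D \<mu> h \<phi> u = qw D (\<mu> - wt u) h * \<phi> u"

text \<open>Vanishing on all long words is finite support, since the alphabet is finite; a length
  bound is easy to carry through the three kinds of generators.\<close>

definition model :: "'i::finite qdatum \<Rightarrow> 'i weight \<Rightarrow> ('i, 'i list \<Rightarrow> complex) uqmod" where
  "model D \<mu> = \<lparr> car = {\<phi>. \<exists>n. \<forall>w. length w \<ge> n \<longrightarrow> \<phi> w = 0},
     act = (\<lambda>g. case g of GE i \<Rightarrow> model_E D \<mu> i | GF i \<Rightarrow> model_F i | GK h \<Rightarrow> model_K D \<mu> h) \<rparr>"

lemma act_model [simp]: "act (model D \<mu>) (GE i) = model_E D \<mu> i" "act (model D \<mu>) (GF i) = model_F i"
  "act (model D \<mu>) (GK h) = model_K D \<mu> h"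
  by (simp_all add: model_def)

lemma model_E_add: "model_E D \<mu> i (\<lambda>w. \<phi> w + \<psi> w) u = model_E D \<mu> i \<phi> u + model_E D \<mu> i \<psi> u"
  by (induction u arbitrary: \<phi> \<psi>) (simp_all add: algebra_simps)

lemma model_E_scale: "model_E D \<mu> i (\<lambda>w. c * \<phi> w) u = c * model_E D \<mu> i \<phi> u"
  by (induction u arbitrary: \<phi>) (simp_all add: algebra_simps)

lemma model_E_zero [simp]: "model_E D \<mu> i (\<lambda>w. 0) u = 0"
  by (induction u) simp_all

lemma model_E_vanishes:
  "(\<And>w. length w \<ge> n \<Longrightarrow> \<phi> w = 0) \<Longrightarrow> length u \<ge> n \<Longrightarrow> model_E D \<mu> i \<phi> u = 0"
proof (induction u arbitrary: \<phi> n)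
  case (Cons j u)
  have "model_E D \<mu> i (\<lambda>w. \<phi> (j # w)) u = 0"
    by (rule Cons.IH[of "n - 1"]) (use Cons.prems in auto)
  then show ?case using Cons.prems by simp
qed simp

text \<open>The weight \<kappa> is arbitrary because the induction strips a letter j off the words
  and absorbs \<open>alpha j\<close> into \<kappa>.\<close>

lemma model_E_K:
  assumes D: "qdatum D"
  shows "model_E D \<mu> i (\<lambda>w. qw D (\<kappa> - wt w) h * \<phi> w) u = qw D (\<kappa> - alpha i - wt u) h * model_E D \<mu> i \<phi> u"
proof (induction u arbitrary: \<phi> \<kappa>)
  case (Cons j u)
  have "model_E D \<mu> i (\<lambda>w. qw D (\<kappa> - alpha j - wt w) h * \<phi> (j # w)) u
      = qw D (\<kappa> - alpha j - alpha i - wt u) h * model_E D \<mu> i (\<lambda>w. \<phi> (j # w)) u"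
    by (rule Cons.IH)
  then show ?case by (simp add: algebra_simps diff_diff_eq add.commute add.left_commute)
qed simp

lemma premodule_model:
  assumes D: "qdatum D"
  shows "premodule D (model D \<mu>)"
proof
  show "cvec.subspace (car (model D \<mu>))"
  proof (rule cvec.subspaceI)
    fix \<phi> \<psi> assume "\<phi> \<in> car (model D \<mu>)" "\<psi> \<in> car (model D \<mu>)"
    then obtain n k where "\<forall>w. length w \<ge> n \<longrightarrow> \<phi> w = 0" "\<forall>w. length w \<ge> k \<longrightarrow> \<psi> w = 0"
      by (auto simp: model_def)
    then have "\<exists>n. \<forall>w. length w \<ge> n \<longrightarrow> (\<phi> + \<psi>) w = 0"
      by (intro exI[of _ "max n k"]) simp
    then show "\<phi> + \<psi> \<in> car (model D \<mu>)" unfolding model_def by simp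
  qed (auto simp: model_def scaleC_fun_apply)
next
  fix g
  show "linear_on (car (model D \<mu>)) (act (model D \<mu>) g)"
  proof (cases g)
    case (GF i)
    have "model_F i (\<phi> + \<psi>) u = model_F i \<phi> u + model_F i \<psi> u"
      "model_F i (c *\<^sub>C \<phi>) u = c *\<^sub>C model_F i \<phi> u" for \<phi> \<psi> u c
      by (cases u; simp add: scaleC_fun_apply)+
    then show ?thesis by (auto simp: GF linear_on_def fun_eq_iff scaleC_fun_apply)
  qed (auto simp: linear_on_def fun_eq_iff plus_fun_def scaleC_fun_def scaleC_complex model_E_add
      model_E_scale model_K_def algebra_simps)
  show "act (model D \<mu>) g ` car (model D \<mu>) \<subseteq> car (model D \<mu>)"
  proof (rule image_subsetI)
    fix \<phi> assume "\<phi> \<in> car (model D \<mu>)"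
    then obtain n where n: "\<And>w. length w \<ge> n \<Longrightarrow> \<phi> w = 0" by (auto simp: model_def)
    have "act (model D \<mu>) g \<phi> w = 0" if "length w \<ge> Suc n" for w
    proof (cases g)
      case (GE i)
      then show ?thesis using model_E_vanishes[of n \<phi> w] n that by simp
    next
      case (GF i)
      then show ?thesis using n that by (cases w) auto
    next
      case (GK h)
      then show ?thesis using n that by (simp add: model_K_def)
    qed
    then show "act (model D \<mu>) g \<phi> \<in> car (model D \<mu>)" unfolding model_def by auto
  qed
next
  fix h k i j and \<phi> :: "'a list \<Rightarrow> complex"
  show "act (model D \<mu>) (GK 0) \<phi> = \<phi>"
    by (simp add: model_K_def fun_eq_iff D)
  show "act (model D \<mu>) (GK (h + k)) \<phi> = act (model D \<mu>) (GK h) (act (model D \<mu>) (GK k) \<phi>)"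
    by (simp add: model_K_def fun_eq_iff qw_add_right D)
  show "act (model D \<mu>) (GK h) (act (model D \<mu>) (GE i) \<phi>) =
      qw D (alpha i) h *\<^sub>C act (model D \<mu>) (GE i) (act (model D \<mu>) (GK h) \<phi>)"
  proof (rule ext)
    fix u
    have "model_E D \<mu> i (model_K D \<mu> h \<phi>) u = qw D (\<mu> - alpha i - wt u) h * model_E D \<mu> i \<phi> u"
      unfolding model_K_def by (rule model_E_K[OF D])
    then show "act (model D \<mu>) (GK h) (act (model D \<mu>) (GE i) \<phi>) u =
      (qw D (alpha i) h *\<^sub>C act (model D \<mu>) (GE i) (act (model D \<mu>) (GK h) \<phi>)) u"
      by (simp add: model_K_def scaleC_fun_apply scaleC_complex qw_diff_left[OF D] D)
  qed
  show "act (model D \<mu>) (GK h) (act (model D \<mu>) (GF i) \<phi>) =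
      qw D (- alpha i) h *\<^sub>C act (model D \<mu>) (GF i) (act (model D \<mu>) (GK h) \<phi>)"
  proof (rule ext)
    fix u
    show "act (model D \<mu>) (GK h) (act (model D \<mu>) (GF i) \<phi>) u =
      (qw D (- alpha i) h *\<^sub>C act (model D \<mu>) (GF i) (act (model D \<mu>) (GK h) \<phi>)) u"
      by (cases u) (simp_all add: model_K_def scaleC_fun_apply scaleC_complex qw_diff_left[OF D]
        qw_minus_left[OF D] qw_add_left[OF D] D field_simps)
  qed
  show "act (model D \<mu>) (GE i) (act (model D \<mu>) (GF j) \<phi>) = act (model D \<mu>) (GF j) (act (model D \<mu>) (GE i) \<phi>) +
      (if i = j then (1 / (q_i D i - inverse (q_i D i))) *\<^sub>C
         (act (model D \<mu>) (GK (alpha i)) \<phi> - act (model D \<mu>) (GK (- alpha i)) \<phi>) else 0)"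
  proof (rule ext)
    fix u
    show "act (model D \<mu>) (GE i) (act (model D \<mu>) (GF j) \<phi>) u = (act (model D \<mu>) (GF j) (act (model D \<mu>) (GE i) \<phi>) +
      (if i = j then (1 / (q_i D i - inverse (q_i D i))) *\<^sub>C
         (act (model D \<mu>) (GK (alpha i)) \<phi> - act (model D \<mu>) (GK (- alpha i)) \<phi>) else 0)) u"
      \<comment> \<open>In the recursion of \<open>model_E\<close>, the insertion in front of the
        whole word is the commutator term, and the recursive call is \<open>F_j E_i\<close>.\<close>
      by (cases u) (auto simp: model_K_def scaleC_fun_apply scaleC_complex model_coeff_def algebra_simps)
  qed
qed (rule D)

definition model_one :: "'i list \<Rightarrow> complex" where
  "model_one w = (if w = [] then 1 else 0)"

text \<open>Closure under the \<open>F\<^sub>i\<close> suffices for a submodule: the \<open>E\<^sub>i\<close> commute with the Serre elements.\<close>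

inductive_set serre_ideal :: "'i::finite qdatum \<Rightarrow> 'i weight \<Rightarrow> ('i list \<Rightarrow> complex) set" for D \<mu> where
  zero: "0 \<in> serre_ideal D \<mu>"
| add: "x \<in> serre_ideal D \<mu> \<Longrightarrow> y \<in> serre_ideal D \<mu> \<Longrightarrow> x + y \<in> serre_ideal D \<mu>"
| scale: "x \<in> serre_ideal D \<mu> \<Longrightarrow> c *\<^sub>C x \<in> serre_ideal D \<mu>"
| F: "x \<in> serre_ideal D \<mu> \<Longrightarrow> model_F i x \<in> serre_ideal D \<mu>"
| serre: "i \<noteq> j \<Longrightarrow> x \<in> car (model D \<mu>) \<Longrightarrow> serre_op D model_F i j x \<in> serre_ideal D \<mu>"

context
  fixes D :: "'i::finite qdatum" and \<mu> :: "'i weight"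
  assumes D: "qdatum D"
begin

interpretation N: premodule D "model D \<mu>" by (rule premodule_model[OF D])

lemma model_one_in: "model_one \<in> car (model D \<mu>)"
  by (auto simp: model_def model_one_def intro: exI[of _ 1])

lemma model_E_one: "model_E D \<mu> i model_one = 0"
proof -
  have "model_E D \<mu> i \<phi> u = 0" if "\<And>w. w \<noteq> [] \<Longrightarrow> \<phi> w = 0" for \<phi> u
    using model_E_vanishes[of 1 \<phi> u] that by (cases u) (auto simp: Suc_le_eq)
  then show ?thesis by (auto simp: fun_eq_iff model_one_def)
qed

lemma model_K_one: "model_K D \<mu> h model_one = qw D \<mu> h *\<^sub>C model_one"
  by (auto simp: fun_eq_iff model_K_def model_one_def scaleC_fun_apply scaleC_complex)

text \<open>The Serre elements in the \<open>E_i\<close> commute with every \<open>F_k\<close> and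
  kill \<open>model_one\<close>, and \<open>model_one\<close> generates the model under the
  \<open>F_k\<close>. The induction over the word u peels off first letters.\<close>

lemma model_serre_E:
  assumes ij: "i \<noteq> j" and \<phi>: "\<phi> \<in> car (model D \<mu>)"
  shows "serre_op D (model_E D \<mu>) i j \<phi> = 0"
proof (rule ext)
  let ?S = "serre_op D (model_E D \<mu>) i j"
  have one: "?S model_one = 0"
  proof -
    have "(model_E D \<mu> i ^^ r) model_one = (if r = 0 then model_one else 0)" for r
      by (induction r) (use N.act_zero[of "GE i"] in \<open>auto simp: model_E_one\<close>)
    moreover have "(model_E D \<mu> i ^^ r) 0 = 0" for r
      by (induction r) (use N.act_zero[of "GE i"] in auto)
    ultimately show ?thesis using N.act_zero[of "GE j"] by (auto simp: serre_op_def Let_def model_E_one intro!: sum.neutral)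
  qed
  note lin = N.linear_serre[of GE i j, simplified]
  have step: "?S \<phi> u = (\<Sum>k\<in>UNIV. model_F k (?S (\<lambda>w. \<phi> (k # w))) u)" if \<phi>: "\<phi> \<in> car (model D \<mu>)" for \<phi> u
  proof -
    define d where "d k = (\<lambda>w. \<phi> (k # w))" for k
    obtain n where "\<And>w. length w \<ge> n \<Longrightarrow> \<phi> w = 0" using \<phi> by (auto simp: model_def)
    then have d: "d k \<in> car (model D \<mu>)" for k
      by (auto simp: model_def d_def intro: exI[of _ n])
    have Fd: "model_F k (d k) \<in> car (model D \<mu>)" for k using N.act_in[OF d, of "GF k" k] by simp
    have "\<phi> = \<phi> [] *\<^sub>C model_one + (\<Sum>k\<in>UNIV. model_F k (d k))"
    proof (rule ext)
      fix u show "\<phi> u = (\<phi> [] *\<^sub>C model_one + (\<Sum>k\<in>UNIV. model_F k (d k))) u"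
        by (cases u) (simp_all add: scaleC_fun_apply scaleC_complex model_one_def sum_fun_apply d_def)
    qed
    then have "?S \<phi> = ?S (\<phi> [] *\<^sub>C model_one + (\<Sum>k\<in>UNIV. model_F k (d k)))" by simp
    also have "\<dots> = (\<Sum>k\<in>UNIV. ?S (model_F k (d k)))"
      using model_one_in Fd by (simp add: linear_on_add[OF lin] linear_on_scale[OF lin] one N.sum_in
        linear_on_sum[OF lin N.subspace_car])
    also have "\<dots> = (\<Sum>k\<in>UNIV. model_F k (?S (d k)))"
      using N.F_serre[OF ij d] by simp
    finally show ?thesis by (simp add: sum_fun_apply d_def)
  qed
  fix u
  show "?S \<phi> u = 0 u" using \<phi>
  proof (induction u arbitrary: \<phi>)
    case Nil
    then show ?case by (simp add: step)
  next
    case (Cons k u)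
    obtain n where "\<And>w. length w \<ge> n \<Longrightarrow> \<phi> w = 0" using Cons.prems by (auto simp: model_def)
    then have "(\<lambda>w. \<phi> (k # w)) \<in> car (model D \<mu>)"
      by (auto simp: model_def intro: exI[of _ n])
    then show ?case using Cons.IH by (simp add: step[OF Cons.prems])
  qed
qed

lemma serre_ideal_in: "x \<in> serre_ideal D \<mu> \<Longrightarrow> x \<in> car (model D \<mu>)"
proof (induction rule: serre_ideal.induct)
  case (F x i)
  then show ?case using N.act_in[of x "GF i"] by simp
next
  case (serre i j x)
  then show ?case using N.serre_in(1)[of x i j] by simp
qed (auto simp del: zero_fun_apply plus_fun_apply)

lemma serre_ideal_act: "x \<in> serre_ideal D \<mu> \<Longrightarrow> act (model D \<mu>) g x \<in> serre_ideal D \<mu>"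
proof (induction arbitrary: g rule: serre_ideal.induct)
  case zero
  show ?case by (simp add: serre_ideal.zero del: zero_fun_apply)
next
  case (add x y)
  then show "act (model D \<mu>) g (x + y) \<in> serre_ideal D \<mu>"
    by (simp add: N.act_add serre_ideal_in serre_ideal.add del: plus_fun_apply)
next
  case (scale x c)
  then show ?case by (simp add: N.act_scale serre_ideal_in serre_ideal.scale)
next
  case (F x i)
  have x: "x \<in> car (model D \<mu>)" using F(1) by (rule serre_ideal_in)
  have diff: "a - b \<in> serre_ideal D \<mu>" if "a \<in> serre_ideal D \<mu>" "b \<in> serre_ideal D \<mu>" for a b
    using serre_ideal.add[OF that(1) serre_ideal.scale[OF that(2), of "-1"]] by simp
  show ?case
  proof (cases g)
    case (GE k)
    have "model_F i (model_E D \<mu> k x) + (if k = i then (1 / (q_i D k - inverse (q_i D k))) *\<^sub>C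
        (model_K D \<mu> (alpha k) x - model_K D \<mu> (- alpha k) x) else 0) \<in> serre_ideal D \<mu>"
    proof -
      have "model_F i (model_E D \<mu> k x) \<in> serre_ideal D \<mu>"
        using F.IH[of "GE k"] by (simp add: serre_ideal.F)
      moreover have "c *\<^sub>C (model_K D \<mu> (alpha k) x - model_K D \<mu> (- alpha k) x) \<in> serre_ideal D \<mu>" for c
        using F.IH[of "GK (alpha k)"] F.IH[of "GK (- alpha k)"] by (intro serre_ideal.scale diff) simp_all
      ultimately show ?thesis
        by (cases "k = i") (simp_all only: if_True if_False simp_thms serre_ideal.add serre_ideal.zero)
    qed
    then show ?thesis using N.E_F[OF x, of k i] by (simp only: GE act_model)
  next
    case (GF k)
    show ?thesis using F(1) by (simp add: GF serre_ideal.F)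
  next
    case (GK h)
    show ?thesis using N.K_F[OF x, of h i] F.IH[of "GK h"]
      by (simp add: GK serre_ideal.F serre_ideal.scale)
  qed
next
  case (serre i j x)
  show ?case
  proof (cases g)
    case (GE k)
    show ?thesis using N.E_serre[OF serre, of k] N.act_in[OF serre(2), of "GE k"] serre(1)
      by (simp add: GE serre_ideal.serre)
  next
    case (GF k)
    show ?thesis using serre by (simp add: GF serre_ideal.F serre_ideal.serre)
  next
    case (GK h)
    have "model_K D \<mu> h (serre_op D model_F i j x) = serre_op D model_F i j
      ((qw D (- alpha i) h ^ nat (1 - cmat D i j) * qw D (- alpha j) h) *\<^sub>C model_K D \<mu> h x)"
      using N.K_serre_F[OF serre(2), of h i j] by simp
    then show ?thesis using serre N.act_in[OF serre(2), of "GK h"] by (simp add: GK serre_ideal.serre)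
  qed
qed

lemma serre_ideal_alg: "x \<in> serre_ideal D \<mu> \<Longrightarrow> act_alg (model D \<mu>) a x \<in> serre_ideal D \<mu>"
proof (induction a rule: free_alg_induct)
  case (single w c)
  have "foldr (act (model D \<mu>)) w x \<in> serre_ideal D \<mu>" using single
    by (induction w) (simp_all add: serre_ideal_act del: act_model)
  then show ?case by (simp add: act_alg_single serre_ideal.scale)
qed (simp_all add: act_alg_add serre_ideal.add serre_ideal.zero)

text \<open>Modulo the Serre ideal the model satisfies all relations of the quantum group and
  \<open>model_one\<close> is a highest weight vector of weight \<mu>. The defining relations of the
  Verma module therefore hold there.\<close>

lemma verma_ideal_model: "x \<in> verma_ideal D \<mu> \<Longrightarrow> act_alg (model D \<mu>) x model_one \<in> serre_ideal D \<mu>"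
proof (induction rule: verma_ideal.induct)
  case (mult x a)
  then show ?case by (simp add: N.act_alg_mult model_one_in serre_ideal_alg)
next
  case (rel r b)
  define y where "y = act_alg (model D \<mu>) b model_one"
  have y: "y \<in> car (model D \<mu>)" by (simp add: y_def model_one_in)
  have "act_alg (model D \<mu>) r y \<in> serre_ideal D \<mu>"
    using N.act_alg_rel[OF rel y]
  proof (elim disjE exE conjE)
    fix i j :: 'i assume ij: "i \<noteq> j"
    show ?thesis if "act_alg (model D \<mu>) r y = serre_op D (\<lambda>i. act (model D \<mu>) (GE i)) i j y"
      using that model_serre_E[OF ij y] serre_ideal.zero by simp
    show ?thesis if "act_alg (model D \<mu>) r y = serre_op D (\<lambda>i. act (model D \<mu>) (GF i)) i j y"
      unfolding that act_model using serre_ideal.serre[OF ij y] .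
  qed (simp only: serre_ideal.zero)
  then show ?case by (simp add: N.act_alg_mult model_one_in y_def)
qed (simp_all add: act_alg_add act_alg_diff serre_ideal.add serre_ideal.zero model_E_one model_K_one qw_def
    del: plus_fun_apply zero_fun_apply minus_apply)

text \<open>Every Serre element consists of nonempty words, so the coefficient of the empty word
  descends to the Verma module. This is how m* is obtained in \<open>mstar_spec\<close>.\<close>

lemma serre_ideal_Nil: "x \<in> serre_ideal D \<mu> \<Longrightarrow> x [] = 0"
proof (induction rule: serre_ideal.induct)
  case (serre i j x)
  have "(model_F i ^^ n) (model_F j y) [] = 0" for n y by (cases n) auto
  then show ?case by (simp add: serre_op_def Let_def sum_fun_apply scaleC_fun_apply scaleC_complex)
qed (auto simp: scaleC_fun_apply scaleC_complex)

end

section \<open>Evaluation of words in operators that satisfy the Serre relations\<close>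

lemma act_alg_word: "act_alg V (Poly_Mapping.single (map g w) c) v = c *\<^sub>C foldr (\<lambda>i. act V (g i)) w v"
  by (simp add: act_alg_single foldr_map o_def)

lemma model_word: "foldr model_F w model_one u = (if u = w then 1 else 0)"
proof (induction w arbitrary: u)
  case (Cons i w)
  then show ?case by (cases u) auto
qed (auto simp: model_one_def)

text \<open>The substitution of the operators f for the \<open>F_i\<close> and of v for the highest
  weight vector. The target carries only the operators f, so that it can later be a module on which
  rescaled \<open>E_i\<close> take the place of the \<open>F_i\<close>.\<close>

definition word_eval :: "('i \<Rightarrow> 'v \<Rightarrow> 'v) \<Rightarrow> 'v \<Rightarrow> ('i list \<Rightarrow> complex) \<Rightarrow> 'v::cvec" where
  "word_eval f v \<phi> = (\<Sum>w | \<phi> w \<noteq> 0. \<phi> w *\<^sub>C foldr f w v)"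

lemma finite_model_support: "\<phi> \<in> car (model D \<mu>) \<Longrightarrow> finite {w :: 'i::finite list. \<phi> w \<noteq> 0}"
proof -
  assume "\<phi> \<in> car (model D \<mu>)"
  then obtain n where n: "\<And>w. length w \<ge> n \<Longrightarrow> \<phi> w = 0" by (auto simp: model_def)
  have "{w. \<phi> w \<noteq> 0} \<subseteq> {w :: 'i list. set w \<subseteq> UNIV \<and> length w \<le> n}"
    using n by (auto intro: leI less_imp_le simp: not_le[symmetric])
  then show ?thesis by (rule finite_subset) (rule finite_lists_length_le[OF finite])
qed

lemma word_eval_eq:
  "finite S \<Longrightarrow> {w. \<phi> w \<noteq> 0} \<subseteq> S \<Longrightarrow> word_eval f v \<phi> = (\<Sum>w\<in>S. \<phi> w *\<^sub>C foldr f w v)"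
  unfolding word_eval_def by (intro sum.mono_neutral_left) auto

context
  fixes D :: "'i::finite qdatum" and \<mu> :: "'i weight" and W :: "'v::cvec set" and f :: "'i \<Rightarrow> 'v \<Rightarrow> 'v" and v :: 'v
  assumes D: "qdatum D" and W: "cvec.subspace W" and f: "\<And>i. linear_on W (f i)" "\<And>i. f i ` W \<subseteq> W"
    and v: "v \<in> W" and serre0: "\<And>i j x. i \<noteq> j \<Longrightarrow> x \<in> W \<Longrightarrow> serre_op D f i j x = 0"
begin

interpretation N: premodule D "model D \<mu>" by (rule premodule_model[OF D])

lemma word_eval_word_in: "foldr f w v \<in> W"
  using f(2) v by (induction w) auto

lemma word_eval_in: "word_eval f v \<phi> \<in> W"
  unfolding word_eval_def by (intro cvec.subspace_sum[OF W] cvec.subspace_scale[OF W] word_eval_word_in)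

lemma linear_word_eval: "linear_on (car (model D \<mu>)) (word_eval f v)"
proof (rule linear_onI)
  fix x y assume xy: "x \<in> car (model D \<mu>)" "y \<in> car (model D \<mu>)"
  let ?S = "{w. x w \<noteq> 0} \<union> {w. y w \<noteq> 0}"
  have "finite ?S" using finite_model_support[OF xy(1)] finite_model_support[OF xy(2)] by simp
  then have "word_eval f v z = (\<Sum>w\<in>?S. z w *\<^sub>C foldr f w v)" if "{w. z w \<noteq> 0} \<subseteq> ?S" for z
    using that by (rule word_eval_eq)
  moreover have "{w. (x + y) w \<noteq> 0} \<subseteq> ?S" "{w. x w \<noteq> 0} \<subseteq> ?S" "{w. y w \<noteq> 0} \<subseteq> ?S" by auto
  ultimately show "word_eval f v (x + y) = word_eval f v x + word_eval f v y"
    by (simp add: scaleC_left_distrib sum.distrib)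
next
  fix c x assume x: "x \<in> car (model D \<mu>)"
  have "word_eval f v z = (\<Sum>w | x w \<noteq> 0. z w *\<^sub>C foldr f w v)" if "{w. z w \<noteq> 0} \<subseteq> {w. x w \<noteq> 0}" for z
    using finite_model_support[OF x] that by (rule word_eval_eq)
  moreover have "{w. (c *\<^sub>C x) w \<noteq> 0} \<subseteq> {w. x w \<noteq> 0}" by (auto simp: scaleC_fun_apply scaleC_complex)
  ultimately show "word_eval f v (c *\<^sub>C x) = c *\<^sub>C word_eval f v x"
    by (simp add: scaleC_fun_apply scaleC_complex cvec.scale_sum_right scaleC_scaleC)
qed

lemma word_eval_F:
  assumes x: "x \<in> car (model D \<mu>)"
  shows "word_eval f v (model_F i x) = f i (word_eval f v x)"
proof -
  have "{w. model_F i x w \<noteq> 0} = (#) i ` {w. x w \<noteq> 0}"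
  proof (rule set_eqI)
    fix w show "w \<in> {w. model_F i x w \<noteq> 0} \<longleftrightarrow> w \<in> (#) i ` {w. x w \<noteq> 0}" by (cases w) auto
  qed
  then have "word_eval f v (model_F i x) = (\<Sum>w | x w \<noteq> 0. x w *\<^sub>C f i (foldr f w v))"
    unfolding word_eval_def by (simp add: sum.reindex)
  also have "\<dots> = (\<Sum>w | x w \<noteq> 0. f i (x w *\<^sub>C foldr f w v))"
    by (simp add: linear_on_scale[OF f(1)] word_eval_word_in)
  also have "\<dots> = f i (word_eval f v x)"
    unfolding word_eval_def
    by (rule linear_on_sum[OF f(1) W, symmetric]) (intro cvec.subspace_scale[OF W] word_eval_word_in)
  finally show ?thesis .
qed

lemma word_eval_F_funpow:
  "x \<in> car (model D \<mu>) \<Longrightarrow> word_eval f v ((model_F i ^^ n) x) = (f i ^^ n) (word_eval f v x)"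
proof (induction n)
  case (Suc n)
  then show ?case using N.funpow_in[of x n "GF i"] by (simp add: word_eval_F)
qed simp

text \<open>Evaluation intertwines \<open>model_F\<close> with f, so it sends Serre elements in the
  model to Serre elements in f, which vanish on W.\<close>

lemma word_eval_serre_ideal: "x \<in> serre_ideal D \<mu> \<Longrightarrow> word_eval f v x = 0"
proof (induction rule: serre_ideal.induct)
  case zero
  show "word_eval f v 0 = 0" by (simp add: word_eval_def)
next
  case (add x y)
  then show "word_eval f v (x + y) = 0" by (simp only: linear_on_add[OF linear_word_eval] serre_ideal_in D add_0)
next
  case (scale x c)
  then show ?case by (simp add: linear_on_scale[OF linear_word_eval] serre_ideal_in D)
next
  case (F x i)
  then show ?case using linear_on_zero[OF f(1) W] by (simp add: word_eval_F serre_ideal_in D)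
next
  case (serre i j x)
  have in1: "(model_F k ^^ n) y \<in> car (model D \<mu>)" "model_F k y \<in> car (model D \<mu>)"
    if "y \<in> car (model D \<mu>)" for k n y
    using N.funpow_in[OF that, of n "GF k"] N.act_in[OF that, of "GF k"] by simp_all
  have "word_eval f v (serre_op D model_F i j x) = serre_op D f i j (word_eval f v x)"
    unfolding serre_op_def Let_def using serre(2)
    by (subst linear_on_sum[OF linear_word_eval N.subspace_car])
      (auto simp: linear_on_scale[OF linear_word_eval] in1 word_eval_F_funpow word_eval_F)
  then show ?case using serre0[OF serre(1) word_eval_in] by simp
qed

text \<open>The freeness part of the triangular decomposition.\<close>

lemma verma_ideal_word_relation:
  assumes "finite A" "(\<Sum>w\<in>A. Poly_Mapping.single (map GF w) (c w)) \<in> verma_ideal D \<mu>"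
  shows "(\<Sum>w\<in>A. c w *\<^sub>C foldr f w v) = 0"
proof -
  define x where "x = (\<Sum>w\<in>A. c w *\<^sub>C foldr model_F w model_one)"
  have xw: "x w = (if w \<in> A then c w else 0)" for w
    using assms(1) by (simp add: x_def sum_fun_apply scaleC_fun_apply scaleC_complex model_word if_distrib cong: if_cong)
  have "x \<in> serre_ideal D \<mu>"
    using verma_ideal_model[OF D assms(2)] by (simp add: act_alg_setsum act_alg_word x_def)
  then have "word_eval f v x = 0" by (rule word_eval_serre_ideal)
  moreover have "word_eval f v x = (\<Sum>w\<in>A. x w *\<^sub>C foldr f w v)"
    using assms(1) by (intro word_eval_eq) (auto simp: xw)
  ultimately show ?thesis by (simp add: xw)
qed

end

section \<open>The contravariant pairing on a Verma module\<close>

context premodule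
begin

lemma K_F_word: "v \<in> car X \<Longrightarrow> K h (foldr F w v) = qw D (- wt w) h *\<^sub>C foldr F w (K h v)"
  by (induction w) (simp_all add: K_F act_scale scaleC_scaleC D qw_diff_left scaleC_one qw_minus_left divide_inverse mult.commute)

lemma K_E_word: "v \<in> car X \<Longrightarrow> K h (foldr E w v) = qw D (wt w) h *\<^sub>C foldr E w (K h v)"
  by (induction w) (simp_all add: K_E act_scale scaleC_scaleC D qw_add_left scaleC_one mult.commute)

lemma submodule_of_singular:
  assumes m: "m \<in> car X" and Em: "\<And>i. E i m = 0" and Km: "\<And>h. K h m = c h *\<^sub>C m"
  shows "act_alg X x m \<in> cvec.span (range (\<lambda>w. foldr F w m))"
proof -
  let ?S = "cvec.span (range (\<lambda>w. foldr F w m))"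
  have SX: "?S \<subseteq> car X"
    using m by (intro cvec.span_minimal subspace_car) auto
  have Fw: "foldr F w m \<in> ?S" for w by (rule cvec.span_base) auto
  have Kw: "K h (foldr F w m) \<in> ?S" for h w
    using m by (simp add: K_F_word Km linear_on_scale[OF linear_word] cvec.span_scale Fw)
  have gen: "act X g ` ?S \<subseteq> ?S" if "\<And>w. act X g (foldr F w m) \<in> ?S" for g
    by (rule linear_on_span_image[OF linear_on_subset[OF linear_act SX]]) (use that in auto)
  have FS: "F i y \<in> ?S" if "y \<in> ?S" for i y
  proof -
    have "act X (GF i) (foldr F w m) \<in> ?S" for w using Fw[of "i # w"] by simp
    then show ?thesis using gen that by blast
  qed
  have Ew: "E i (foldr F w m) \<in> ?S" for i w
  proof (induction w)
    case Nil
    show ?case using Em by (simp add: cvec.span_zero)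
  next
    case (Cons j w)
    then show ?case using m
      by (auto simp: E_F intro!: cvec.span_add cvec.span_diff cvec.span_scale FS Kw)
  qed
  have act: "act X g y \<in> ?S" if "y \<in> ?S" for g y
    by (cases g) (use gen[of g] that Ew Kw FS in auto)
  have "foldr (act X) u m \<in> ?S" for u
    by (induction u) (use act Fw[of "[]"] in auto)
  then show ?thesis
    unfolding act_alg_def by (intro cvec.span_sum cvec.span_scale)
qed

end

section \<open>The vacuum functional m* and its contravariance\<close>

locale verma =
  fixes D :: "'i::finite qdatum" and \<mu> :: "'i weight" and M :: "('i, 'v::cvec) uqmod" and m :: 'v
  assumes D: "qdatum D" and verma: "verma_module D \<mu> M m"

sublocale verma \<subseteq> premodule D M
  using uq_module_premodule[OF D] verma by (auto simp: verma_module_def)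

context verma
begin

abbreviation "chi \<equiv> mstar D \<mu> M m"
abbreviation "Fm w \<equiv> foldr F w m"

lemma m_in [simp]: "m \<in> car M"
  and car_eq: "car M = range (\<lambda>x. act_alg M x m)"
  and act_alg_eq_0_iff: "act_alg M x m = 0 \<longleftrightarrow> x \<in> verma_ideal D \<mu>"
  using verma unfolding verma_module_def by blast+

lemma E_m [simp]: "E i m = 0"
  using act_alg_eq_0_iff[of "gE i"] verma_ideal.E[of i] by simp

lemma K_m: "K h m = qw D \<mu> h *\<^sub>C m"
  using act_alg_eq_0_iff[of "gK h - cst (qpow D (bil D \<mu> h))"] verma_ideal.K[of h]
  by (simp add: act_alg_diff qw_def)

lemma K_Fm: "K h (Fm w) = qw D (\<mu> - wt w) h *\<^sub>C Fm w"
  by (simp add: K_F_word K_m linear_on_scale[OF linear_word] scaleC_scaleC D qw_diff_left qw_minus_left field_simps)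

lemma car_span: "car M = cvec.span (range Fm)"
proof
  show "car M \<subseteq> cvec.span (range Fm)"
    using submodule_of_singular[OF m_in E_m K_m] by (auto simp: car_eq)
  show "cvec.span (range Fm) \<subseteq> car M"
    by (intro cvec.span_minimal subspace_car) auto
qed

text \<open>Existence: m* is the coefficient of the empty word, pulled back from the word model.
  Uniqueness: the vectors \<open>Fm w\<close> span, and for nonempty w their weight differs from
  \<mu>. The last clause records the invariance that the model makes evident.\<close>

lemma mstar_spec:
  "chi \<in> extensional (car M) \<and> linear_on (car M) chi \<and> chi m = 1 \<and>
    (\<forall>\<kappa>. \<kappa> \<noteq> \<mu> \<longrightarrow> (\<forall>x\<in>wspace D M \<kappa>. chi x = 0)) \<and>
    (\<forall>y\<in>car M. (\<forall>i. chi (F i y) = 0) \<and> (\<forall>h. chi (K h y) = qw D \<mu> h * chi y))"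
proof -
  interpret N: premodule D "model D \<mu>" by (rule premodule_model[OF D])
  have one: "model_one \<in> car (model D \<mu>)" by (rule model_one_in[OF D])
  define g where "g x = act_alg (model D \<mu>) x model_one []" for x
  have wd: "g x = g y" if "act_alg M x m = act_alg M y m" for x y
  proof -
    have "x - y \<in> verma_ideal D \<mu>" using that by (simp add: act_alg_eq_0_iff[symmetric] act_alg_diff)
    then have "act_alg (model D \<mu>) (x - y) model_one [] = 0"
      by (intro serre_ideal_Nil[OF D, where \<mu> = \<mu>] verma_ideal_model[OF D])
    then show ?thesis by (simp add: g_def act_alg_diff)
  qed
  define u where "u y = (SOME x. act_alg M x m = y)" for y
  define f where "f = restrict (\<lambda>y. g (u y)) (car M)"
  have fg: "f (act_alg M x m) = g x" for x
  proof -
    have "act_alg M (u (act_alg M x m)) m = act_alg M x m"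
      unfolding u_def by (rule someI[where x = x]) (rule refl)
    then have "g (u (act_alg M x m)) = g x" by (rule wd)
    moreover have "act_alg M x m \<in> car M" by (intro alg_in m_in)
    ultimately show ?thesis unfolding f_def by (simp only: restrict_apply if_True)
  qed
  have f_lin: "linear_on (car M) f"
  proof (rule linear_onI)
    fix x y assume "x \<in> car M" "y \<in> car M"
    then obtain a b where "x = act_alg M a m" "y = act_alg M b m" by (auto simp: car_eq)
    then show "f (x + y) = f x + f y"
      using fg[of "a + b"] by (simp add: act_alg_add fg g_def)
  next
    fix c x assume "x \<in> car M"
    then obtain a where "x = act_alg M a m" by (auto simp: car_eq)
    then show "f (c *\<^sub>C x) = c *\<^sub>C f x"
      using fg[of "cst c * a"] by (simp add: act_alg_mult N.act_alg_mult one fg g_def scaleC_fun_apply)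
  qed
  have f_m: "f m = 1" using fg[of 1] by (simp add: g_def model_one_def)
  have f_F: "f (F i y) = 0" if "y \<in> car M" for i y
  proof -
    from that obtain a where "y = act_alg M a m" by (auto simp: car_eq)
    then show ?thesis using fg[of "gF i * a"] by (simp add: act_alg_mult N.act_alg_mult one g_def)
  qed
  have f_K: "f (K h y) = qw D \<mu> h * f y" if "y \<in> car M" for h y
  proof -
    from that obtain a where "y = act_alg M a m" by (auto simp: car_eq)
    then show ?thesis using fg[of "gK h * a"]
      by (simp add: act_alg_mult N.act_alg_mult one g_def model_K_def fg)
  qed
  have f_w: "f x = 0" if "\<kappa> \<noteq> \<mu>" "x \<in> wspace D M \<kappa>" for \<kappa> x
  proof -
    obtain h where h: "qw D \<kappa> h \<noteq> qw D \<mu> h" using qw_eqD[OF D, of \<kappa> \<mu>] \<open>\<kappa> \<noteq> \<mu>\<close> by blast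
    have x: "x \<in> car M" "K h x = qw D \<kappa> h *\<^sub>C x" using that(2) by (auto simp: wspace_def qw_def)
    have "qw D \<mu> h * f x = qw D \<kappa> h * f x"
      using f_K[OF x(1), of h] linear_on_scale[OF f_lin x(1), of "qw D \<kappa> h"] x(2) by (auto simp: scaleC_complex)
    then show ?thesis using h by simp
  qed
  let ?P = "\<lambda>f. f \<in> extensional (car M) \<and> linear_on (car M) f \<and> f m = 1 \<and>
    (\<forall>\<kappa>. \<kappa> \<noteq> \<mu> \<longrightarrow> (\<forall>x\<in>wspace D M \<kappa>. f x = 0))"
  have Pf: "?P f" using f_lin f_m f_w by (auto simp: f_def)
  have uniq: "f' = f" if P: "?P f'" for f'
  proof (rule extensionalityI[of f' "car M"])
    fix y assume y: "y \<in> car M"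
    show "f' y = f y"
    proof (rule linear_on_span_eqI[of "range Fm"])
      show "linear_on (cvec.span (range Fm)) f'" "linear_on (cvec.span (range Fm)) f" "y \<in> cvec.span (range Fm)"
        using P f_lin y by (simp_all add: car_span)
      fix x assume "x \<in> range Fm"
      then obtain w where x: "x = Fm w" by auto
      show "f' x = f x"
      proof (cases "w = []")
        case True
        then show ?thesis using P f_m x by simp
      next
        case False
        have "Fm w \<in> wspace D M (\<mu> - wt w)" using K_Fm by (simp add: wspace_def qw_def)
        moreover have "\<mu> - wt w \<noteq> \<mu>" using False by simp
        ultimately have "f' (Fm w) = 0" "f (Fm w) = 0" using P f_w by blast+
        then show ?thesis by (simp only: x)
      qed
    qed
  qed (use P Pf in \<open>simp_all only: simp_thms\<close>)
  have "chi = f" unfolding mstar_def by (rule the_equality) (fact Pf, fact uniq)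
  then show ?thesis using Pf f_F f_K by simp
qed

lemma linear_chi: "linear_on (car M) chi"
  and chi_m [simp]: "chi m = 1"
  and chi_F [simp]: "y \<in> car M \<Longrightarrow> chi (F i y) = 0"
  and chi_K: "y \<in> car M \<Longrightarrow> chi (K h y) = qw D \<mu> h * chi y"
  using mstar_spec by blast+

lemmas chi_add = linear_on_add[OF linear_chi]
  and chi_diff = linear_on_diff[OF linear_chi subspace_car]
  and chi_scale = linear_on_scale[OF linear_chi, unfolded scaleC_complex]
  and chi_zero [simp] = linear_on_zero[OF linear_chi subspace_car]

definition flip_gen :: "'i gen \<Rightarrow> 'i gen" where
  "flip_gen g = (case g of GE i \<Rightarrow> GF i | GF i \<Rightarrow> GE i | GK h \<Rightarrow> GK h)"

lemma flip_gen_simps [simp]: "flip_gen (GE i) = GF i" "flip_gen (GF i) = GE i" "flip_gen (GK h) = GK h"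
  by (simp_all add: flip_gen_def)

lemma linear_gen_word: "linear_on (car M) (foldr (act M) u)"
  using linear_word[of id u] by simp

lemmas gen_word_add = linear_on_add[OF linear_gen_word]
  and gen_word_diff = linear_on_diff[OF linear_gen_word subspace_car]
  and gen_word_scale = linear_on_scale[OF linear_gen_word]
  and gen_word_zero [simp] = linear_on_zero[OF linear_gen_word subspace_car]

text \<open>Invariance of the vacuum expectation under the anti-automorphism exchanging \<open>E\<^sub>i\<close> and \<open>F\<^sub>i\<close>: the
  defining relations that move all \<open>E\<^sub>i\<close> to the right correspond to each other.\<close>

lemma chi_flip: "chi (foldr (act M) u m) = chi (foldr (act M) (rev (map flip_gen u)) m)"
proof (induction u rule: length_induct)
  case (1 u)
  let ?T = "\<lambda>u. chi (foldr (act M) u m) = chi (foldr (act M) (rev (map flip_gen u)) m)"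
  \<comment> \<open>An \<open>E_i\<close> is moved to the right. A factor \<open>q^h\<close> costs
    the same scalar on both sides, and an \<open>F_j\<close> leaves in addition words that are
    shorter and fall under the outer induction. At the end \<open>E_i\<close> kills m, while in the
    flipped word the leading \<open>F_i\<close> is killed by m*.\<close>
  have E: "?T (p @ GE i # b)" if "length (p @ GE i # b) = length u" for p i b
    using that
  proof (induction b arbitrary: p i)
    case Nil
    show ?case by simp
  next
    case (Cons g b)
    show ?case
    proof (cases g)
      case (GE j)
      then show ?thesis using Cons.IH[of "p @ [GE i]" j] Cons.prems by simp
    next
      case (GK h)
      define y where "y = foldr (act M) b m"
      define z where "z = foldr (act M) (rev (map flip_gen p)) m"
      have yz: "y \<in> car M" "z \<in> car M" by (auto simp: y_def z_def)
      have "E i (K h y) = inverse (qw D (alpha i) h) *\<^sub>C K h (E i y)"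
        using yz by (simp add: K_E scaleC_scaleC D scaleC_one)
      moreover have "K h (F i z) = inverse (qw D (alpha i) h) *\<^sub>C F i (K h z)"
        using yz by (simp add: K_F D qw_minus_left)
      moreover have "?T ((p @ [GK h]) @ GE i # b)"
        using Cons.prems by (intro Cons.IH) simp
      ultimately show ?thesis using yz
        by (simp add: GK y_def[symmetric] z_def[symmetric] gen_word_scale chi_scale)
    next
      case (GF j)
      define y where "y = foldr (act M) b m"
      define z where "z = foldr (act M) (rev (map flip_gen p)) m"
      have yz: "y \<in> car M" "z \<in> car M" by (auto simp: y_def z_def)
      have "?T ((p @ [GF j]) @ GE i # b)"
        using Cons.prems by (intro Cons.IH) simp
      moreover have "?T (p @ GK h # b)" for h
        using Cons.prems GF by (intro 1[rule_format]) simp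
      ultimately show ?thesis using yz E_F[OF yz(1), of i j] E_F[OF yz(2), of j i]
        by (auto simp: GF y_def[symmetric] z_def[symmetric] gen_word_scale chi_scale
          gen_word_add gen_word_diff chi_add chi_diff)
    qed
  qed
  show ?case
  proof (cases u)
    case (Cons g b)
    show ?thesis
    proof (cases g)
      case (GE i)
      then show ?thesis using E[of "[]" i b] Cons by simp
    next
      case (GF i)
      then show ?thesis using Cons by simp
    next
      case (GK h)
      then show ?thesis using Cons 1[rule_format, of b]
        by (simp add: chi_K K_m gen_word_scale chi_scale)
    qed
  qed simp
qed

abbreviation "ew w y \<equiv> chi (foldr E w y)"

lemma linear_ew: "linear_on (car M) (ew w)"
  by (rule linear_on_compose[OF linear_word _ linear_chi]) auto

lemma chi_E_F_rev: "ew w (Fm w') = ew (rev w') (Fm (rev w))"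
proof -
  have "flip_gen \<circ> GE = GF" "flip_gen \<circ> GF = GE" by auto
  then show ?thesis using chi_flip[of "map GE w @ map GF w'"]
    by (simp add: foldr_map o_def rev_map)
qed

lemma ew_K: "y \<in> car M \<Longrightarrow> ew w (K h y) = qw D (\<mu> - wt w) h * ew w y"
proof -
  assume y: "y \<in> car M"
  have "qw D (wt w) h * ew w (K h y) = chi (K h (foldr E w y))"
    using y by (simp add: K_E_word chi_scale)
  also have "\<dots> = qw D \<mu> h * ew w y" using y by (simp add: chi_K)
  finally show ?thesis by (simp add: qw_diff_left D field_simps)
qed

end

section \<open>Irreducible Verma modules: separation and relations of the functionals\<close>

locale irreducible_verma = verma +
  assumes irreducible: "uq_irreducible M"
begin

text \<open>The common kernel of the functionals is the radical of the contravariant form. It is a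
  submodule that does not contain m, hence zero by irreducibility.\<close>

lemma ew_separates:
  assumes "y \<in> car M" "\<And>w. ew w y = 0"
  shows "y = 0"
proof -
  define R where "R = {y \<in> car M. \<forall>w. ew w y = 0}"
  have R: "y \<in> car M" "ew w y = 0" if "y \<in> R" for y w using that by (auto simp: R_def)
  have E: "E i y \<in> R" if "y \<in> R" for i y
  proof -
    have "ew w (E i y) = 0" for w using R(2)[OF that, of "w @ [i]"] by simp
    then show ?thesis using R[OF that] by (simp add: R_def)
  qed
  have K: "K h y \<in> R" if "y \<in> R" for h y
    using R[OF that] by (simp add: R_def ew_K)
  \<comment> \<open>\<open>F_i\<close> is pushed to the left through the \<open>E_j\<close>; the
    commutators are values at vectors of R, and at the far left m* kills \<open>F_i\<close>.\<close>
  have F: "F i y \<in> R" if "y \<in> R" for i y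
  proof -
    have "ew w (F i y) = 0" for w
      using that
    proof (induction w arbitrary: y rule: rev_induct)
      case Nil
      then show ?case using R by simp
    next
      case (snoc j w)
      have y: "y \<in> car M" and "E j y \<in> car M" using R[OF snoc.prems] by auto
      have "ew w (F i (E j y)) = 0" using snoc.IH[OF E[OF snoc.prems]] .
      moreover have "ew w (K h y) = 0" for h using R(2)[OF K[OF snoc.prems]] .
      ultimately show ?case using y E_F[OF y, of j i]
        by (auto simp: linear_on_add[OF linear_ew] linear_on_scale[OF linear_ew] linear_on_diff[OF linear_ew subspace_car]
          linear_on_zero[OF linear_ew subspace_car] scaleC_complex)
    qed
    then show ?thesis using R[OF that] by (simp add: R_def)
  qed
  have "cvec.subspace R"
  proof (rule cvec.subspaceI)
    have "ew w 0 = 0" for w using linear_on_zero[OF linear_ew subspace_car] .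
    then show "0 \<in> R" by (simp add: R_def)
  qed (auto simp: R_def linear_on_add[OF linear_ew] linear_on_scale[OF linear_ew] scaleC_complex)
  moreover have "R \<subseteq> car M" by (auto simp: R_def)
  moreover have "act M g ` R \<subseteq> R" for g by (cases g) (use E F K in auto)
  ultimately have "R = {0} \<or> R = car M" using irreducible by (auto simp: uq_irreducible_def)
  moreover have "m \<notin> R" using R(2)[of m "[]"] by auto
  moreover have "y \<in> R" using assms by (simp add: R_def)
  ultimately show ?thesis using m_in by blast
qed

text \<open>As \<open>M\<close> is irreducible, linear relations between the functionals \<open>ew w\<close> are relations between the
  vectors \<open>Fm (rev w)\<close>, hence consequences of the Serre relations.\<close>

lemma ew_relation:
  fixes W :: "'w::cvec set"
  assumes A: "finite A" and rel: "\<And>w'. (\<Sum>w\<in>A. c w * ew w (Fm w')) = 0"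
    and W: "cvec.subspace W" and f: "\<And>i. linear_on W (f i)" "\<And>i. f i ` W \<subseteq> W"
    and v: "v \<in> W" and serre0: "\<And>i j x. i \<noteq> j \<Longrightarrow> x \<in> W \<Longrightarrow> serre_op D f i j x = 0"
  shows "(\<Sum>w\<in>A. c w *\<^sub>C foldr f (rev w) v) = 0"
proof -
  define y where "y = (\<Sum>w\<in>A. c w *\<^sub>C Fm (rev w))"
  have y: "y \<in> car M" by (auto simp: y_def intro!: sum_in)
  have "ew w' y = 0" for w'
  proof -
    have "ew w' y = (\<Sum>w\<in>A. c w * ew w' (Fm (rev w)))"
      unfolding y_def by (subst linear_on_sum[OF linear_ew subspace_car])
        (auto simp: linear_on_scale[OF linear_ew] scaleC_complex)
    also have "\<dots> = (\<Sum>w\<in>A. c w * ew w (Fm (rev w')))"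
    proof (rule sum.cong)
      show "c w * ew w' (Fm (rev w)) = c w * ew w (Fm (rev w'))" for w
        using chi_E_F_rev[of w' "rev w"] by (simp only: rev_rev_ident)
    qed simp
    finally show ?thesis using rel by simp
  qed
  then have "y = 0" using ew_separates[OF y] by blast
  moreover have "y = act_alg M (\<Sum>w\<in>rev ` A. Poly_Mapping.single (map GF w) (c (rev w))) m"
    by (simp add: y_def act_alg_setsum act_alg_word sum.reindex)
  ultimately have "(\<Sum>w\<in>rev ` A. Poly_Mapping.single (map GF w) (c (rev w))) \<in> verma_ideal D \<mu>"
    by (intro act_alg_eq_0_iff[THEN iffD1]) simp
  then have "(\<Sum>w\<in>rev ` A. c (rev w) *\<^sub>C foldr f w v) = 0"
    using A by (intro verma_ideal_word_relation[OF D W f v serre0]) auto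
  then show ?thesis by (simp add: sum.reindex)
qed

end

section \<open>Leading terms of tensors\<close>

declare plus_fun_apply [simp del] zero_fun_apply [simp del]

locale premodule_pair = X: premodule D X + T: premodule D T
  for D :: "'i::finite qdatum" and X :: "('i, 'v::cvec) uqmod" and T :: "('i, 'v) tens_uqmod"
begin

abbreviation "XT \<equiv> tens_mod X T"

lemma car_tens [simp]: "car XT = tens_space (car X) (car T)"
  by (simp add: tens_mod_def)

lemma bilinear_coproduct: "bilinear_on (car X) (car T) (coproduct_act X T g)"
  by (cases g) (auto simp: bilinear_on_def linear_on_def X.act_add X.act_scale T.act_add T.act_scale
    tcons_add_left tcons_add_right tcons_scale_left tcons_scale_right scaleC_right_distrib)

lemma linear_act_tens: "linear_on (car XT) (act XT g)"
  unfolding tens_mod_def by (simp add: linear_on_tens_lift[OF X.subspace_car T.subspace_car bilinear_coproduct])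

lemma act_tens: "x \<in> car X \<Longrightarrow> t \<in> car T \<Longrightarrow> act XT g (x \<otimes> t) = coproduct_act X T g x t"
  unfolding tens_mod_def by (simp add: tens_lift_tcons[OF X.subspace_car T.subspace_car bilinear_coproduct])

lemma coproduct_in: "x \<in> car X \<Longrightarrow> t \<in> car T \<Longrightarrow> coproduct_act X T g x t \<in> car XT"
  by (cases g) (auto intro!: tens_space_tcons cvec.subspace_add[OF subspace_tens_space])

lemma act_tens_subset: "act XT g ` car XT \<subseteq> car XT"
proof -
  have "act XT g ` cvec.span {x \<otimes> y |x y. x \<in> car X \<and> y \<in> car T} \<subseteq> car XT"
  proof (rule linear_on_span_image)
    show "linear_on (cvec.span {x \<otimes> y |x y. x \<in> car X \<and> y \<in> car T}) (act XT g)"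
      using linear_act_tens by (simp add: tens_space_def)
    show "act XT g ` {x \<otimes> y |x y. x \<in> car X \<and> y \<in> car T} \<subseteq> car XT"
      using coproduct_in by (auto simp: act_tens simp del: car_tens)
    show "cvec.subspace (car XT)" by (simp add: subspace_tens_space)
  qed
  then show ?thesis by (simp add: tens_space_def)
qed

lemma linear_act_act: "linear_on (car XT) (\<lambda>y. act XT g (act XT g' y))"
  by (rule linear_on_compose[OF linear_act_tens act_tens_subset linear_act_tens])

text \<open>All these relations are identities between linear maps, so pure tensors suffice. Only
  the commutator of \<open>E_i\<close> and \<open>F_j\<close> needs care.\<close>

lemma premodule_tens: "premodule D XT"
proof
  fix v assume v: "v \<in> car XT"
  note eqI = linear_on_tens_space_eqI[where X = "car X" and Y = "car T" and t = v]
  have v': "v \<in> tens_space (car X) (car T)" using v by simp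
  note lin = linear_act_tens[simplified] linear_act_act[simplified]
  show "act XT (GK 0) v = v"
  proof (rule eqI[OF _ _ _ v', where f = "act XT (GK 0)" and g = "\<lambda>v. v"])
  qed (use lin in \<open>auto simp: act_tens X.K_zero T.K_zero linear_on_id\<close>)
  fix h k
  show "act XT (GK (h + k)) v = act XT (GK h) (act XT (GK k) v)"
  proof (rule eqI[OF _ _ _ v', where f = "act XT (GK (h + k))" and g = "\<lambda>v. act XT (GK h) (act XT (GK k) v)"])
  qed (use lin in \<open>auto simp: act_tens X.K_add T.K_add\<close>)
  fix i
  show "act XT (GK h) (act XT (GE i) v) = qw D (alpha i) h *\<^sub>C act XT (GE i) (act XT (GK h) v)"
  proof (rule eqI[OF _ _ _ v', where f = "\<lambda>v. act XT (GK h) (act XT (GE i) v)"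
        and g = "\<lambda>v. qw D (alpha i) h *\<^sub>C act XT (GE i) (act XT (GK h) v)"])
    fix x t assume xt: "x \<in> car X" "t \<in> car T"
    show "act XT (GK h) (act XT (GE i) (x \<otimes> t)) = qw D (alpha i) h *\<^sub>C act XT (GE i) (act XT (GK h) (x \<otimes> t))"
      using xt T.K_commute[of t h "alpha i"] by (simp add: act_tens tens_space_tcons linear_on_add[OF lin(1)] X.K_E T.K_E tcons_scale_left
        tcons_scale_right scaleC_right_distrib)
  qed (intro lin linear_on_cmult)+
  show "act XT (GK h) (act XT (GF i) v) = qw D (- alpha i) h *\<^sub>C act XT (GF i) (act XT (GK h) v)"
  proof (rule eqI[OF _ _ _ v', where f = "\<lambda>v. act XT (GK h) (act XT (GF i) v)"
        and g = "\<lambda>v. qw D (- alpha i) h *\<^sub>C act XT (GF i) (act XT (GK h) v)"])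
    fix x t assume xt: "x \<in> car X" "t \<in> car T"
    show "act XT (GK h) (act XT (GF i) (x \<otimes> t)) = qw D (- alpha i) h *\<^sub>C act XT (GF i) (act XT (GK h) (x \<otimes> t))"
      using xt X.K_commute[of x h "- alpha i"] by (simp add: act_tens tens_space_tcons linear_on_add[OF lin(1)] X.K_F T.K_F tcons_scale_left
        tcons_scale_right scaleC_right_distrib)
  qed (intro lin linear_on_cmult)+
  fix j
  define c where "c = (if i = j then 1 / (q_i D i - inverse (q_i D i)) else 0)"
  have EF: "(if i = j then (1 / (q_i D i - inverse (q_i D i))) *\<^sub>C z else 0) = c *\<^sub>C z" for z :: "'c::cvec"
    by (simp add: c_def)
  have "act XT (GE i) (act XT (GF j) v) = act XT (GF j) (act XT (GE i) v) +
      c *\<^sub>C (act XT (GK (alpha i)) v - act XT (GK (- alpha i)) v)"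
  proof (rule eqI[OF _ _ _ v', where f = "\<lambda>v. act XT (GE i) (act XT (GF j) v)"
        and g = "\<lambda>v. act XT (GF j) (act XT (GE i) v) +
      c *\<^sub>C (act XT (GK (alpha i)) v - act XT (GK (- alpha i)) v)"])
    fix x t assume xt: "x \<in> car X" "t \<in> car T"
    define xE xF xK xK' where "xE = act X (GE i) x" and "xF = act X (GF j) x" and "xK = act X (GK (alpha i)) x"
      and "xK' = act X (GK (- alpha j)) x"
    have 1: "act X (GE i) xF = act X (GF j) xE + c *\<^sub>C (xK - act X (GK (- alpha i)) x)"
      using X.E_F[OF xt(1), of i j] by (simp add: EF xE_def xF_def xK_def)
    have 2: "act T (GE i) (act T (GF j) t) = act T (GF j) (act T (GE i) t) +
        c *\<^sub>C (act T (GK (alpha i)) t - act T (GK (- alpha i)) t)"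
      using T.E_F[OF xt(2), of i j] by (simp add: EF)
    have 3: "act X (GK (- alpha j)) xE = inverse (qw D (alpha i) (alpha j)) *\<^sub>C act X (GE i) xK'"
      using X.K_E[OF xt(1), of "- alpha j" i] by (simp add: xE_def xK'_def qw_minus_right X.D)
    have 4: "act T (GK (alpha i)) (act T (GF j) t) = inverse (qw D (alpha j) (alpha i)) *\<^sub>C act T (GF j) (act T (GK (alpha i)) t)"
      using T.K_F[OF xt(2), of "alpha i" j] by (simp add: qw_minus_left X.D)
    \<comment> \<open>By symmetry of the form, the scalars of 3 and 4 agree, so the mixed terms with
      \<open>E_i\<close> on the left and \<open>F_j\<close> on the right factor coincide in L and R
      below.\<close>
    have 5: "qw D (alpha j) (alpha i) = qw D (alpha i) (alpha j)" by (rule qw_commute[OF X.D])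
    \<comment> \<open>For i = j the terms with \<open>q^(-alpha_i)\<close> on the left and
      \<open>q^(alpha_i)\<close> on the right cancel; for i \<noteq> j the constant c is 0.\<close>
    have 6: "c *\<^sub>C (xK \<otimes> act T (GK (alpha i)) t) - c *\<^sub>C (act X (GK (- alpha i)) x \<otimes> act T (GK (alpha i)) t)
        + (c *\<^sub>C (xK' \<otimes> act T (GK (alpha i)) t) - c *\<^sub>C (xK' \<otimes> act T (GK (- alpha i)) t))
       = c *\<^sub>C (xK \<otimes> act T (GK (alpha i)) t) - c *\<^sub>C (act X (GK (- alpha i)) x \<otimes> act T (GK (- alpha i)) t)"
      by (cases "i = j") (auto simp: xK'_def c_def)
    have tdl: "(a - b) \<otimes> s = a \<otimes> s - b \<otimes> s" for a b and s :: "'v tens"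
      using tcons_add_left[of "a - b" b s] by (simp add: eq_diff_eq)
    have tdr: "a \<otimes> (s - s') = a \<otimes> s - a \<otimes> s'" for a and s s' :: "'v tens"
      using tcons_add_right[of a "s - s'" s'] by (simp add: eq_diff_eq)
    have xin: "xE \<in> car X" "xF \<in> car X" "xK \<in> car X" "xK' \<in> car X"
      using xt by (auto simp: xE_def xF_def xK_def xK'_def)
    have L: "act XT (GE i) (act XT (GF j) (x \<otimes> t)) =
      act X (GE i) xF \<otimes> act T (GK (alpha i)) t + xF \<otimes> act T (GE i) t +
      (act X (GE i) xK' \<otimes> act T (GK (alpha i)) (act T (GF j) t) + xK' \<otimes> act T (GE i) (act T (GF j) t))"
      using xt xin by (simp add: act_tens tens_space_tcons linear_on_add[OF lin(1)] xF_def[symmetric] xK'_def[symmetric])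
    have R: "act XT (GF j) (act XT (GE i) (x \<otimes> t)) =
      act X (GF j) xE \<otimes> act T (GK (alpha i)) t + act X (GK (- alpha j)) xE \<otimes> act T (GF j) (act T (GK (alpha i)) t) +
      (xF \<otimes> act T (GE i) t + xK' \<otimes> act T (GF j) (act T (GE i) t))"
      using xt xin by (simp add: act_tens tens_space_tcons linear_on_add[OF lin(1)] xE_def[symmetric] xF_def[symmetric] xK'_def[symmetric])
    have K: "act XT (GK (alpha i)) (x \<otimes> t) = xK \<otimes> act T (GK (alpha i)) t"
      "act XT (GK (- alpha i)) (x \<otimes> t) = act X (GK (- alpha i)) x \<otimes> act T (GK (- alpha i)) t"
      using xt by (simp_all add: act_tens xK_def)
    show "act XT (GE i) (act XT (GF j) (x \<otimes> t)) = act XT (GF j) (act XT (GE i) (x \<otimes> t)) +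
      c *\<^sub>C (act XT (GK (alpha i)) (x \<otimes> t) - act XT (GK (- alpha i)) (x \<otimes> t))"
      unfolding L R K 1 2 3 4 5 using 6
      by (simp only: tcons_add_left tcons_add_right tcons_scale_left tcons_scale_right tdl tdr
        cvec.scale_right_diff_distrib) (simp add: algebra_simps)
  qed (intro lin linear_on_cmult linear_on_plus linear_on_minus)+
  then show "act XT (GE i) (act XT (GF j) v) = act XT (GF j) (act XT (GE i) v) +
      (if i = j then (1 / (q_i D i - inverse (q_i D i))) *\<^sub>C
         (act XT (GK (alpha i)) v - act XT (GK (- alpha i)) v) else 0)"
    by (simp add: c_def)
qed (use X.D linear_act_tens act_tens_subset in \<open>auto simp: subspace_tens_space simp del: car_tens\<close>, auto simp: subspace_tens_space)

end

sublocale premodule_pair \<subseteq> XT: premodule D "tens_mod X T"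
  by (rule premodule_tens)

locale verma_tensor = verma D \<mu> M m + T: premodule D T
  for D :: "'i::finite qdatum" and \<mu> and M :: "('i, 'v::cvec) uqmod" and m and T :: "('i, 'v) tens_uqmod"

sublocale verma_tensor \<subseteq> premodule_pair D M T ..

context verma_tensor
begin

text \<open>The contraction \<open>ew w \<otimes> id\<close>. These contractions serve as
  coordinates for tensors, and the empty word gives the leading term.\<close>

definition test :: "'i list \<Rightarrow> 'v tens \<Rightarrow> 'v tens" where
  "test w = tens_lift (car M) (car T) (\<lambda>x t. ew w x *\<^sub>C t)"

abbreviation "lead \<equiv> test []"

lemma mstar_id_eq: "mstar_id D \<mu> M m T = lead"
  by (simp add: mstar_id_def test_def)

lemma bilinear_test: "bilinear_on (car M) (car T) (\<lambda>x t. ew w x *\<^sub>C t)"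
  by (auto simp: bilinear_on_def intro!: linear_on_cmult linear_on_id linear_on_scaled linear_ew)

lemma linear_test: "linear_on (car XT) (test w)"
  by (simp add: test_def linear_on_tens_lift[OF subspace_car T.subspace_car bilinear_test])

lemma test_tcons: "x \<in> car M \<Longrightarrow> t \<in> car T \<Longrightarrow> test w (x \<otimes> t) = ew w x *\<^sub>C t"
  by (simp add: test_def tens_lift_tcons[OF subspace_car T.subspace_car bilinear_test])

lemmas test_add = linear_on_add[OF linear_test, unfolded car_tens]
  and test_diff = linear_on_diff[OF linear_test XT.subspace_car, unfolded car_tens]
  and test_scale = linear_on_scale[OF linear_test, unfolded car_tens]
  and test_zero [simp] = linear_on_zero[OF linear_test XT.subspace_car]
  and test_sum = linear_on_sum[OF linear_test XT.subspace_car, unfolded car_tens]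

lemma tens_eqI:
  assumes "y \<in> car XT" "linear_on (car XT) f" "linear_on (car XT) g"
    and "\<And>x t. x \<in> car M \<Longrightarrow> t \<in> car T \<Longrightarrow> f (x \<otimes> t) = g (x \<otimes> t)"
  shows "f y = g y"
  by (rule linear_on_tens_space_eqI[OF assms(2,3)[unfolded car_tens] assms(4) assms(1)[unfolded car_tens]])

lemma tens_image_subset:
  assumes "linear_on (car XT) f" "cvec.subspace Y"
    and "\<And>x t. x \<in> car M \<Longrightarrow> t \<in> car T \<Longrightarrow> f (x \<otimes> t) \<in> Y"
  shows "f ` car XT \<subseteq> Y"
proof -
  have "f ` cvec.span {x \<otimes> y |x y. x \<in> car M \<and> y \<in> car T} \<subseteq> Y"
    using assms by (intro linear_on_span_image) (auto simp: tens_space_def)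
  then show ?thesis by (simp add: tens_space_def)
qed

lemma test_in: "y \<in> car XT \<Longrightarrow> test w y \<in> car T"
  using tens_image_subset[OF linear_test T.subspace_car] by (auto simp: test_tcons simp del: car_tens)

lemma linear_test_act: "linear_on (car XT) (\<lambda>y. test w (act XT g y))"
  by (rule linear_on_compose[OF linear_act_tens act_tens_subset linear_test])

lemma linear_act_test: "linear_on (car XT) (\<lambda>y. act T g (test w y))"
  by (rule linear_on_compose[OF linear_test _ T.linear_act]) (use test_in in blast)

text \<open>Acting by \<open>E_i\<close> inside m* lengthens the word at its end. When
  \<open>E_i y = 0\<close> this becomes a recursion that computes the contraction with
  \<open>w @ [i]\<close> from the one with w.\<close>

lemma test_E:
  assumes y: "y \<in> car XT"
  shows "test w (XT.E i y) = T.K (alpha i) (test (w @ [i]) y) + T.E i (test w y)"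
proof (rule tens_eqI[OF y])
  fix x t assume "x \<in> car M" "t \<in> car T"
  then show "test w (XT.E i (x \<otimes> t)) = T.K (alpha i) (test (w @ [i]) (x \<otimes> t)) + T.E i (test w (x \<otimes> t))"
    by (simp add: act_tens test_add tens_space_tcons test_tcons T.act_scale)
qed (intro linear_test_act linear_act_test linear_on_plus)+

lemma test_K:
  assumes y: "y \<in> car XT"
  shows "test w (XT.K h y) = qw D (\<mu> - wt w) h *\<^sub>C T.K h (test w y)"
proof (rule tens_eqI[OF y])
  fix x t assume "x \<in> car M" "t \<in> car T"
  then show "test w (XT.K h (x \<otimes> t)) = qw D (\<mu> - wt w) h *\<^sub>C T.K h (test w (x \<otimes> t))"
    by (simp add: act_tens test_tcons T.act_scale ew_K scaleC_scaleC)
qed (intro linear_test_act linear_act_test linear_on_cmult)+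

text \<open>m* kills the image of \<open>F_i\<close>, so only the summand
  \<open>q^(-alpha_i) \<otimes> F_i\<close> of the coproduct contributes.\<close>

lemma lead_F:
  assumes y: "y \<in> car XT"
  shows "lead (XT.F i y) = qw D \<mu> (- alpha i) *\<^sub>C T.F i (lead y)"
proof (rule tens_eqI[OF y])
  fix x t assume "x \<in> car M" "t \<in> car T"
  then show "lead (XT.F i (x \<otimes> t)) = qw D \<mu> (- alpha i) *\<^sub>C T.F i (lead (x \<otimes> t))"
    by (simp add: act_tens test_add tens_space_tcons test_tcons T.act_scale chi_K scaleC_scaleC)
qed (intro linear_test_act linear_act_test linear_on_cmult)+

lemma lead_F_word:
  assumes y: "y \<in> car XT"
  shows "lead (foldr XT.F w y) = qw D \<mu> (- wt w) *\<^sub>C foldr T.F w (lead y)"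
proof (induction w)
  case Nil
  then show ?case by (simp add: D scaleC_one)
next
  case (Cons i w)
  have "lead (foldr XT.F (i # w) y) = qw D \<mu> (- alpha i) *\<^sub>C T.F i (lead (foldr XT.F w y))"
    using lead_F[OF XT.word_map_in[OF y]] by simp
  then show ?case unfolding Cons.IH using T.word_map_in[OF test_in[OF y], of GF w]
    by (simp add: T.act_scale scaleC_scaleC qw_add_right[OF D, symmetric] add.commute)
qed

end

locale irreducible_verma_tensor = verma_tensor D \<mu> M m T + irreducible_verma D \<mu> M m
  for D :: "'i::finite qdatum" and \<mu> and M :: "('i, 'v::cvec) uqmod" and m and T :: "('i, 'v) tens_uqmod"
begin

text \<open>Evaluating the second tensor factor at a list of functionals reduces separation for tensors to
  separation on \<open>M\<close>.\<close>

lemma test_separates: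
  assumes y: "y \<in> car XT" and z: "\<And>w. test w y = 0"
  shows "y = 0"
proof (rule ext)
  fix l
  define sl where "sl fs = tens_lift (car M) (car T) (\<lambda>x t. t fs *\<^sub>C x)" for fs
  have bl: "bilinear_on (car M) (car T) (\<lambda>x t. t fs *\<^sub>C x)" for fs
    by (auto simp: bilinear_on_def linear_on_def scaleC_right_distrib scaleC_left_distrib scaleC_scaleC
      scaleC_fun_apply plus_fun_apply scaleC_complex mult.commute)
  have sl_lin: "linear_on (car XT) (sl fs)" for fs
    by (simp add: sl_def linear_on_tens_lift[OF subspace_car T.subspace_car bl])
  have sl_tcons: "sl fs (x \<otimes> t) = t fs *\<^sub>C x" if "x \<in> car M" "t \<in> car T" for fs x t
    using that by (simp add: sl_def tens_lift_tcons[OF subspace_car T.subspace_car bl])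
  have sl_in: "sl fs ` car XT \<subseteq> car M" for fs
    by (rule tens_image_subset[OF sl_lin subspace_car]) (simp add: sl_tcons)
  have ew_sl: "ew w (sl fs y) = test w y fs" for w fs
  proof (rule tens_eqI[OF y])
    show "linear_on (car XT) (\<lambda>y. ew w (sl fs y))"
      by (rule linear_on_compose[OF sl_lin sl_in linear_ew])
    show "linear_on (car XT) (\<lambda>y. test w y fs)"
      using linear_test[of w] by (auto simp: linear_on_def scaleC_fun_apply plus_fun_apply)
  qed (simp add: sl_tcons test_tcons linear_on_scale[OF linear_ew] scaleC_fun_apply scaleC_complex)
  have sl0: "sl fs y = 0" for fs
  proof (rule ew_separates)
    show "sl fs y \<in> car M" using sl_in y by blast
    show "ew w (sl fs y) = 0" for w using ew_sl z by (simp add: zero_fun_apply)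
  qed
  show "y l = 0 l"
  \<comment> \<open>By the encoding of tensors, every element of the tensor space vanishes at lists
    that are empty or begin with a nonlinear function.\<close>
  proof (cases "l = [] \<or> \<not> linear_on UNIV (hd l)")
    case True
    have "y l = 0"
    proof (rule tens_eqI[OF y])
      show "linear_on (car XT) (\<lambda>y. y l)" by (simp add: linear_on_def scaleC_fun_apply plus_fun_apply)
      show "linear_on (car XT) (\<lambda>y. 0 :: complex)" by (rule linear_on_0)
    qed (use True in \<open>auto simp: tcons_def split: list.splits\<close>)
    then show ?thesis by (simp add: zero_fun_apply)
  next
    case False
    then obtain f fs where l: "l = f # fs" and f: "linear_on UNIV f" by (cases l) auto
    have "y l = f (sl fs y)"
    proof (rule tens_eqI[OF y])
      show "linear_on (car XT) (\<lambda>y. y l)" by (simp add: linear_on_def scaleC_fun_apply plus_fun_apply)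
      show "linear_on (car XT) (\<lambda>y. f (sl fs y))" by (rule linear_on_compose[OF sl_lin _ f]) simp
      fix x t assume "x \<in> car M" "t \<in> car T"
      then have "sl fs (x \<otimes> t) = t fs *\<^sub>C x" by (rule sl_tcons)
      moreover have "(x \<otimes> t) l = f x * t fs" by (simp add: l tcons_def f)
      ultimately show "(x \<otimes> t) l = f (sl fs (x \<otimes> t))"
        by (simp add: linear_on_scale[OF f] scaleC_complex)
    qed
    then show ?thesis using sl0 linear_on_zero[OF f cvec.subspace_UNIV] by (simp add: zero_fun_apply)
  qed
qed

text \<open>With \<open>E_i y = 0\<close>, \<open>test_E\<close> propagates vanishing from the
  leading term to all contractions, as \<open>q^(alpha_i)\<close> is invertible.\<close>

lemma singular_unique:
  assumes y: "y \<in> car XT" and E: "\<And>i. XT.E i y = 0" and lead0: "lead y = 0"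
  shows "y = 0"
proof (rule test_separates[OF y])
  show "test w y = 0" for w
  proof (induction w rule: rev_induct)
    case (snoc i w)
    then show ?case using test_E[OF y, of w i] T.K_eq_0_iff[OF test_in[OF y]] by (simp add: E)
  qed (rule lead0)
qed

text \<open>For a vector that need not be singular, \<open>test_E\<close> expresses its contractions
  through the leading terms of its images under words in the \<open>E_i\<close>.\<close>

lemma lead_E_words_separate:
  assumes y: "y \<in> car XT" and "\<And>u. lead (foldr XT.E u y) = 0"
  shows "y = 0"
proof (rule test_separates[OF y])
  show "test w y = 0" for w
    using assms
  proof (induction w arbitrary: y rule: rev_induct)
    case Nil
    show ?case using Nil(2)[of "[]"] by simp
  next
    case (snoc i w)
    have "test w (XT.E i y) = 0"
    proof (rule snoc.IH)
      show "XT.E i y \<in> car XT" using snoc.prems(1) by (rule XT.act_in)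
      show "lead (foldr XT.E u (XT.E i y)) = 0" for u
        using snoc.prems(2)[of "u @ [i]"] by simp
    qed
    moreover have "test w y = 0" using snoc by blast
    ultimately show ?case using test_E[OF snoc.prems(1), of w i] T.K_eq_0_iff[OF test_in[OF snoc.prems(1)]]
      by simp
  qed
qed

text \<open>The coproduct of a Serre element is not needed: the \<open>E\<^sub>k\<close> commute with it, and leading terms
  only see its action on the second factor.\<close>

lemma serre_F_tens:
  assumes ij: "i \<noteq> j" and T0: "\<And>t. t \<in> car T \<Longrightarrow> serre_op D T.F i j t = 0" and y: "y \<in> car XT"
  shows "serre_op D XT.F i j y = 0"
proof (rule lead_E_words_separate)
  let ?n = "nat (1 - cmat D i j)"
  show "serre_op D XT.F i j y \<in> car XT" using XT.serre_in(1)[OF y] .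
  have rep: "foldr f (replicate r k) z = (f k ^^ r) z" for f :: "'i \<Rightarrow> 'v tens \<Rightarrow> 'v tens" and r k z
    by (induction r) simp_all
  have lead_S: "lead (serre_op D XT.F i j z) = 0" if z: "z \<in> car XT" for z
  proof -
    \<comment> \<open>The scalar in \<open>lead_F_word\<close> depends only on the weight of the
      word, which all terms of a Serre element share.\<close>
    define c where "c = qw D \<mu> (- (wt (replicate ?n i) + alpha j))"
    have term_r: "lead ((XT.F i ^^ (?n - r)) (XT.F j ((XT.F i ^^ r) z))) =
        c *\<^sub>C (T.F i ^^ (?n - r)) (T.F j ((T.F i ^^ r) (lead z)))" if "r \<le> ?n" for r
    proof -
      have "wt (replicate (?n - r) i @ j # replicate r i) = wt (replicate ?n i) + alpha j"
        using that by (simp add: wt_replicate vec_eq_iff of_nat_diff algebra_simps)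
      then show ?thesis
        using lead_F_word[OF z, of "replicate (?n - r) i @ j # replicate r i"]
        by (simp only: c_def) (simp add: rep)
    qed
    have "lead (serre_op D XT.F i j z) = c *\<^sub>C serre_op D T.F i j (lead z)"
      unfolding serre_op_def Let_def
      by (subst linear_on_sum[OF linear_test XT.subspace_car])
        (use z in \<open>auto simp: linear_on_scale[OF linear_test] term_r scaleC_scaleC cvec.scale_sum_right mult.commute
          simp del: car_tens intro!: sum.cong\<close>)
    then show ?thesis using T0 test_in[OF z] by simp
  qed
  have "foldr XT.E u (serre_op D XT.F i j y) = serre_op D XT.F i j (foldr XT.E u y)" for u
    by (induction u) (simp_all add: XT.E_serre[OF ij] XT.word_map_in[OF y] del: car_tens)
  then show "lead (foldr XT.E u (serre_op D XT.F i j y)) = 0" for u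
    using lead_S[OF XT.word_map_in[OF y]] by simp
qed

end

section \<open>Existence of singular vectors\<close>

text \<open>Induction on A: on the kernel of \<open>e u\<close> the remaining functionals suffice,
  and what is left of g vanishes on that kernel, so it is a multiple of \<open>e u\<close>. The
  space X may have any dimension.\<close>

lemma functional_in_span:
  fixes e :: "'b \<Rightarrow> 'v::cvec \<Rightarrow> complex"
  assumes "finite A" "cvec.subspace X" "linear_on X g" "\<And>a. a \<in> A \<Longrightarrow> linear_on X (e a)"
    and "\<And>x. x \<in> X \<Longrightarrow> (\<And>a. a \<in> A \<Longrightarrow> e a x = 0) \<Longrightarrow> g x = 0"
  shows "\<exists>d. \<forall>x\<in>X. g x = (\<Sum>a\<in>A. d a * e a x)"
  using assms
proof (induction A arbitrary: X rule: finite_induct)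
  case (insert u A)
  note X = insert.prems(1)
  have lu: "linear_on X (e u)" and le: "\<And>a. a \<in> A \<Longrightarrow> linear_on X (e a)" using insert.prems(3) by auto
  define X' where "X' = {x \<in> X. e u x = 0}"
  have "cvec.subspace X'"
    unfolding X'_def using X linear_on_zero[OF lu X]
    by (intro cvec.subspaceI) (auto simp: linear_on_add[OF lu] linear_on_scale[OF lu] cvec.subspace_0
      cvec.subspace_add cvec.subspace_scale scaleC_complex)
  then have "\<exists>d. \<forall>x\<in>X'. g x = (\<Sum>a\<in>A. d a * e a x)"
  proof (rule insert.IH)
    show "linear_on X' g" by (rule linear_on_subset[OF insert.prems(2)]) (auto simp: X'_def)
    show "linear_on X' (e a)" if "a \<in> A" for a
      by (rule linear_on_subset[OF le[OF that]]) (auto simp: X'_def)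
    show "g x = 0" if "x \<in> X'" "\<And>a. a \<in> A \<Longrightarrow> e a x = 0" for x
      using that by (intro insert.prems(4)) (auto simp: X'_def)
  qed
  then obtain d where d: "\<And>x. x \<in> X \<Longrightarrow> e u x = 0 \<Longrightarrow> g x = (\<Sum>a\<in>A. d a * e a x)"
    by (auto simp: X'_def)
  define g' where "g' x = g x - (\<Sum>a\<in>A. d a * e a x)" for x
  have lg': "linear_on X g'"
    unfolding g'_def
    by (intro linear_on_minus insert.prems(2) linear_on_setsum)
      (use linear_on_cmult[OF le] in \<open>simp add: scaleC_complex\<close>)
  have g'0: "g' x = 0" if "x \<in> X" "e u x = 0" for x using d[OF that] by (simp add: g'_def)
  have "\<exists>c. \<forall>x\<in>X. g' x = c * e u x"
  proof (cases "\<forall>x\<in>X. e u x = 0")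
    case True
    then show ?thesis using g'0 by (intro exI[of _ 0]) auto
  next
    case False
    then obtain x1 where x1: "x1 \<in> X" "e u x1 \<noteq> 0" by auto
    show ?thesis
    proof (intro exI[of _ "g' x1 / e u x1"] ballI)
      fix x assume x: "x \<in> X"
      let ?c = "e u x / e u x1"
      have cx: "?c *\<^sub>C x1 \<in> X" using x1 X by (simp add: cvec.subspace_scale)
      have "g' (x - ?c *\<^sub>C x1) = 0"
        using x cx x1 X by (intro g'0) (simp_all add: cvec.subspace_diff linear_on_diff[OF lu X] linear_on_scale[OF lu]
          scaleC_complex)
      then show "g' x = g' x1 / e u x1 * e u x"
        using x cx x1 by (simp add: linear_on_diff[OF lg' X] linear_on_scale[OF lg'] scaleC_complex)
    qed
  qed
  then obtain c where c: "\<And>x. x \<in> X \<Longrightarrow> g' x = c * e u x" by auto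
  show ?case
  proof (intro exI[of _ "d(u := c)"] ballI)
    fix x assume "x \<in> X"
    have "(\<Sum>a\<in>A. (d(u := c)) a * e a x) = (\<Sum>a\<in>A. d a * e a x)"
      using insert.hyps(2) by (intro sum.cong) auto
    then show "g x = (\<Sum>a\<in>insert u A. (d(u := c)) a * e a x)"
      using insert.hyps c[OF \<open>x \<in> X\<close>] by (simp add: g'_def algebra_simps)
  qed
qed auto

text \<open>A functional that depends on the earlier ones has its value forced by the hypothesis on
  relations. Otherwise some x0 is killed by the earlier functionals but not by the new one, and
  adding a rank one tensor with first factor x0 corrects the new value alone.\<close>

lemma tensor_with_prescribed_values:
  fixes e :: "'b \<Rightarrow> 'v::cvec \<Rightarrow> complex" and Y :: "'b \<Rightarrow> 'w::cvec"
  assumes "finite A" and X: "cvec.subspace X" and S: "cvec.subspace S"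
    and "\<And>a. a \<in> A \<Longrightarrow> linear_on X (e a)" "\<And>a. a \<in> A \<Longrightarrow> Y a \<in> S"
    and "\<And>c. (\<And>x. x \<in> X \<Longrightarrow> (\<Sum>a\<in>A. c a * e a x) = 0) \<Longrightarrow> (\<Sum>a\<in>A. c a *\<^sub>C Y a) = 0"
  shows "\<exists>(n::nat) x t. (\<forall>i<n. x i \<in> X \<and> t i \<in> S) \<and> (\<forall>a\<in>A. (\<Sum>i<n. e a (x i) *\<^sub>C t i) = Y a)"
  using assms(1,4-)
proof (induction A rule: finite_induct)
  case empty
  show ?case by (intro exI[of _ 0]) auto
next
  case (insert u A)
  have "\<exists>(n::nat) x t. (\<forall>i<n. x i \<in> X \<and> t i \<in> S) \<and> (\<forall>a\<in>A. (\<Sum>i<n. e a (x i) *\<^sub>C t i) = Y a)"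
  proof (rule insert.IH)
    fix c assume c: "\<And>x. x \<in> X \<Longrightarrow> (\<Sum>a\<in>A. c a * e a x) = 0"
    have eq: "(\<Sum>a\<in>A. (c(u := 0)) a * z a) = (\<Sum>a\<in>A. c a * z a)"
      "(\<Sum>a\<in>A. (c(u := 0)) a *\<^sub>C z' a) = (\<Sum>a\<in>A. c a *\<^sub>C z' a)" for z and z' :: "'b \<Rightarrow> 'w"
      using insert.hyps(2) by (auto intro!: sum.cong)
    have "(\<Sum>a\<in>insert u A. (c(u := 0)) a *\<^sub>C Y a) = 0"
    proof (rule insert.prems(3))
      fix x assume "x \<in> X"
      then show "(\<Sum>a\<in>insert u A. (c(u := 0)) a * e a x) = 0"
        using insert.hyps c eq(1)[of "\<lambda>a. e a x"] by simp
    qed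
    then show "(\<Sum>a\<in>A. c a *\<^sub>C Y a) = 0" using insert.hyps eq(2)[of Y] by simp
  qed (use insert.prems in auto)
  then obtain n :: nat and x t where xt: "\<And>i. i < n \<Longrightarrow> x i \<in> X \<and> t i \<in> S"
    and val: "\<And>a. a \<in> A \<Longrightarrow> (\<Sum>i<n. e a (x i) *\<^sub>C t i) = Y a" by blast
  show ?case
  proof (cases "\<exists>d. \<forall>x\<in>X. e u x = (\<Sum>a\<in>A. d a * e a x)")
    case True
    then obtain d where d: "\<And>x. x \<in> X \<Longrightarrow> e u x = (\<Sum>a\<in>A. d a * e a x)" by blast
    have "(\<Sum>a\<in>insert u A. (d(u := -1)) a *\<^sub>C Y a) = 0"
    proof (rule insert.prems(3))
      fix x assume "x \<in> X"
      have "(\<Sum>a\<in>A. (d(u := -1)) a * e a x) = (\<Sum>a\<in>A. d a * e a x)"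
        using insert.hyps(2) by (intro sum.cong) auto
      then show "(\<Sum>a\<in>insert u A. (d(u := -1)) a * e a x) = 0"
        using insert.hyps d[OF \<open>x \<in> X\<close>] by simp
    qed
    moreover have "(\<Sum>a\<in>A. (d(u := -1)) a *\<^sub>C Y a) = (\<Sum>a\<in>A. d a *\<^sub>C Y a)"
      using insert.hyps(2) by (intro sum.cong) auto
    ultimately have Yu: "Y u = (\<Sum>a\<in>A. d a *\<^sub>C Y a)" using insert.hyps by simp
    have "(\<Sum>i<n. e u (x i) *\<^sub>C t i) = (\<Sum>i<n. \<Sum>a\<in>A. d a *\<^sub>C (e a (x i) *\<^sub>C t i))"
      using xt by (intro sum.cong) (simp_all add: d cvec.scale_sum_left scaleC_scaleC)
    also have "\<dots> = (\<Sum>a\<in>A. d a *\<^sub>C (\<Sum>i<n. e a (x i) *\<^sub>C t i))"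
      by (subst sum.swap) (simp only: cvec.scale_sum_right)
    also have "\<dots> = (\<Sum>a\<in>A. d a *\<^sub>C Y a)" by (simp add: val)
    finally have "(\<Sum>i<n. e u (x i) *\<^sub>C t i) = Y u" by (simp add: Yu)
    then show ?thesis using xt val by (intro exI[of _ n] exI[of _ x] exI[of _ t]) auto
  next
    case False
    have "\<not> (\<forall>x\<in>X. (\<forall>a\<in>A. e a x = 0) \<longrightarrow> e u x = 0)"
    proof
      assume "\<forall>x\<in>X. (\<forall>a\<in>A. e a x = 0) \<longrightarrow> e u x = 0"
      then have "\<exists>d. \<forall>x\<in>X. e u x = (\<Sum>a\<in>A. d a * e a x)"
        using insert.hyps(1) insert.prems(1) by (intro functional_in_span X) auto
      then show False using False by blast
    qed
    then obtain x0 where x0: "x0 \<in> X" "\<And>a. a \<in> A \<Longrightarrow> e a x0 = 0" "e u x0 \<noteq> 0" by auto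
    define z where "z = (1 / e u x0) *\<^sub>C (Y u - (\<Sum>i<n. e u (x i) *\<^sub>C t i))"
    have "z \<in> S" unfolding z_def
      using insert.prems(2) xt by (intro cvec.subspace_scale[OF S] cvec.subspace_diff[OF S] cvec.subspace_sum[OF S]) auto
    define x' where "x' = x(n := x0)"
    define t' where "t' = t(n := z)"
    have "(\<Sum>i<n. e a (x' i) *\<^sub>C t' i) = (\<Sum>i<n. e a (x i) *\<^sub>C t i)" for a
      by (intro sum.cong) (auto simp: x'_def t'_def)
    then have s: "(\<Sum>i<Suc n. e a (x' i) *\<^sub>C t' i) = (\<Sum>i<n. e a (x i) *\<^sub>C t i) + e a x0 *\<^sub>C z" for a
      by (simp add: x'_def t'_def)
    show ?thesis
    proof (intro exI[of _ "Suc n"] exI[of _ x'] exI[of _ t'] conjI allI impI ballI)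
      fix i assume "i < Suc n"
      then show "x' i \<in> X" "t' i \<in> S" using xt x0(1) \<open>z \<in> S\<close> by (auto simp: x'_def t'_def less_Suc_eq)
    next
      fix a assume "a \<in> insert u A"
      then show "(\<Sum>i<Suc n. e a (x' i) *\<^sub>C t' i) = Y a"
        unfolding s using val x0 by (auto simp: z_def scaleC_scaleC scaleC_one)
    qed
  qed
qed

section \<open>Rescaled raising operators and homomorphisms from singular vectors\<close>

context premodule
begin

text \<open>The operators \<open>-q\<^bsup>-\<alpha>\<^sub>i\<^esup> E\<^sub>i\<close> satisfy the Serre relations: in a word, collecting the \<open>q\<^sup>h\<close> gives a
  factor depending only on the multiset of letters.\<close>

definition twisted_E :: "'i \<Rightarrow> 'v \<Rightarrow> 'v" where
  "twisted_E i v = - K (- alpha i) (E i v)"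

text \<open>The scalar that appears when the factors \<open>q^(-alpha_i)\<close> in a word of
  \<open>twisted_E\<close> are moved to the left: a sign times the product of
  \<open>q^(alpha_a, alpha_b)\<close> over all pairs of positions a < b. Half of the total form
  minus its diagonal is this pair sum, written so that its independence of the order of the letters
  is visible.\<close>

definition twist :: "'i list \<Rightarrow> complex" where
  "twist w = (-1) ^ length w * qpow D ((bil D (wt w) (wt w) - sum_list (map (\<lambda>k. bil D (alpha k) (alpha k)) w)) / 2)"

lemma twist_Cons: "twist (i # w) = - (qw D (alpha i) (wt w) * twist w)"
proof -
  have "(bil D (alpha i + wt w) (alpha i + wt w) - (bil D (alpha i) (alpha i) + sum_list (map (\<lambda>k. bil D (alpha k) (alpha k)) w))) / 2
    = bil D (alpha i) (wt w) + (bil D (wt w) (wt w) - sum_list (map (\<lambda>k. bil D (alpha k) (alpha k)) w)) / 2"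
    using bil_commute[OF D, of "wt w" "alpha i"] by (simp add: bil_add_left bil_add_right field_simps)
  then show ?thesis
    by (simp only: twist_def wt_simps list.map sum_list.Cons length_Cons qw_def qpow_add[OF D]) simp
qed

lemma twisted_E_word:
  assumes v: "v \<in> car X"
  shows "foldr twisted_E w v = twist w *\<^sub>C K (- wt w) (foldr E w v)"
proof (induction w)
  case Nil
  show ?case using v by (simp add: twist_def bil_zero_left qpow_0 D K_zero scaleC_one)
next
  case (Cons i w)
  let ?y = "foldr E w v"
  have y: "?y \<in> car X" using v by blast
  have "E i (K (- wt w) ?y) = qw D (alpha i) (wt w) *\<^sub>C K (- wt w) (E i ?y)"
    using K_E[OF y, of "- wt w" i] by (simp add: scaleC_scaleC qw_minus_right D scaleC_one)
  then show ?case using y K_add[of "E i ?y" "- alpha i" "- wt w"]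
    unfolding foldr.simps o_apply Cons.IH by (simp add: twisted_E_def act_scale scaleC_scaleC twist_Cons mult.commute)
qed

lemma twisted_E_in: "twisted_E i ` car X \<subseteq> car X"
  using cvec.subspace_neg[OF subspace_car] by (auto simp: twisted_E_def)

lemma linear_twisted_E: "linear_on (car X) (twisted_E i)"
proof -
  have "linear_on (car X) (\<lambda>v. (-1) *\<^sub>C K (- alpha i) (E i v))"
    by (intro linear_on_cmult linear_on_compose[OF linear_act _ linear_act]) auto
  then show ?thesis by (simp add: twisted_E_def[abs_def])
qed

lemma twisted_E_serre:
  assumes v: "v \<in> car X" and z: "serre_op D E i j v = 0"
  shows "serre_op D twisted_E i j v = 0"
proof -
  let ?n = "nat (1 - cmat D i j)"
  define W where "W r = replicate (?n - r) i @ j # replicate r i" for r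
  have rep: "foldr f (replicate r k) y = (f k ^^ r) y" for f :: "'i \<Rightarrow> 'v \<Rightarrow> 'v" and r k y
    by (induction r) simp_all
  have W: "foldr f (W r) v = (f i ^^ (?n - r)) (f j ((f i ^^ r) v))" for f :: "'i \<Rightarrow> 'v \<Rightarrow> 'v" and r
    by (simp add: W_def rep)
  define \<beta> where "\<beta> = wt (W 0)"
  have wtW: "wt (W r) = \<beta>" if "r \<le> ?n" for r
    using that by (simp add: W_def \<beta>_def wt_replicate vec_eq_iff of_nat_diff algebra_simps)
  have "sum_list (map (\<lambda>k. bil D (alpha k) (alpha k)) (W r)) = of_nat ?n * bil D (alpha i) (alpha i) + bil D (alpha j) (alpha j)"
    if "r \<le> ?n" for r
    using that by (simp add: W_def sum_list_replicate of_nat_diff algebra_simps)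
  moreover define \<tau> where "\<tau> = twist (W 0)"
  ultimately have tw: "twist (W r) = \<tau>" if "r \<le> ?n" for r
    using that wtW[OF that] by (simp add: \<tau>_def twist_def \<beta>_def[symmetric]) (simp add: W_def)
  have "serre_op D twisted_E i j v = (\<Sum>r\<le>?n. ((- 1) ^ r * qbinom (q_i D i) ?n r) *\<^sub>C foldr twisted_E (W r) v)"
    by (simp add: serre_op_def Let_def W)
  also have "\<dots> = (\<Sum>r\<le>?n. \<tau> *\<^sub>C K (- \<beta>) (((- 1) ^ r * qbinom (q_i D i) ?n r) *\<^sub>C foldr E (W r) v))"
    using v by (intro sum.cong)
      (simp_all add: twisted_E_word[OF v] tw wtW act_scale word_map_in scaleC_scaleC mult.commute)
  also have "\<dots> = \<tau> *\<^sub>C K (- \<beta>) (\<Sum>r\<le>?n. ((- 1) ^ r * qbinom (q_i D i) ?n r) *\<^sub>C foldr E (W r) v)"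
    using v by (subst act_sum) (auto simp: cvec.scale_sum_right)
  also have "(\<Sum>r\<le>?n. ((- 1) ^ r * qbinom (q_i D i) ?n r) *\<^sub>C foldr E (W r) v) = serre_op D E i j v"
    by (simp add: serre_op_def Let_def W)
  finally show ?thesis by (simp add: z)
qed

text \<open>The Serre relations in the \<open>F_i\<close> are assumed on all of X. Those in the
  \<open>E_i\<close> hold on the submodule generated by s: they hold at s, they commute with every
  \<open>F_k\<close>, and the words in the \<open>F_k\<close> applied to s span that
  submodule.\<close>

lemma verma_ideal_singular:
  assumes s: "s \<in> car X" and Es: "\<And>i. E i s = 0" and Ks: "\<And>h. K h s = qw D lam h *\<^sub>C s"
    and F0: "\<And>i j v. i \<noteq> j \<Longrightarrow> v \<in> car X \<Longrightarrow> serre_op D F i j v = 0"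
    and x: "x \<in> verma_ideal D lam"
  shows "act_alg X x s = 0"
  using x
proof (induction rule: verma_ideal.induct)
  case (mult x a)
  then show ?case using s linear_on_zero[OF act_alg_mult_linear(4)[OF subspace_car linear_act act_subset s] subspace_car]
    by (simp add: act_alg_mult)
next
  case (rel r b)
  let ?y = "act_alg X b s"
  have y: "?y \<in> car X" using s by simp
  have E0: "serre_op D E i j ?y = 0" if ij: "i \<noteq> j" for i j
  proof -
    let ?R = "range (\<lambda>w. foldr F w s)"
    have RX: "cvec.span ?R \<subseteq> car X" using s by (intro cvec.span_minimal subspace_car) auto
    have "(E i ^^ n) 0 = 0" for n by (induction n) simp_all
    moreover have "(E i ^^ r) s = (if r = 0 then s else 0)" for r by (induction r) (auto simp: Es)
    ultimately have s0: "serre_op D E i j s = 0"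
      by (auto simp: serre_op_def Let_def Es intro!: sum.neutral)
    have Fw: "serre_op D E i j (foldr F w s) = 0" for w
    proof (induction w)
      case (Cons k w)
      then show ?case using F_serre[OF ij word_map_in[OF s], of k GF w] by simp
    qed (simp add: s0)
    show ?thesis
    proof (rule linear_on_span_eqI[where G = ?R and f = "serre_op D E i j" and g = "\<lambda>_. 0"])
      show "linear_on (cvec.span ?R) (serre_op D E i j)" by (rule linear_on_subset[OF linear_serre RX])
      show "act_alg X b s \<in> cvec.span ?R" by (rule submodule_of_singular[OF s Es Ks])
    qed (use Fw in \<open>auto simp: linear_on_0\<close>)
  qed
  show ?case using act_alg_rel[OF rel y] E0 F0[OF _ y] s by (auto simp: act_alg_mult)
qed (simp_all add: act_alg_add act_alg_diff Es Ks qw_def)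

lemma singular_homomorphism:
  assumes s: "s \<in> car X" and Es: "\<And>i. E i s = 0" and Ks: "\<And>h. K h s = qw D lam h *\<^sub>C s"
    and F0: "\<And>i j v. i \<noteq> j \<Longrightarrow> v \<in> car X \<Longrightarrow> serre_op D F i j v = 0"
    and M: "verma D lam M m"
  shows "\<exists>f. f \<in> extensional (car M) \<and> uq_linear M X f \<and> f m = s"
proof -
  interpret M: verma D lam M m by (rule M)
  define u where "u y = (SOME x. act_alg M x m = y)" for y
  define f where "f = restrict (\<lambda>y. act_alg X (u y) s) (car M)"
  have fg: "f (act_alg M x m) = act_alg X x s" for x
  proof -
    have "act_alg M (u (act_alg M x m)) m = act_alg M x m"
      unfolding u_def by (rule someI[where x = x]) (rule refl)
    then have "u (act_alg M x m) - x \<in> verma_ideal D lam"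
      by (simp add: M.act_alg_eq_0_iff[symmetric] act_alg_diff)
    then have "act_alg X (u (act_alg M x m) - x) s = 0"
      by (rule verma_ideal_singular[OF s Es Ks, rotated]) (rule F0)
    then have "act_alg X (u (act_alg M x m)) s = act_alg X x s" by (simp add: act_alg_diff)
    moreover have "act_alg M x m \<in> car M" by (intro M.alg_in M.m_in)
    ultimately show ?thesis unfolding f_def by (simp only: restrict_apply if_True)
  qed
  have "uq_linear M X f"
    unfolding uq_linear_def
  proof (intro conjI allI ballI linear_onI)
    show "f ` car M \<subseteq> car X" using s by (auto simp: M.car_eq fg)
  next
    fix x y assume "x \<in> car M" "y \<in> car M"
    then obtain a b where "x = act_alg M a m" "y = act_alg M b m" by (auto simp: M.car_eq)
    then show "f (x + y) = f x + f y" using fg[of "a + b"] by (simp add: act_alg_add fg)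
  next
    fix c x assume "x \<in> car M"
    then obtain a where "x = act_alg M a m" by (auto simp: M.car_eq)
    then show "f (c *\<^sub>C x) = c *\<^sub>C f x"
      using fg[of "cst c * a"] s by (simp add: act_alg_mult M.act_alg_mult fg)
  next
    fix g x assume "x \<in> car M"
    then obtain a where "x = act_alg M a m" by (auto simp: M.car_eq)
    moreover have "f (act_alg M (Poly_Mapping.single [g] 1 * a) m) = act_alg X (Poly_Mapping.single [g] 1 * a) s"
      by (rule fg)
    ultimately show "f (act M g x) = act X g (f x)"
      using s by (simp add: act_alg_mult M.act_alg_mult fg act_alg_single scaleC_one)
  qed
  moreover have "f m = s" using fg[of 1] by simp
  moreover have "f \<in> extensional (car M)" by (simp add: f_def)
  ultimately show ?thesis by blast
qed

end

context irreducible_verma_tensor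
begin

lemma ew_Fm_eq_0: "wt w \<noteq> wt w' \<Longrightarrow> ew w (Fm w') = 0"
proof -
  assume "wt w \<noteq> wt w'"
  then have "\<mu> - wt w \<noteq> \<mu> - wt w'" by simp
  then obtain h where h: "qw D (\<mu> - wt w) h \<noteq> qw D (\<mu> - wt w') h" using qw_eqD[OF D] by blast
  have "ew w (K h (Fm w')) = qw D (\<mu> - wt w) h * ew w (Fm w')" by (rule ew_K) auto
  moreover have "ew w (K h (Fm w')) = qw D (\<mu> - wt w') h * ew w (Fm w')"
    by (simp add: K_Fm linear_on_scale[OF linear_ew] scaleC_complex word_map_in)
  ultimately show ?thesis using h by auto
qed

lemma length_eq_of_wt_eq: "wt w = wt w' \<Longrightarrow> length w = length w'"
  using wt_coordinate_sum[of w] wt_coordinate_sum[of w'] by simp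

text \<open>Nilpotency of the \<open>E_i\<close> on t reduces the forced contractions to finitely
  many words. They are realized by \<open>tensor_with_prescribed_values\<close>, whose compatibility
  condition is supplied by \<open>ew_relation\<close> for the operators
  \<open>twisted_E\<close>.\<close>

lemma singular_exists:
  assumes t: "t \<in> car T" and Kt: "\<And>h. T.K h t = qw D \<nu> h *\<^sub>C t"
    and E0: "\<And>i j x. i \<noteq> j \<Longrightarrow> x \<in> car T \<Longrightarrow> serre_op D T.E i j x = 0"
    and nil: "\<And>w. length w \<ge> N \<Longrightarrow> foldr T.E w t = 0"
  shows "\<exists>s\<in>car XT. lead s = t \<and> (\<forall>i. XT.E i s = 0) \<and> (\<forall>h. XT.K h s = qw D (\<mu> + \<nu>) h *\<^sub>C s)"
proof -
  \<comment> \<open>By \<open>test_E\<close>, the equation \<open>E_i s = 0\<close> amounts to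
    \<open>test (w @ [i]) s = twisted_E i (test w s)\<close>. Started at t, the recursion yields
    these values, with the letters of w in reversed order.\<close>
  define Y where "Y w = foldr T.twisted_E (rev w) t" for w
  define A where "A = {w :: 'i list. length w < N}"
  \<comment> \<open>For words of length at least N the required value is 0, and by weights the
    functional \<open>ew w\<close> vanishes on this X as well. Only the words in A remain to be
    matched.\<close>
  define X where "X = cvec.span (Fm ` A)"
  have "A \<subseteq> {w. set w \<subseteq> UNIV \<and> length w \<le> N}" by (auto simp: A_def)
  then have finA: "finite A" by (rule finite_subset) (rule finite_lists_length_le[OF finite])
  have X: "cvec.subspace X" by (simp add: X_def)
  have XM: "X \<subseteq> car M" unfolding X_def by (intro cvec.span_minimal subspace_car) auto
  have Yin: "Y w \<in> car T" for w
  proof -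
    have "foldr T.twisted_E u t \<in> car T" for u
      using T.twisted_E_in t by (induction u) auto
    then show ?thesis by (simp add: Y_def)
  qed
  have Y0: "Y w = 0" if "length w \<ge> N" for w
    using nil[of "rev w"] that by (simp add: Y_def T.twisted_E_word[OF t])
  have KY: "T.K h (Y w) = qw D (\<nu> + wt w) h *\<^sub>C Y w" for h w
  proof -
    have "T.K h (foldr T.E u t) = qw D (\<nu> + wt u) h *\<^sub>C foldr T.E u t" for u
      using T.K_E_word[OF t, of h u]
      by (simp add: Kt linear_on_scale[OF T.linear_word] t scaleC_scaleC qw_add_left[OF D] mult.commute)
    then show ?thesis using T.K_commute[of "foldr T.E (rev w) t" h "- wt w"] t
      by (simp add: Y_def T.twisted_E_word T.act_scale T.word_map_in T.act_in scaleC_scaleC mult.commute)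
  qed
  have ewX: "ew w x = 0" if "length w \<ge> N" "x \<in> X" for w x
  proof (rule linear_on_span_eqI[where G = "Fm ` A" and f = "ew w" and g = "\<lambda>_. 0"])
    show "linear_on (cvec.span (Fm ` A)) (ew w)"
      using linear_on_subset[OF linear_ew XM] by (simp add: X_def)
    show "ew w y = 0" if "y \<in> Fm ` A" for y
    proof -
      obtain w' where w': "y = Fm w'" "length w' < N" using \<open>y \<in> Fm ` A\<close> by (auto simp: A_def)
      then have "wt w \<noteq> wt w'" using length_eq_of_wt_eq[of w w'] \<open>length w \<ge> N\<close> by auto
      then show ?thesis by (simp add: w' ew_Fm_eq_0)
    qed
  qed (use that in \<open>auto simp: X_def linear_on_0\<close>)
  have "\<exists>(n::nat) x y. (\<forall>i<n. x i \<in> X \<and> y i \<in> car T) \<and> (\<forall>w\<in>A. (\<Sum>i<n. ew w (x i) *\<^sub>C y i) = Y w)"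
  proof (rule tensor_with_prescribed_values[OF finA X T.subspace_car])
    show "linear_on X (ew w)" for w by (rule linear_on_subset[OF linear_ew XM])
    show "Y w \<in> car T" for w by (rule Yin)
    fix c assume c: "\<And>x. x \<in> X \<Longrightarrow> (\<Sum>w\<in>A. c w * ew w x) = 0"
    show "(\<Sum>w\<in>A. c w *\<^sub>C Y w) = 0"
      unfolding Y_def
    proof (rule ew_relation[OF finA _ T.subspace_car T.linear_twisted_E T.twisted_E_in t])
      show "serre_op D T.twisted_E i j x = 0" if "i \<noteq> j" "x \<in> car T" for i j x
        using T.twisted_E_serre[OF that(2)] E0[OF that] by blast
      \<comment> \<open>The relation c is known on X only; the other vectors \<open>Fm w'\<close>
        have a length, hence a weight, that pairs to 0 with all words in A.\<close>
      show "(\<Sum>w\<in>A. c w * ew w (Fm w')) = 0" for w'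
      proof (cases "w' \<in> A")
        case True
        then show ?thesis by (intro c) (auto simp: X_def intro: cvec.span_base)
      next
        case False
        show ?thesis
        proof (intro sum.neutral ballI)
          fix w assume "w \<in> A"
          then have "wt w \<noteq> wt w'" using length_eq_of_wt_eq[of w w'] False by (auto simp: A_def)
          then show "c w * ew w (Fm w') = 0" by (simp add: ew_Fm_eq_0)
        qed
      qed
    qed
  qed
  then obtain n :: nat and x y where xy: "\<And>i. i < n \<Longrightarrow> x i \<in> X" "\<And>i. i < n \<Longrightarrow> y i \<in> car T"
    and val: "\<And>w. w \<in> A \<Longrightarrow> (\<Sum>i<n. ew w (x i) *\<^sub>C y i) = Y w" by blast
  define s where "s = (\<Sum>i<n. x i \<otimes> y i)"
  have xM: "x i \<in> car M" if "i < n" for i using xy(1)[OF that] XM by auto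
  have s: "s \<in> car XT"
    unfolding s_def by (intro XT.sum_in) (use xM xy(2) in \<open>auto intro: tens_space_tcons\<close>)
  have tests: "test w s = Y w" for w
  proof -
    have "test w s = (\<Sum>i<n. ew w (x i) *\<^sub>C y i)"
      unfolding s_def using xM xy(2) by (subst test_sum) (auto simp: test_tcons intro: tens_space_tcons)
    also have "\<dots> = Y w"
    proof (cases "length w < N")
      case False
      then have "ew w (x i) = 0" if "i < n" for i using ewX[OF _ xy(1)[OF that]] by simp
      then show ?thesis using Y0[of w] False by simp
    qed (simp add: val A_def)
    finally show ?thesis .
  qed
  have "XT.E i s = 0" for i
  proof (rule test_separates)
    show "XT.E i s \<in> car XT" using s by (rule XT.act_in)
    have "Y (w @ [i]) = - T.K (- alpha i) (T.E i (Y w))" for w by (simp add: Y_def T.twisted_E_def)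
    then show "test w (XT.E i s) = 0" for w
      using T.K_minus(2)[of "T.E i (Y w)" "alpha i"] Yin T.act_scale[of "T.K (- alpha i) (T.E i (Y w))" "GK (alpha i)" "-1"]
      by (simp add: test_E[OF s] tests)
  qed
  moreover have "XT.K h s - qw D (\<mu> + \<nu>) h *\<^sub>C s = 0" for h
  proof (rule test_separates)
    show "XT.K h s - qw D (\<mu> + \<nu>) h *\<^sub>C s \<in> car XT"
      by (intro XT.diff_in XT.act_in XT.scale_in s)
    have "test w (XT.K h s - qw D (\<mu> + \<nu>) h *\<^sub>C s) = test w (XT.K h s) - qw D (\<mu> + \<nu>) h *\<^sub>C test w s" for w
      using s XT.act_in[OF s, of "GK h"] XT.scale_in[OF s, of "qw D (\<mu> + \<nu>) h"] by (simp add: test_diff test_scale)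
    also have "\<dots> w = 0" for w
      by (simp add: test_K[OF s] tests KY scaleC_scaleC qw_add_left qw_diff_left D)
    finally show "test w (XT.K h s - qw D (\<mu> + \<nu>) h *\<^sub>C s) = 0" for w .
  qed
  then have "XT.K h s = qw D (\<mu> + \<nu>) h *\<^sub>C s" for h by simp
  moreover have "lead s = t" by (simp add: tests Y_def)
  ultimately show ?thesis using s by blast
qed

end

section \<open>Weight spaces\<close>

lemma wspace_iff: "v \<in> wspace D X \<kappa> \<longleftrightarrow> v \<in> car X \<and> (\<forall>h. act X (GK h) v = qw D \<kappa> h *\<^sub>C v)"
  by (simp add: wspace_def qw_def)

text \<open>Such coordinates extend linearly a map that is prescribed on weight vectors only, as in
  \<open>fusion_map_Cons\<close>.\<close>

definition weight_coordinates :: "'i::finite qdatum \<Rightarrow> ('i, 'v::cvec) uqmod \<Rightarrow> 'v set \<Rightarrow> 'v set \<Rightarrow>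
    ('v \<Rightarrow> 'v \<Rightarrow> complex) \<Rightarrow> bool" where
  "weight_coordinates D X G B r \<longleftrightarrow> finite B \<and> B \<subseteq> G - {0} \<and> (\<forall>b. linear_on (car X) (r b)) \<and>
    (\<forall>x\<in>car X. (\<Sum>b\<in>B. r b x *\<^sub>C b) = x) \<and>
    (\<forall>\<kappa>. \<forall>x\<in>wspace D X \<kappa>. \<forall>b\<in>B. r b x \<noteq> 0 \<longrightarrow> b \<in> wspace D X \<kappa>)"

lemma weight_coordinatesD:
  assumes "weight_coordinates D X G B r"
  shows "finite B" "B \<subseteq> G - {0}" "linear_on (car X) (r b)" "x \<in> car X \<Longrightarrow> (\<Sum>b\<in>B. r b x *\<^sub>C b) = x"
    "x \<in> wspace D X \<kappa> \<Longrightarrow> b \<in> B \<Longrightarrow> r b x \<noteq> 0 \<Longrightarrow> b \<in> wspace D X \<kappa>"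
  using assms by (simp_all add: weight_coordinates_def)

context premodule
begin

lemma subspace_wspace: "cvec.subspace (wspace D X \<kappa>)"
  by (rule cvec.subspaceI)
    (auto simp: wspace_iff act_add act_scale scaleC_right_distrib scaleC_scaleC mult.commute)

lemma wspace_unique:
  assumes "v \<in> wspace D X \<kappa>" "v \<in> wspace D X \<kappa>'" "v \<noteq> 0"
  shows "\<kappa> = \<kappa>'"
proof (rule qw_eqD[OF D])
  fix h
  have "qw D \<kappa> h *\<^sub>C v = qw D \<kappa>' h *\<^sub>C v" using assms(1,2) by (auto simp: wspace_iff)
  then show "qw D \<kappa> h = qw D \<kappa>' h" using assms(3) by simp
qed

text \<open>For h separating \<pi> from \<rho>, the operator \<open>q^h - q^(\<rho>(h))\<close>
  removes the component at \<rho> and rescales the one at \<pi> by a nonzero number.\<close>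

lemma weight_vectors_independent:
  assumes "finite P" "\<And>\<pi>. \<pi> \<in> P \<Longrightarrow> z \<pi> \<in> wspace D X \<pi>" "(\<Sum>\<pi>\<in>P. z \<pi>) = 0"
  shows "\<forall>\<pi>\<in>P. z \<pi> = 0"
  using assms
proof (induction P arbitrary: z rule: finite_induct)
  case (insert \<rho> P)
  have in_X: "z \<pi> \<in> car X" if "\<pi> \<in> insert \<rho> P" for \<pi>
    using insert.prems(1)[OF that] by (simp add: wspace_iff)
  have zero: "z \<pi> = 0" if \<pi>: "\<pi> \<in> P" for \<pi>
  proof -
    have "\<pi> \<noteq> \<rho>" using \<pi> insert.hyps by auto
    then obtain h where h: "qw D \<pi> h \<noteq> qw D \<rho> h" using qw_eqD[OF D] by blast
    define y where "y \<pi> = (qw D \<pi> h - qw D \<rho> h) *\<^sub>C z \<pi>" for \<pi>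
    have Kz: "K h (z \<pi>) - qw D \<rho> h *\<^sub>C z \<pi> = y \<pi>" if "\<pi> \<in> insert \<rho> P" for \<pi>
      using insert.prems(1)[OF that] by (simp add: wspace_iff y_def cvec.scale_left_diff_distrib)
    have "(\<Sum>\<pi>\<in>insert \<rho> P. y \<pi>) = (\<Sum>\<pi>\<in>insert \<rho> P. K h (z \<pi>)) - qw D \<rho> h *\<^sub>C (\<Sum>\<pi>\<in>insert \<rho> P. z \<pi>)"
      unfolding cvec.scale_sum_right sum_subtractf[symmetric] by (intro sum.cong) (simp_all add: Kz)
    also have "(\<Sum>\<pi>\<in>insert \<rho> P. K h (z \<pi>)) = K h (\<Sum>\<pi>\<in>insert \<rho> P. z \<pi>)"
      by (rule act_sum[symmetric]) (rule in_X)
    finally have "(\<Sum>\<pi>\<in>insert \<rho> P. y \<pi>) = 0" using insert.prems(2) by simp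
    moreover have "y \<rho> = 0" by (simp add: y_def)
    ultimately have "(\<Sum>\<pi>\<in>P. y \<pi>) = 0" using insert.hyps by simp
    then have "\<forall>\<pi>\<in>P. y \<pi> = 0"
      using insert.prems(1) by (intro insert.IH) (auto simp: y_def cvec.subspace_scale[OF subspace_wspace])
    then show ?thesis using \<pi> h by (auto simp: y_def)
  qed
  then have "z \<rho> = 0" using insert.prems(2) insert.hyps by simp
  then show ?case using zero by simp
qed simp

lemma weight_decomposition:
  assumes G: "G \<subseteq> (\<Union>\<kappa>. wspace D X \<kappa>)" and y: "y \<in> cvec.span G"
  shows "\<exists>f. finite {\<kappa>. f \<kappa> \<noteq> 0} \<and> (\<forall>\<kappa>. f \<kappa> \<in> cvec.span (G \<inter> wspace D X \<kappa>)) \<and> y = (\<Sum>\<kappa> | f \<kappa> \<noteq> 0. f \<kappa>)"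
  using y
proof (induction rule: cvec_span_induct)
  case zero
  show ?case by (intro exI[of _ "\<lambda>_. 0"]) (auto simp: cvec.span_zero)
next
  case (add x y)
  then obtain f g where f: "finite {\<kappa>. f \<kappa> \<noteq> 0}" "\<And>\<kappa>. f \<kappa> \<in> cvec.span (G \<inter> wspace D X \<kappa>)" "x = (\<Sum>\<kappa> | f \<kappa> \<noteq> 0. f \<kappa>)"
    and g: "finite {\<kappa>. g \<kappa> \<noteq> 0}" "\<And>\<kappa>. g \<kappa> \<in> cvec.span (G \<inter> wspace D X \<kappa>)" "y = (\<Sum>\<kappa> | g \<kappa> \<noteq> 0. g \<kappa>)" by blast
  let ?S = "{\<kappa>. f \<kappa> \<noteq> 0} \<union> {\<kappa>. g \<kappa> \<noteq> 0}"
  have S: "finite ?S" using f(1) g(1) by simp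
  have sup: "{\<kappa>. f \<kappa> + g \<kappa> \<noteq> 0} \<subseteq> ?S" by auto
  have "x = (\<Sum>\<kappa>\<in>?S. f \<kappa>)" "y = (\<Sum>\<kappa>\<in>?S. g \<kappa>)"
    unfolding f(3) g(3) using S by (auto intro!: sum.mono_neutral_left)
  moreover have "(\<Sum>\<kappa> | f \<kappa> + g \<kappa> \<noteq> 0. f \<kappa> + g \<kappa>) = (\<Sum>\<kappa>\<in>?S. f \<kappa> + g \<kappa>)"
    using S by (intro sum.mono_neutral_left) auto
  ultimately have "x + y = (\<Sum>\<kappa> | f \<kappa> + g \<kappa> \<noteq> 0. f \<kappa> + g \<kappa>)" by (simp add: sum.distrib)
  then show ?case using f(2) g(2) finite_subset[OF sup S]
    by (intro exI[of _ "\<lambda>\<kappa>. f \<kappa> + g \<kappa>"]) (auto intro: cvec.span_add)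
next
  case (scale c x)
  then obtain f where f: "finite {\<kappa>. f \<kappa> \<noteq> 0}" "\<And>\<kappa>. f \<kappa> \<in> cvec.span (G \<inter> wspace D X \<kappa>)" "x = (\<Sum>\<kappa> | f \<kappa> \<noteq> 0. f \<kappa>)" by blast
  have "c *\<^sub>C x = (\<Sum>\<kappa> | f \<kappa> \<noteq> 0. c *\<^sub>C f \<kappa>)" by (simp add: f(3) cvec.scale_sum_right)
  also have "\<dots> = (\<Sum>\<kappa> | c *\<^sub>C f \<kappa> \<noteq> 0. c *\<^sub>C f \<kappa>)"
    using f(1) by (intro sum.mono_neutral_right) auto
  finally show ?case using f by (intro exI[of _ "\<lambda>\<kappa>. c *\<^sub>C f \<kappa>"])
    (auto intro: cvec.span_scale finite_subset[OF _ f(1)])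
next
  case (base x)
  then obtain \<kappa> where \<kappa>: "x \<in> wspace D X \<kappa>" using G by auto
  let ?f = "\<lambda>\<pi>. if \<pi> = \<kappa> then x else 0"
  have sup: "{\<pi>. ?f \<pi> \<noteq> 0} \<subseteq> {\<kappa>}" by auto
  have "(\<Sum>\<pi> | ?f \<pi> \<noteq> 0. ?f \<pi>) = (\<Sum>\<pi>\<in>{\<kappa>}. ?f \<pi>)"
    by (rule sum.mono_neutral_left) auto
  then have "x = (\<Sum>\<pi> | ?f \<pi> \<noteq> 0. ?f \<pi>)" by simp
  moreover have "finite {\<pi>. ?f \<pi> \<noteq> 0}" using finite_subset[OF sup] by simp
  moreover have "?f \<pi> \<in> cvec.span (G \<inter> wspace D X \<pi>)" for \<pi>
    using base \<kappa> by (auto intro: cvec.span_base cvec.span_zero)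
  ultimately show ?case by (intro exI[of _ ?f]) blast
qed

text \<open>A combination of weight vectors can be sorted by weight; if the total has weight
  \<kappa>, independence kills all other components.\<close>

lemma span_weight_part:
  assumes G: "G \<subseteq> (\<Union>\<kappa>. wspace D X \<kappa>)" and y: "y \<in> cvec.span G" "y \<in> wspace D X \<kappa>"
  shows "y \<in> cvec.span (G \<inter> wspace D X \<kappa>)"
proof -
  obtain f where f: "finite {\<pi>. f \<pi> \<noteq> 0}" "\<And>\<pi>. f \<pi> \<in> cvec.span (G \<inter> wspace D X \<pi>)" "y = (\<Sum>\<pi> | f \<pi> \<noteq> 0. f \<pi>)"
    using weight_decomposition[OF G y(1)] by blast
  have fw: "f \<pi> \<in> wspace D X \<pi>" for \<pi>
    using f(2)[of \<pi>] cvec.span_minimal[OF _ subspace_wspace, of "G \<inter> wspace D X \<pi>" \<pi>] by auto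
  let ?P = "insert \<kappa> {\<pi>. f \<pi> \<noteq> 0}"
  let ?z = "f(\<kappa> := f \<kappa> - y)"
  have "y = (\<Sum>\<pi>\<in>?P. f \<pi>)" unfolding f(3) using f(1) by (intro sum.mono_neutral_left) auto
  also have "\<dots> = f \<kappa> + (\<Sum>\<pi>\<in>?P - {\<kappa>}. f \<pi>)" using f(1) by (simp add: sum.remove[of ?P \<kappa>])
  also have "(\<Sum>\<pi>\<in>?P - {\<kappa>}. f \<pi>) = (\<Sum>\<pi>\<in>?P - {\<kappa>}. ?z \<pi>)" by (intro sum.cong) auto
  finally have "(\<Sum>\<pi>\<in>?P. ?z \<pi>) = 0" using f(1) by (simp add: sum.remove[of ?P \<kappa>] del: fun_upd_apply)
      (simp add: algebra_simps)
  then have "\<forall>\<pi>\<in>?P. ?z \<pi> = 0"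
    using f(1) fw y(2) by (intro weight_vectors_independent) (auto simp: cvec.subspace_diff[OF subspace_wspace])
  then have "y = f \<kappa>" by simp
  then show ?thesis using f(2) by simp
qed

lemma weight_basis:
  assumes G: "finite G" "G \<subseteq> (\<Union>\<kappa>. wspace D X \<kappa>)" "car X = cvec.span G"
  shows "\<exists>B r. weight_coordinates D X G B r"
proof -
  obtain B where B: "B \<subseteq> G" "cvec.independent B" "G \<subseteq> cvec.span B"
    using cvec.maximal_independent_subset[of G] by blast
  have span: "cvec.span B = car X"
    using B cvec.span_mono[of B G] cvec.span_minimal[of G "cvec.span B"] by (auto simp: G(3))
  have fin: "finite B" using B(1) G(1) finite_subset by blast
  define r where "r b x = cvec.representation B x b" for b x
  show ?thesis
    unfolding weight_coordinates_def
  proof (intro exI[of _ B] exI[of _ r] conjI allI ballI impI fin)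
    show "B \<subseteq> G - {0}" using B(1,2) cvec.dependent_zero by blast
    show "linear_on (car X) (r b)" for b
      unfolding linear_on_def r_def
      using span by (auto simp: cvec.representation_add[OF B(2)] cvec.representation_scale[OF B(2)] scaleC_complex)
    fix x assume x: "x \<in> car X"
    have "(\<Sum>b\<in>B. r b x *\<^sub>C b) = (\<Sum>b | cvec.representation B x b \<noteq> 0. cvec.representation B x b *\<^sub>C b)"
      unfolding r_def using fin by (intro sum.mono_neutral_right) (auto intro: cvec.representation_ne_zero)
    also have "\<dots> = x" by (rule cvec.sum_nonzero_representation_eq[OF B(2)]) (use x span in simp)
    finally show "(\<Sum>b\<in>B. r b x *\<^sub>C b) = x" .
  next
    fix \<kappa> x b assume x: "x \<in> wspace D X \<kappa>" and b: "r b x \<noteq> 0"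
    have "x \<in> cvec.span (B \<inter> wspace D X \<kappa>)"
      using x B(1) G(2) span by (intro span_weight_part) (auto simp: wspace_iff)
    then have "cvec.representation B x = cvec.representation (B \<inter> wspace D X \<kappa>) x"
      by (intro cvec.representation_extend B(2)) auto
    then show "b \<in> wspace D X \<kappa>" using b cvec.representation_ne_zero[of "B \<inter> wspace D X \<kappa>" x b] by (auto simp: r_def)
  qed
qed

lemma finite_weights:
  assumes G: "finite G" "G \<subseteq> (\<Union>\<kappa>. wspace D X \<kappa>)" "car X = cvec.span G"
  shows "finite {\<kappa>. wspace D X \<kappa> \<noteq> {0}}"
proof -
  define \<omega> where "\<omega> g = (SOME \<kappa>. g \<in> wspace D X \<kappa>)" for g
  have "{\<kappa>. wspace D X \<kappa> \<noteq> {0}} \<subseteq> \<omega> ` G"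
  proof
    fix \<kappa> assume "\<kappa> \<in> {\<kappa>. wspace D X \<kappa> \<noteq> {0}}"
    then obtain x where x: "x \<in> wspace D X \<kappa>" "x \<noteq> 0"
      using cvec.subspace_0[OF subspace_wspace] by blast
    then have "x \<in> cvec.span (G \<inter> wspace D X \<kappa>)"
      using G by (intro span_weight_part) (auto simp: wspace_iff)
    then have "\<not> G \<inter> wspace D X \<kappa> \<subseteq> {0}"
      using x(2) cvec.span_minimal[OF _ cvec.subspace_single_0, of "G \<inter> wspace D X \<kappa>"] by blast
    then obtain g where g: "g \<in> G" "g \<in> wspace D X \<kappa>" "g \<noteq> 0" by auto
    have "g \<in> wspace D X (\<omega> g)" unfolding \<omega>_def by (rule someI) (rule g(2))
    then have "\<kappa> = \<omega> g" using wspace_unique g by blast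
    then show "\<kappa> \<in> \<omega> ` G" using g(1) by blast
  qed
  then show ?thesis using G(1) finite_subset by blast
qed

lemma E_word_weight: "v \<in> wspace D X \<kappa> \<Longrightarrow> foldr E w v \<in> wspace D X (\<kappa> + wt w)"
  using K_E_word[of v _ w]
  by (auto simp: wspace_iff linear_on_scale[OF linear_word] scaleC_scaleC qw_add_left D mult.commute word_map_in)

lemma E_word_nilpotent:
  assumes G: "finite G" "G \<subseteq> (\<Union>\<kappa>. wspace D X \<kappa>)" "car X = cvec.span G" and v: "v \<in> wspace D X \<kappa>"
  shows "\<exists>N. \<forall>w. length w \<ge> N \<longrightarrow> foldr E w v = 0"
proof -
  \<comment> \<open>The sum of the coordinates with respect to the simple roots. Each letter of w
    raises it by 1, while only finitely many weights occur.\<close>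
  define \<rho> where "\<rho> \<pi> = (\<Sum>i\<in>UNIV. \<pi> $ i)" for \<pi> :: "'i weight"
  let ?P = "{\<kappa>. wspace D X \<kappa> \<noteq> {0}}"
  have "finite ((\<lambda>n. \<rho> \<kappa> + of_nat n) -` (\<rho> ` ?P))"
    using finite_weights[OF G] by (intro finite_vimageI) (auto simp: inj_def)
  then obtain N where N: "\<And>n. \<rho> \<kappa> + of_nat n \<in> \<rho> ` ?P \<Longrightarrow> n < N"
    using finite_nat_set_iff_bounded by (metis vimageI2)
  have "foldr E w v = 0" if "length w \<ge> N" for w
  proof (rule ccontr)
    assume "foldr E w v \<noteq> 0"
    then have "\<kappa> + wt w \<in> ?P" using E_word_weight[OF v, of w] by auto
    moreover have "\<rho> (\<kappa> + wt w) = \<rho> \<kappa> + of_nat (length w)"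
      by (simp add: \<rho>_def sum.distrib wt_coordinate_sum)
    ultimately have "length w < N" by (intro N) (metis imageI)
    then show False using that by simp
  qed
  then show ?thesis by blast
qed

end

section \<open>The weight lattice, tuples of weight vectors, and finite spanning sets of tensor
  products\<close>

lemma weight_lattice_add: "\<mu> \<in> weight_lattice D \<Longrightarrow> \<nu> \<in> weight_lattice D \<Longrightarrow> \<mu> + \<nu> \<in> weight_lattice D"
  by (auto simp: weight_lattice_def coroot_pairing_def bil_add_left distrib_left add_divide_distrib intro: Ints_add)

lemma weight_lattice_uminus: "\<mu> \<in> weight_lattice D \<Longrightarrow> - \<mu> \<in> weight_lattice D"
  by (auto simp: weight_lattice_def coroot_pairing_def bil_minus_left)

lemma weight_lattice_0: "0 \<in> weight_lattice D"
  by (simp add: weight_lattice_def coroot_pairing_def bil_zero_left)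

lemma weight_lattice_sum_list: "set \<nu>s \<subseteq> weight_lattice D \<Longrightarrow> sum_list \<nu>s \<in> weight_lattice D"
  by (induction \<nu>s) (auto intro: weight_lattice_add weight_lattice_0)

lemma weight_vectors_Nil [simp]: "weight_vectors D [] \<nu>s vs \<longleftrightarrow> \<nu>s = [] \<and> vs = []"
  by (auto simp: weight_vectors_def)

lemma weight_vectors_Cons: "weight_vectors D (V # Vs) \<nu>s vs \<longleftrightarrow>
  (\<exists>\<nu> \<nu>s' v vs'. \<nu>s = \<nu> # \<nu>s' \<and> vs = v # vs' \<and> \<nu> \<in> weight_lattice D \<and> v \<in> wspace D V \<nu> \<and> weight_vectors D Vs \<nu>s' vs')"
  by (cases \<nu>s; cases vs) (auto simp: weight_vectors_def All_less_Suc2)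

lemma weight_vectors_lattice: "weight_vectors D Vs \<nu>s vs \<Longrightarrow> sum_list \<nu>s \<in> weight_lattice D"
  by (rule weight_lattice_sum_list) (auto simp: weight_vectors_def in_set_conv_nth)

lemma pure_tensor_simps [simp]: "pure_tensor [] = tunit" "pure_tensor (v # vs) = v \<otimes> pure_tensor vs"
  by (simp_all add: pure_tensor_def)

lemma tensor_simps [simp]: "tensor [] = unit_mod" "tensor (V # Vs) = tens_mod V (tensor Vs)"
  by (simp_all add: tensor_def)

lemma unit_mod_simps [simp]: "car unit_mod = cvec.span {tunit}"
  "act unit_mod (GE i) x = 0" "act unit_mod (GF i) x = 0" "act unit_mod (GK h) x = x"
  by (simp_all add: unit_mod_def)

lemma premodule_unit: "qdatum D \<Longrightarrow> premodule D (unit_mod :: ('i::finite, 'v::cvec) tens_uqmod)"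
proof
  fix g :: "'i gen"
  show "linear_on (car unit_mod) (act (unit_mod :: ('i, 'v) tens_uqmod) g)"
    by (cases g) (simp_all add: linear_on_def)
  show "act unit_mod g ` car unit_mod \<subseteq> car (unit_mod :: ('i, 'v) tens_uqmod)"
    by (cases g) (auto simp: cvec.span_zero)
qed (simp_all)

lemma M_fd_uq_module: "V \<in> M_fd D \<Longrightarrow> uq_module D V"
  by (simp add: M_fd_def)

lemma M_fd_spanning:
  assumes "V \<in> M_fd D"
  shows "\<exists>G. finite G \<and> G \<subseteq> (\<Union>\<mu>\<in>weight_lattice D. wspace D V \<mu>) \<and> car V = cvec.span G"
proof -
  let ?W = "\<Union>\<mu>\<in>weight_lattice D. wspace D V \<mu>"
  obtain B where B: "finite B" "car V = cvec.span B" "car V = cvec.span ?W"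
    using assms by (auto simp: M_fd_def)
  have "\<exists>S. finite S \<and> S \<subseteq> ?W \<and> b \<in> cvec.span S" if "b \<in> B" for b
  proof -
    have "b \<in> cvec.span ?W" using B cvec.span_base[OF that] by auto
    then obtain S c where S: "finite S" "S \<subseteq> ?W" "b = (\<Sum>a\<in>S. c a *\<^sub>C a)"
      unfolding cvec.span_explicit by blast
    have "b \<in> cvec.span S" unfolding S(3) by (intro cvec.span_sum cvec.span_scale cvec.span_base)
    then show ?thesis using S by blast
  qed
  then obtain S where S: "\<And>b. b \<in> B \<Longrightarrow> finite (S b) \<and> S b \<subseteq> ?W \<and> b \<in> cvec.span (S b)" by metis
  let ?G = "\<Union>b\<in>B. S b"
  have "B \<subseteq> cvec.span ?G" using S cvec.span_mono[of "S _" ?G] by blast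
  then have "car V \<subseteq> cvec.span ?G" using B(2) cvec.span_minimal[of B "cvec.span ?G"] by auto
  moreover have "cvec.span ?G \<subseteq> car V" unfolding B(3) by (intro cvec.span_mono) (use S in blast)
  ultimately show ?thesis using S B(1) by (intro exI[of _ ?G]) blast
qed

context
  fixes D :: "'i::finite qdatum"
  assumes D: "qdatum D"
begin

lemma premodule_tensor:
  "(\<And>V. V \<in> set Vs \<Longrightarrow> premodule D V) \<Longrightarrow> premodule D (tensor (Vs :: ('i, 'v::cvec) uqmod list))"
proof (induction Vs)
  case Nil
  show ?case using premodule_unit[OF D] by simp
next
  case (Cons V Vs)
  interpret premodule_pair D V "tensor Vs"
    using Cons by (intro premodule_pair.intro) auto
  show ?case using premodule_tens by simp
qed

lemma pure_tensor_weight: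
  assumes "\<And>V. V \<in> set Vs \<Longrightarrow> premodule D V" "weight_vectors D (Vs :: ('i, 'v::cvec) uqmod list) \<nu>s vs"
  shows "pure_tensor vs \<in> wspace D (tensor Vs) (sum_list \<nu>s)"
  using assms
proof (induction Vs arbitrary: \<nu>s vs)
  case Nil
  then show ?case by (simp add: wspace_iff D cvec.span_base scaleC_one)
next
  case (Cons V Vs)
  interpret premodule_pair D V "tensor Vs"
    using Cons.prems(1) premodule_tensor[of Vs] by (intro premodule_pair.intro) auto
  obtain \<nu> \<nu>s' v vs' where eq: "\<nu>s = \<nu> # \<nu>s'" "vs = v # vs'" and v: "v \<in> wspace D V \<nu>"
    and vs': "weight_vectors D Vs \<nu>s' vs'" using Cons.prems(2) by (auto simp: weight_vectors_Cons)
  have "pure_tensor vs' \<in> wspace D (tensor Vs) (sum_list \<nu>s')"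
    using Cons.prems(1) by (intro Cons.IH vs') auto
  then show ?case using v by (simp add: eq wspace_iff tens_space_tcons act_tens tcons_scale_left tcons_scale_right
    scaleC_scaleC qw_add_left D)
qed

lemma tens_space_span: "tens_space (cvec.span G) (cvec.span H) = cvec.span {g \<otimes> h |g h. g \<in> G \<and> h \<in> H}"
proof
  let ?S = "{g \<otimes> h |g h. g \<in> G \<and> h \<in> H}"
  have "x \<otimes> y \<in> cvec.span ?S" if x: "x \<in> cvec.span G" and y: "y \<in> cvec.span H" for x y
    using x
  proof (induction rule: cvec_span_induct)
    case (base x)
    from y show ?case
      by (induction rule: cvec_span_induct)
        (use base in \<open>auto simp: cvec.span_zero tcons_add_right tcons_scale_right intro: cvec.span_add cvec.span_scale cvec.span_base\<close>)
  qed (auto simp: cvec.span_zero tcons_add_left tcons_scale_left intro: cvec.span_add cvec.span_scale)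
  then show "tens_space (cvec.span G) (cvec.span H) \<subseteq> cvec.span ?S"
    unfolding tens_space_def by (intro cvec.span_minimal) auto
  show "cvec.span ?S \<subseteq> tens_space (cvec.span G) (cvec.span H)"
    unfolding tens_space_def by (intro cvec.span_mono) (auto intro: cvec.span_base)
qed

lemma tensor_spanning:
  assumes "set Vs \<subseteq> M_fd D"
  shows "\<exists>G. finite G \<and> G \<subseteq> {pure_tensor vs |\<nu>s vs. weight_vectors D Vs \<nu>s vs} \<and> car (tensor Vs) = cvec.span G"
  using assms
proof (induction Vs)
  case Nil
  show ?case by (intro exI[of _ "{tunit}"]) auto
next
  case (Cons V Vs)
  obtain G where G: "finite G" "G \<subseteq> (\<Union>\<mu>\<in>weight_lattice D. wspace D V \<mu>)" "car V = cvec.span G"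
    using M_fd_spanning[of V D] Cons.prems by auto
  obtain H where H: "finite H" "H \<subseteq> {pure_tensor vs |\<nu>s vs. weight_vectors D Vs \<nu>s vs}" "car (tensor Vs) = cvec.span H"
    using Cons by auto
  let ?S = "{g \<otimes> h |g h. g \<in> G \<and> h \<in> H}"
  have "?S = (\<lambda>(g, h). g \<otimes> h) ` (G \<times> H)" by auto
  then have "finite ?S" using G(1) H(1) by simp
  moreover have "?S \<subseteq> {pure_tensor vs |\<nu>s vs. weight_vectors D (V # Vs) \<nu>s vs}"
  proof
    fix x assume "x \<in> ?S"
    then obtain g h where gh: "x = g \<otimes> h" "g \<in> G" "h \<in> H" by auto
    then obtain \<mu> \<nu>s vs where "\<mu> \<in> weight_lattice D" "g \<in> wspace D V \<mu>" "h = pure_tensor vs" "weight_vectors D Vs \<nu>s vs"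
      using G(2) H(2) by blast
    then have "x = pure_tensor (g # vs)" "weight_vectors D (V # Vs) (\<mu> # \<nu>s) (g # vs)"
      by (auto simp: gh weight_vectors_Cons)
    then show "x \<in> {pure_tensor vs |\<nu>s vs. weight_vectors D (V # Vs) \<nu>s vs}" by blast
  qed
  moreover have "car (tensor (V # Vs)) = cvec.span ?S"
    by (simp add: tens_mod_def G(3) H(3) tens_space_span)
  ultimately show ?case by blast
qed

end

section \<open>Homomorphisms into tensor products\<close>

lemma uq_linear_act: "uq_linear V W f \<Longrightarrow> v \<in> car V \<Longrightarrow> f (act V g v) = act W g (f v)"
  and uq_linear_linear: "uq_linear V W f \<Longrightarrow> linear_on (car V) f"
  and uq_linear_in: "uq_linear V W f \<Longrightarrow> v \<in> car V \<Longrightarrow> f v \<in> car W"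
  by (auto simp: uq_linear_def)

lemma uq_linear_compose:
  "uq_linear V W f \<Longrightarrow> uq_linear W X g \<Longrightarrow> uq_linear V X (\<lambda>x. g (f x))"
  by (auto simp: uq_linear_def image_subset_iff intro: linear_on_compose)

lemma uq_linear_sum:
  assumes "premodule D V" "premodule D W" "\<And>a. a \<in> A \<Longrightarrow> uq_linear V W (f a)"
  shows "uq_linear V W (\<lambda>x. \<Sum>a\<in>A. c a *\<^sub>C f a x)"
proof -
  interpret V: premodule D V by (rule assms(1))
  interpret W: premodule D W by (rule assms(2))
  show ?thesis
    unfolding uq_linear_def
  proof (intro conjI allI ballI)
    show "(\<lambda>x. \<Sum>a\<in>A. c a *\<^sub>C f a x) ` car V \<subseteq> car W"
      using uq_linear_in[OF assms(3)] by (auto intro!: W.sum_in)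
    show "linear_on (car V) (\<lambda>x. \<Sum>a\<in>A. c a *\<^sub>C f a x)"
      by (intro linear_on_setsum linear_on_cmult uq_linear_linear[OF assms(3)])
    fix g v assume v: "v \<in> car V"
    show "(\<Sum>a\<in>A. c a *\<^sub>C f a (act V g v)) = act W g (\<Sum>a\<in>A. c a *\<^sub>C f a v)"
      using v uq_linear_in[OF assms(3)] uq_linear_act[OF assms(3)]
      by (subst W.act_sum) (auto simp: W.act_scale)
  qed
qed

lemma uq_linear_alg:
  assumes "premodule D V" "premodule D W" and f: "uq_linear V W f" and v: "v \<in> car V"
  shows "f (act_alg V x v) = act_alg W x (f v)"
proof -
  interpret V: premodule D V by (rule assms(1))
  interpret W: premodule D W by (rule assms(2))
  note lin = uq_linear_linear[OF f]
  show ?thesis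
  proof (induction x rule: free_alg_induct)
    case zero
    then show ?case using linear_on_zero[OF lin V.subspace_car] by simp
  next
    case (single w c)
    have "f (foldr (act V) w v) = foldr (act W) w (f v)"
      by (induction w) (use v in \<open>simp_all add: uq_linear_act[OF f]\<close>)
    then show ?case using v by (simp add: act_alg_single linear_on_scale[OF lin])
  next
    case (add x y)
    then show ?case using v by (simp add: act_alg_add linear_on_add[OF lin])
  qed
qed

lemma uq_linear_word:
  assumes "premodule D V" and f: "uq_linear V W f" and v: "v \<in> car V"
  shows "f (foldr (\<lambda>i. act V (g i)) w v) = foldr (\<lambda>i. act W (g i)) w (f v)"
proof -
  interpret V: premodule D V by (rule assms(1))
  show ?thesis using v by (induction w) (simp_all add: uq_linear_act[OF f] V.word_map_in)
qed

lemma (in irreducible_verma_tensor) homomorphism_unique: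
  assumes "verma D lam M' m'" and f: "uq_linear M' XT f" and g: "uq_linear M' XT g"
    and lead: "lead (f m') = lead (g m')" and y: "y \<in> car M'"
  shows "f y = g y"
proof -
  interpret M': verma D lam M' m' by (rule assms(1))
  have in_XT: "f m' \<in> car XT" "g m' \<in> car XT"
    using uq_linear_in[OF f M'.m_in] uq_linear_in[OF g M'.m_in] by blast+
  have "f m' - g m' = 0"
  proof (rule singular_unique)
    show "f m' - g m' \<in> car XT" using in_XT by (rule XT.diff_in)
    have "XT.E i (f m') = 0" "XT.E i (g m') = 0" for i
      using uq_linear_act[OF f M'.m_in, of "GE i"] uq_linear_act[OF g M'.m_in, of "GE i"]
        linear_on_zero[OF uq_linear_linear[OF f] M'.subspace_car] linear_on_zero[OF uq_linear_linear[OF g] M'.subspace_car]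
      by simp_all
    then show "XT.E i (f m' - g m') = 0" for i using XT.act_diff[OF in_XT] by simp
    show "lead (f m' - g m') = 0" using in_XT lead by (simp add: test_diff)
  qed
  then have "f m' = g m'" by simp
  moreover obtain x where "y = act_alg M' x m'" using y M'.car_eq by auto
  ultimately show ?thesis
    using uq_linear_alg[OF M'.premodule_axioms XT.premodule_axioms f M'.m_in]
      uq_linear_alg[OF M'.premodule_axioms XT.premodule_axioms g M'.m_in] by simp
qed

text \<open>The onefold tensor product of \<open>V\<close> is \<open>V \<otimes> \<complex>\<close>, identified with \<open>V\<close> by \<open>v \<mapsto> v \<otimes> 1\<close>.\<close>

locale onefold = V: premodule D V for D :: "'i::finite qdatum" and V :: "('i, 'v::cvec) uqmod"
begin

interpretation U: premodule D "unit_mod :: ('i, 'v) tens_uqmod"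
  by (rule premodule_unit[OF V.D])

sublocale VU: premodule_pair D V "unit_mod :: ('i, 'v) tens_uqmod" ..

lemma act_onefold: "v \<in> car V \<Longrightarrow> act (tens_mod V unit_mod) g (v \<otimes> tunit) = act V g v \<otimes> tunit"
  by (cases g) (auto simp: VU.act_tens cvec.span_base)

lemma onefold_in: "v \<in> car V \<Longrightarrow> v \<otimes> tunit \<in> car (tens_mod V unit_mod)"
  by (auto intro: tens_space_tcons cvec.span_base)

lemma onefold_cases: "y \<in> car (tens_mod V unit_mod) \<Longrightarrow> \<exists>v\<in>car V. y = v \<otimes> tunit"
proof -
  assume "y \<in> car (tens_mod V unit_mod)"
  then have "y \<in> tens_space (car V) (cvec.span {tunit})" by simp
  then show ?thesis
  proof (induction rule: tens_space_induct)
    case subspace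
    show ?case
    proof (rule cvec.subspaceI)
      show "0 \<in> {t. \<exists>v\<in>car V. t = v \<otimes> tunit}" by (auto intro!: bexI[of _ 0])
      show "x + y \<in> {t. \<exists>v\<in>car V. t = v \<otimes> tunit}" if "x \<in> {t. \<exists>v\<in>car V. t = v \<otimes> tunit}"
        "y \<in> {t. \<exists>v\<in>car V. t = v \<otimes> tunit}" for x y
        using that by (auto simp: tcons_add_left[symmetric])
      show "c *\<^sub>C x \<in> {t. \<exists>v\<in>car V. t = v \<otimes> tunit}" if "x \<in> {t. \<exists>v\<in>car V. t = v \<otimes> tunit}" for c x
        using that by (auto simp: tcons_scale_left[symmetric])
    qed
  next
    case (tcons x y)
    then obtain c where "y = c *\<^sub>C tunit" by (auto simp: cvec.span_singleton)
    then have "x \<otimes> y = (c *\<^sub>C x) \<otimes> tunit" by (simp add: tcons_scale_left tcons_scale_right)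
    then show ?case using tcons by blast
  qed
qed

lemma act_word_onefold:
  "v \<in> car V \<Longrightarrow> foldr (\<lambda>i. act (tens_mod V unit_mod) (g i)) w (v \<otimes> tunit) = foldr (\<lambda>i. act V (g i)) w v \<otimes> tunit"
  by (induction w) (simp_all add: act_onefold V.word_map_in)

lemma tcons_sum_left: "(\<Sum>a\<in>A. f a) \<otimes> t = (\<Sum>a\<in>A. f a \<otimes> t)"
  by (induction A rule: infinite_finite_induct) (simp_all add: tcons_add_left)

lemma serre_onefold:
  assumes "v \<in> car V"
  shows "serre_op D (\<lambda>i. act (tens_mod V unit_mod) (g i)) i j (v \<otimes> tunit) = serre_op D (\<lambda>i. act V (g i)) i j v \<otimes> tunit"
proof -
  have pow: "(act (tens_mod V unit_mod) a ^^ n) (u \<otimes> tunit) = (act V a ^^ n) u \<otimes> tunit" if "u \<in> car V" for a n u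
    using that by (induction n) (simp_all add: act_onefold)
  show ?thesis using assms
    by (simp add: serre_op_def Let_def pow act_onefold tcons_sum_left tcons_scale_left)
qed

lemma onefold_weight: "v \<in> wspace D V \<nu> \<Longrightarrow> v \<otimes> tunit \<in> wspace D (tens_mod V unit_mod) \<nu>"
  using onefold_in by (auto simp: wspace_iff act_onefold tcons_scale_left simp del: VU.car_tens)

end

section \<open>Appending tensor factors\<close>

lemma tapp_add_left: "tapp k (x + y) t = tapp k x t + tapp k y t"
  and tapp_scale_left: "tapp k (c *\<^sub>C x) t = c *\<^sub>C tapp k x t"
  and tapp_add_right: "tapp k x (s + t) = tapp k x s + tapp k x t"
  and tapp_scale_right: "tapp k x (c *\<^sub>C t) = c *\<^sub>C tapp k x t"
  by (simp_all add: fun_eq_iff tapp_def plus_fun_apply scaleC_fun_apply scaleC_complex algebra_simps)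

lemma tapp_1: "tapp 1 (b \<otimes> tunit) t = b \<otimes> t"
  by (rule ext) (auto simp: tapp_def tcons_def tunit_def split: list.splits)

lemma tapp_2: "tapp 2 (a \<otimes> (b \<otimes> tunit)) t = a \<otimes> (b \<otimes> t)"
proof (rule ext)
  fix fs
  show "tapp 2 (a \<otimes> (b \<otimes> tunit)) t fs = (a \<otimes> (b \<otimes> t)) fs"
  proof (cases fs)
    case (Cons f gs)
    then show ?thesis by (cases gs) (auto simp: tapp_def tcons_def tunit_def)
  qed (simp add: tapp_def tcons_def)
qed

text \<open>The map \<open>f \<otimes> id: M\<^sub>1 \<otimes> X \<rightarrow> M\<^sub>0 \<otimes> V \<otimes> X\<close> for a homomorphism \<open>f: M\<^sub>1 \<rightarrow> M\<^sub>0 \<otimes> V\<close>.\<close>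

locale vertex_step = M1: premodule D M1 + M0: premodule D M0 + onefold D V + X: premodule D X
  for D :: "'i::finite qdatum" and M1 M0 V :: "('i, 'v::cvec) uqmod" and X :: "('i, 'v) tens_uqmod"
begin

sublocale M0V: premodule_pair D M0 "tens_mod V unit_mod"
  by (intro premodule_pair.intro M0.premodule_axioms VU.premodule_tens)

sublocale VX: premodule_pair D V X ..

sublocale M0VX: premodule_pair D M0 "tens_mod V X"
  by (intro premodule_pair.intro M0.premodule_axioms VX.premodule_tens)

sublocale M1X: premodule_pair D M1 X ..

lemma M0V_eqI:
  assumes "z \<in> car (tens_mod M0 (tens_mod V unit_mod))"
    and "linear_on (car (tens_mod M0 (tens_mod V unit_mod))) f" "linear_on (car (tens_mod M0 (tens_mod V unit_mod))) g"
    and "\<And>a b. a \<in> car M0 \<Longrightarrow> b \<in> car V \<Longrightarrow> f (a \<otimes> (b \<otimes> tunit)) = g (a \<otimes> (b \<otimes> tunit))"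
  shows "f z = g z"
proof (rule linear_on_tens_space_eqI[where f = f and g = g])
  show "z \<in> tens_space (car M0) (car (tens_mod V unit_mod))" using assms(1) by (simp only: M0V.car_tens)
  show "linear_on (tens_space (car M0) (car (tens_mod V unit_mod))) f"
    "linear_on (tens_space (car M0) (car (tens_mod V unit_mod))) g" using assms(2,3) by (simp_all only: M0V.car_tens)
  fix a y assume "a \<in> car M0" "y \<in> car (tens_mod V unit_mod)"
  then show "f (a \<otimes> y) = g (a \<otimes> y)" using onefold_cases[of y] assms(4) by blast
qed

lemma tapp_in:
  assumes z: "z \<in> car (tens_mod M0 (tens_mod V unit_mod))" and t: "t \<in> car X"
  shows "tapp 2 z t \<in> car (tens_mod M0 (tens_mod V X))"
proof -
  have "z \<in> tens_space (car M0) (car (tens_mod V unit_mod))" using z by (simp only: M0V.car_tens)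
  then show ?thesis
  proof (induction rule: tens_space_induct)
    case subspace
    have "tapp 2 0 t = 0" by (simp add: tapp_def fun_eq_iff zero_fun_apply)
    then show ?case
      by (intro cvec.subspaceI) (auto simp: tapp_add_left tapp_scale_left simp del: M0VX.car_tens)
  next
    case (tcons a y)
    then obtain b where "b \<in> car V" "y = b \<otimes> tunit" using onefold_cases by blast
    then show ?case using tcons t by (simp add: tapp_2 tens_space_tcons)
  qed
qed

lemma linear_tapp_left: "linear_on S (\<lambda>z. tapp k z t)"
  by (simp add: linear_on_def tapp_add_left tapp_scale_left)

lemma linear_tapp_right: "linear_on S (tapp k z)"
  by (simp add: linear_on_def tapp_add_right tapp_scale_right)

lemma linear_tapp_compose: "linear_on S f \<Longrightarrow> linear_on S (\<lambda>z. tapp k (f z) t)"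
  by (rule linear_on_compose[OF _ subset_UNIV linear_tapp_left])

text \<open>Coassociativity: the left sides act on \<open>M0 \<otimes> (V \<otimes> X)\<close> and
  the right sides on \<open>(M0 \<otimes> V) \<otimes> X\<close>, which the list encoding
  identifies.\<close>

lemma act_tapp:
  assumes z: "z \<in> car (tens_mod M0 (tens_mod V unit_mod))" and t: "t \<in> car X"
  shows "act (tens_mod M0 (tens_mod V X)) (GE i) (tapp 2 z t) =
      tapp 2 (act (tens_mod M0 (tens_mod V unit_mod)) (GE i) z) (act X (GK (alpha i)) t) + tapp 2 z (act X (GE i) t)"
    and "act (tens_mod M0 (tens_mod V X)) (GF i) (tapp 2 z t) =
      tapp 2 (act (tens_mod M0 (tens_mod V unit_mod)) (GF i) z) t + tapp 2 (act (tens_mod M0 (tens_mod V unit_mod)) (GK (- alpha i)) z) (act X (GF i) t)"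
    and "act (tens_mod M0 (tens_mod V X)) (GK h) (tapp 2 z t) =
      tapp 2 (act (tens_mod M0 (tens_mod V unit_mod)) (GK h) z) (act X (GK h) t)"
proof -
  have lin: "linear_on (car (tens_mod M0 (tens_mod V unit_mod))) (\<lambda>z. act (tens_mod M0 (tens_mod V X)) g (tapp 2 z t))" for g
    by (rule linear_on_compose[OF linear_tapp_left _ M0VX.linear_act_tens]) (use tapp_in t in blast)
  note lins = lin linear_on_plus linear_tapp_compose linear_tapp_left M0V.linear_act_tens
  have unit: "tunit \<in> car (unit_mod :: ('i, 'v) tens_uqmod)" by (simp add: cvec.span_base)
  note simps = tapp_2 M0VX.act_tens VX.act_tens M0V.act_tens VU.act_tens tens_space_tcons tcons_add_right
    tapp_add_left tapp_add_right act_onefold onefold_in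
  show "act (tens_mod M0 (tens_mod V X)) (GE i) (tapp 2 z t) =
      tapp 2 (act (tens_mod M0 (tens_mod V unit_mod)) (GE i) z) (act X (GK (alpha i)) t) + tapp 2 z (act X (GE i) t)"
    by (rule M0V_eqI[OF z]) ((intro lins)+, use t unit in \<open>simp add: simps\<close>)
  show "act (tens_mod M0 (tens_mod V X)) (GF i) (tapp 2 z t) =
      tapp 2 (act (tens_mod M0 (tens_mod V unit_mod)) (GF i) z) t + tapp 2 (act (tens_mod M0 (tens_mod V unit_mod)) (GK (- alpha i)) z) (act X (GF i) t)"
    by (rule M0V_eqI[OF z]) ((intro lins)+, use t unit in \<open>simp add: simps\<close>)
  show "act (tens_mod M0 (tens_mod V X)) (GK h) (tapp 2 z t) =
      tapp 2 (act (tens_mod M0 (tens_mod V unit_mod)) (GK h) z) (act X (GK h) t)"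
    by (rule M0V_eqI[OF z]) ((intro lins)+, use t unit in \<open>simp add: simps\<close>)
qed

context
  fixes f :: "'v \<Rightarrow> 'v tens"
  assumes f: "uq_linear M1 (tens_mod M0 (tens_mod V unit_mod)) f"
begin

lemma bilinear_tens_id: "bilinear_on (car M1) (car X) (\<lambda>x t. tapp 2 (f x) t)"
  by (auto simp: bilinear_on_def intro: linear_tapp_right linear_tapp_compose uq_linear_linear[OF f])

lemma tens_id_tcons: "x \<in> car M1 \<Longrightarrow> t \<in> car X \<Longrightarrow> tens_id M1 X f (x \<otimes> t) = tapp 2 (f x) t"
  by (simp add: tens_id_def tens_lift_tcons[OF M1.subspace_car X.subspace_car bilinear_tens_id])

lemma linear_tens_id: "linear_on (car (tens_mod M1 X)) (tens_id M1 X f)"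
  by (simp add: tens_id_def linear_on_tens_lift[OF M1.subspace_car X.subspace_car bilinear_tens_id])

lemma tens_id_subset: "tens_id M1 X f ` car (tens_mod M1 X) \<subseteq> car (tens_mod M0 (tens_mod V X))"
proof -
  let ?S = "{x \<otimes> t |x t. x \<in> car M1 \<and> t \<in> car X}"
  have "tens_id M1 X f ` cvec.span ?S \<subseteq> car (tens_mod M0 (tens_mod V X))"
  proof (rule linear_on_span_image)
    show "linear_on (cvec.span ?S) (tens_id M1 X f)"
      using linear_tens_id by (simp add: tens_space_def)
    show "tens_id M1 X f ` ?S \<subseteq> car (tens_mod M0 (tens_mod V X))"
      using tapp_in[OF uq_linear_in[OF f]] by (auto simp: tens_id_tcons simp del: M0VX.car_tens)
    show "cvec.subspace (car (tens_mod M0 (tens_mod V X)))" by (rule M0VX.XT.subspace_car)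
  qed
  then show ?thesis by (simp add: tens_space_def)
qed

lemma uq_linear_tens_id: "uq_linear (tens_mod M1 X) (tens_mod M0 (tens_mod V X)) (tens_id M1 X f)"
  unfolding uq_linear_def
proof (intro conjI allI ballI)
  fix g y assume "y \<in> car (tens_mod M1 X)"
  then have y: "y \<in> tens_space (car M1) (car X)" by simp
  show "tens_id M1 X f (act (tens_mod M1 X) g y) = act (tens_mod M0 (tens_mod V X)) g (tens_id M1 X f y)"
  proof (rule linear_on_tens_space_eqI[OF _ _ _ y])
    show "linear_on (tens_space (car M1) (car X)) (\<lambda>y. tens_id M1 X f (act (tens_mod M1 X) g y))"
      using linear_on_compose[OF M1X.linear_act_tens M1X.act_tens_subset linear_tens_id] by simp
    show "linear_on (tens_space (car M1) (car X)) (\<lambda>y. act (tens_mod M0 (tens_mod V X)) g (tens_id M1 X f y))"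
      using linear_on_compose[OF linear_tens_id tens_id_subset M0VX.linear_act_tens] by simp
    fix x t assume xt: "x \<in> car M1" "t \<in> car X"
    then show "tens_id M1 X f (act (tens_mod M1 X) g (x \<otimes> t)) = act (tens_mod M0 (tens_mod V X)) g (tens_id M1 X f (x \<otimes> t))"
      using uq_linear_in[OF f xt(1)]
      by (cases g) (simp_all add: M1X.act_tens tens_id_tcons act_tapp uq_linear_act[OF f] tens_space_tcons
        linear_on_add[OF linear_tens_id])
  qed
qed (fact linear_tens_id tens_id_subset)+

end

end

section \<open>Vertex operators\<close>

locale verma_family =
  fixes D :: "'i::finite qdatum" and M :: "'i weight \<Rightarrow> ('i, 'v::cvec) uqmod" and m :: "'i weight \<Rightarrow> 'v"
    and lam :: "'i weight"
  assumes D: "qdatum D" and verma_M: "\<And>\<mu>. verma_module D \<mu> (M \<mu>) (m \<mu>)" and regular: "lam \<in> h_reg D M"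
begin

abbreviation "L \<equiv> weight_lattice D"

lemma verma_at: "verma D \<mu> (M \<mu>) (m \<mu>)"
  by (intro verma.intro D verma_M)

lemma premodule_at: "premodule D (M \<mu>)"
  using uq_module_premodule[OF D] verma_M by (auto simp: verma_module_def)

lemma irreducible_at: "\<kappa> \<in> L \<Longrightarrow> irreducible_verma D (lam - \<kappa>) (M (lam - \<kappa>)) (m (lam - \<kappa>))"
  using regular weight_lattice_uminus[of \<kappa> D]
  by (intro irreducible_verma.intro verma_at irreducible_verma_axioms.intro) (auto simp: h_reg_def)

lemma irreducible_tensor_at:
  "\<kappa> \<in> L \<Longrightarrow> premodule D T \<Longrightarrow> irreducible_verma_tensor D (lam - \<kappa>) (M (lam - \<kappa>)) (m (lam - \<kappa>)) T"
  by (intro irreducible_verma_tensor.intro verma_tensor.intro irreducible_at verma_at)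

lemma M_fd_premodule: "V \<in> M_fd D \<Longrightarrow> premodule D V"
  using uq_module_premodule[OF D M_fd_uq_module] .

lemma premodule_tensor_fd: "set Vs \<subseteq> M_fd D \<Longrightarrow> premodule D (tensor Vs)"
  using M_fd_premodule by (intro premodule_tensor[OF D]) auto

abbreviation ldr :: "'i weight \<Rightarrow> ('i, 'v) tens_uqmod \<Rightarrow> 'v tens \<Rightarrow> 'v tens" where
  "ldr \<kappa> X \<equiv> mstar_id D (lam - \<kappa>) (M (lam - \<kappa>)) (m (lam - \<kappa>)) X"

text \<open>This justifies the definite description in \<open>phi\<close>:
  \<open>singular_exists\<close> and \<open>singular_homomorphism\<close> give a map,
  \<open>homomorphism_unique\<close> its uniqueness. The source weight is written
  \<open>lam - \<kappa>\<close> with \<kappa> in the weight lattice, since regularity of lam then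
  makes \<open>M (lam - (\<kappa> + \<nu>))\<close> irreducible.\<close>

lemma phi_spec:
  assumes V: "V \<in> M_fd D" and \<kappa>: "\<kappa> \<in> L" and \<nu>: "\<nu> \<in> L" and v: "v \<in> wspace D V \<nu>"
  shows "phi D M m (lam - \<kappa>) V \<nu> v \<in> extensional (car (M (lam - \<kappa>)))" (is ?A)
    and uq_linear_phi: "uq_linear (M (lam - \<kappa>)) (tens_mod (M (lam - (\<kappa> + \<nu>))) (tens_mod V unit_mod))
      (phi D M m (lam - \<kappa>) V \<nu> v)" (is ?B)
    and ldr_phi: "ldr (\<kappa> + \<nu>) (tens_mod V unit_mod) (phi D M m (lam - \<kappa>) V \<nu> v (m (lam - \<kappa>))) = v \<otimes> tunit" (is ?C)
proof -
  interpret onefold D V by (intro onefold.intro M_fd_premodule V)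
  let ?T = "tens_mod V unit_mod"
  have \<kappa>\<nu>: "\<kappa> + \<nu> \<in> L" by (rule weight_lattice_add[OF \<kappa> \<nu>])
  interpret MT: irreducible_verma_tensor D "lam - (\<kappa> + \<nu>)" "M (lam - (\<kappa> + \<nu>))" "m (lam - (\<kappa> + \<nu>))" ?T
    by (rule irreducible_tensor_at[OF \<kappa>\<nu> VU.premodule_tens])
  note uq = M_fd_uq_module[OF V]
  have vV: "v \<in> car V" using v by (simp add: wspace_iff)
  have vt: "v \<otimes> tunit \<in> wspace D ?T \<nu>" by (rule onefold_weight[OF v])
  obtain G where "finite G" "G \<subseteq> (\<Union>\<mu>\<in>L. wspace D V \<mu>)" "car V = cvec.span G"
    using M_fd_spanning[OF V] by blast
  then obtain N where N: "\<And>w. length w \<ge> N \<Longrightarrow> foldr V.E w v = 0"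
    using V.E_word_nilpotent[of G v \<nu>] v by blast
  have serre: "serre_op D (\<lambda>i. act ?T (g i)) i j t = 0"
    if "g = GE \<or> g = GF" "i \<noteq> j" "t \<in> car ?T" for g i j t
  proof -
    obtain u where u: "u \<in> car V" "t = u \<otimes> tunit" using onefold_cases[OF \<open>t \<in> car ?T\<close>] by blast
    have "serre_op D (\<lambda>i. act V (g i)) i j u = 0"
      using that(1) uq_module_serre[OF D uq that(2) u(1)] by auto
    then show ?thesis by (simp add: u serre_onefold)
  qed
  have "\<exists>s\<in>car MT.XT. MT.lead s = v \<otimes> tunit \<and> (\<forall>i. MT.XT.E i s = 0) \<and>
      (\<forall>h. MT.XT.K h s = qw D (lam - (\<kappa> + \<nu>) + \<nu>) h *\<^sub>C s)"
  proof (rule MT.singular_exists)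
    show "v \<otimes> tunit \<in> car ?T" "\<And>h. VU.XT.K h (v \<otimes> tunit) = qw D \<nu> h *\<^sub>C (v \<otimes> tunit)"
      using vt by (auto simp only: wspace_iff)
    show "foldr VU.XT.E w (v \<otimes> tunit) = 0" if "length w \<ge> N" for w
      using N[OF that] vV by (simp add: act_word_onefold)
    show "serre_op D VU.XT.E i j x = 0" if "i \<noteq> j" "x \<in> car ?T" for i j x
      using serre[of GE] that by blast
  qed
  then obtain s where s: "s \<in> car MT.XT" "MT.lead s = v \<otimes> tunit" "\<And>i. MT.XT.E i s = 0"
    "\<And>h. MT.XT.K h s = qw D (lam - \<kappa>) h *\<^sub>C s" by auto
  have "\<exists>f. f \<in> extensional (car (M (lam - \<kappa>))) \<and> uq_linear (M (lam - \<kappa>)) MT.XT f \<and> f (m (lam - \<kappa>)) = s"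
  proof (rule MT.XT.singular_homomorphism[OF s(1,3,4) _ verma_at])
    show "serre_op D MT.XT.F i j y = 0" if "i \<noteq> j" "y \<in> car MT.XT" for i j y
      using MT.serre_F_tens[OF that(1) _ that(2)] serre[of GF] that(1) by blast
  qed
  then obtain f where f: "f \<in> extensional (car (M (lam - \<kappa>)))" "uq_linear (M (lam - \<kappa>)) MT.XT f" "f (m (lam - \<kappa>)) = s"
    by blast
  let ?P = "\<lambda>f. f \<in> extensional (car (M (lam - \<kappa>))) \<and> uq_linear (M (lam - \<kappa>)) MT.XT f \<and>
    MT.lead (f (m (lam - \<kappa>))) = v \<otimes> tunit"
  have eq: "lam - \<kappa> - \<nu> = lam - (\<kappa> + \<nu>)" by simp
  have "phi D M m (lam - \<kappa>) V \<nu> v = f"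
    unfolding phi_def tensor_simps eq MT.mstar_id_eq pure_tensor_simps
  proof (rule the_equality)
    show "?P f" using f s by simp
    fix g assume g: "?P g"
    then have ug: "uq_linear (M (lam - \<kappa>)) MT.XT g" and eg: "g \<in> extensional (car (M (lam - \<kappa>)))"
      and lg: "MT.lead (g (m (lam - \<kappa>))) = MT.lead (f (m (lam - \<kappa>)))" using f(3) s(2) by simp_all
    show "g = f"
    proof (rule extensionalityI[OF eg f(1)])
      show "g x = f x" if "x \<in> car (M (lam - \<kappa>))" for x
        by (rule MT.homomorphism_unique[OF verma_at ug f(2) lg that])
    qed
  qed
  then show ?A ?B ?C using f s by (simp_all add: MT.mstar_id_eq)
qed

lemma vertex_stepI:
  "V \<in> M_fd D \<Longrightarrow> premodule D X \<Longrightarrow> vertex_step D (M \<mu>) (M \<mu>') V X"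
  by (simp add: vertex_step_def onefold_def premodule_at M_fd_premodule)

lemma uq_linear_vertex_op:
  assumes "set Vs \<subseteq> M_fd D" "weight_vectors D Vs \<nu>s vs"
  shows "uq_linear (M lam) (tens_mod (M (lam - sum_list \<nu>s)) (tensor Vs)) (vertex_op D M m lam Vs \<nu>s vs)"
  using assms
proof (induction Vs arbitrary: \<nu>s vs)
  case Nil
  interpret onefold D "M lam" by (intro onefold.intro premodule_at)
  show ?case using Nil
    by (auto simp: uq_linear_def linear_on_def act_onefold onefold_in tcons_add_left tcons_scale_left simp del: VU.car_tens)
next
  case (Cons V Vs)
  obtain \<nu> \<nu>s' v vs' where eq: "\<nu>s = \<nu> # \<nu>s'" "vs = v # vs'" and \<nu>: "\<nu> \<in> L" and v: "v \<in> wspace D V \<nu>"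
    and vs': "weight_vectors D Vs \<nu>s' vs'" using Cons.prems(2) by (auto simp: weight_vectors_Cons)
  have V: "V \<in> M_fd D" and Vs: "set Vs \<subseteq> M_fd D" using Cons.prems(1) by auto
  define \<kappa> where "\<kappa> = sum_list \<nu>s'"
  have \<kappa>: "\<kappa> \<in> L" unfolding \<kappa>_def by (rule weight_vectors_lattice[OF vs'])
  interpret S: vertex_step D "M (lam - \<kappa>)" "M (lam - (\<kappa> + \<nu>))" V "tensor Vs"
    by (intro vertex_stepI V premodule_tensor_fd Vs)
  have "uq_linear (M lam) (tens_mod (M (lam - (\<kappa> + \<nu>))) (tens_mod V (tensor Vs)))
    (\<lambda>x. tens_id (M (lam - \<kappa>)) (tensor Vs) (phi D M m (lam - \<kappa>) V \<nu> v) (vertex_op D M m lam Vs \<nu>s' vs' x))"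
    by (rule uq_linear_compose[OF Cons.IH[OF Vs vs', folded \<kappa>_def] S.uq_linear_tens_id[OF uq_linear_phi[OF V \<kappa> \<nu> v]]])
  moreover have "(\<lambda>x. tens_id (M (lam - \<kappa>)) (tensor Vs) (phi D M m (lam - \<kappa>) V \<nu> v) (vertex_op D M m lam Vs \<nu>s' vs' x))
    = vertex_op D M m lam (V # Vs) (\<nu> # \<nu>s') (v # vs')"
    by (simp add: fun_eq_iff Let_def \<kappa>_def)
  ultimately show ?case
    by (simp only: eq tensor_simps sum_list.Cons \<kappa>_def[symmetric] add.commute[of \<nu> \<kappa>])
qed

abbreviation sing :: "('i, 'v) uqmod list \<Rightarrow> 'i weight list \<Rightarrow> 'v list \<Rightarrow> 'v tens" where
  "sing Vs \<nu>s vs \<equiv> vertex_op D M m lam Vs \<nu>s vs (m lam)"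

lemma sing_in:
  "set Vs \<subseteq> M_fd D \<Longrightarrow> weight_vectors D Vs \<nu>s vs \<Longrightarrow> sing Vs \<nu>s vs \<in> car (tens_mod (M (lam - sum_list \<nu>s)) (tensor Vs))"
  by (rule uq_linear_in[OF uq_linear_vertex_op verma.m_in[OF verma_at]])

lemma sing_K:
  assumes "set Vs \<subseteq> M_fd D" "weight_vectors D Vs \<nu>s vs"
  shows "act (tens_mod (M (lam - sum_list \<nu>s)) (tensor Vs)) (GK h) (sing Vs \<nu>s vs) = qw D lam h *\<^sub>C sing Vs \<nu>s vs"
proof -
  interpret V: verma D lam "M lam" "m lam" by (rule verma_at)
  show ?thesis
    using uq_linear_act[OF uq_linear_vertex_op[OF assms] V.m_in, of "GK h"]
      linear_on_scale[OF uq_linear_linear[OF uq_linear_vertex_op[OF assms]] V.m_in, of "qw D lam h"]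
    by (simp add: V.K_m)
qed

lemma ldr_weight:
  assumes \<kappa>: "\<kappa> \<in> L" and X: "premodule D X" and s: "s \<in> car (tens_mod (M (lam - \<kappa>)) X)"
    and K: "\<And>h. act (tens_mod (M (lam - \<kappa>)) X) (GK h) s = qw D lam h *\<^sub>C s"
  shows "ldr \<kappa> X s \<in> wspace D X \<kappa>"
proof -
  interpret irreducible_verma_tensor D "lam - \<kappa>" "M (lam - \<kappa>)" "m (lam - \<kappa>)" X
    by (rule irreducible_tensor_at[OF \<kappa> X])
  have "qw D (lam - \<kappa>) h *\<^sub>C T.K h (lead s) = qw D lam h *\<^sub>C lead s" for h
    using test_K[OF s, of "[]" h] s by (simp add: K test_scale)
  then have "inverse (qw D (lam - \<kappa>) h) *\<^sub>C (qw D (lam - \<kappa>) h *\<^sub>C T.K h (lead s)) =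
      inverse (qw D (lam - \<kappa>) h) *\<^sub>C (qw D lam h *\<^sub>C lead s)" for h by simp
  then have "T.K h (lead s) = qw D \<kappa> h *\<^sub>C lead s" for h
    by (simp add: scaleC_scaleC scaleC_one D qw_diff_left)
  then show ?thesis using test_in[OF s] by (simp add: wspace_iff mstar_id_eq)
qed

lemma weight_expansion:
  assumes Vs: "set Vs \<subseteq> M_fd D" and y: "y \<in> wspace D (tensor Vs) \<kappa>"
  shows "\<exists>(N::nat) c \<eta> w. (\<forall>n<N. weight_vectors D Vs (\<eta> n) (w n) \<and> sum_list (\<eta> n) = \<kappa>) \<and>
    y = (\<Sum>n<N. c n *\<^sub>C pure_tensor (w n))"
proof -
  interpret X: premodule D "tensor Vs" by (rule premodule_tensor_fd[OF Vs])
  obtain G where G: "finite G" "G \<subseteq> {pure_tensor vs |\<nu>s vs. weight_vectors D Vs \<nu>s vs}" "car (tensor Vs) = cvec.span G"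
    using tensor_spanning[OF D Vs] by blast
  have pw: "pure_tensor vs \<in> wspace D (tensor Vs) (sum_list \<nu>s)" if "weight_vectors D Vs \<nu>s vs" for \<nu>s vs
    using that Vs M_fd_premodule by (intro pure_tensor_weight[OF D]) auto
  have Gw: "\<exists>\<nu>s vs. g = pure_tensor vs \<and> weight_vectors D Vs \<nu>s vs" if "g \<in> G" for g
    using G(2) that by blast
  have "G \<subseteq> (\<Union>\<kappa>. wspace D (tensor Vs) \<kappa>)"
  proof
    fix g assume "g \<in> G"
    then obtain \<nu>s vs where "g = pure_tensor vs" "weight_vectors D Vs \<nu>s vs" using Gw by blast
    then show "g \<in> (\<Union>\<kappa>. wspace D (tensor Vs) \<kappa>)" using pw by auto
  qed
  then have "y \<in> cvec.span (G \<inter> wspace D (tensor Vs) \<kappa>)"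
    using y G(3) by (intro X.span_weight_part) (auto simp: wspace_iff)
  then have "y \<in> cvec.span (G \<inter> wspace D (tensor Vs) \<kappa> - {0})" by (simp add: cvec.span_delete_0)
  moreover define H where "H = G \<inter> wspace D (tensor Vs) \<kappa> - {0}"
  ultimately obtain u where u: "y = (\<Sum>g\<in>H. u g *\<^sub>C g)"
    using cvec.span_finite[of H] G(1) by auto
  have "\<exists>\<nu>s vs. g = pure_tensor vs \<and> weight_vectors D Vs \<nu>s vs \<and> sum_list \<nu>s = \<kappa>" if g: "g \<in> H" for g
  proof -
    obtain \<nu>s vs where gv: "g = pure_tensor vs" "weight_vectors D Vs \<nu>s vs" using Gw[of g] g unfolding H_def by blast
    then have "sum_list \<nu>s = \<kappa>" using X.wspace_unique[of g "sum_list \<nu>s" \<kappa>] pw g by (simp add: H_def)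
    then show ?thesis using gv by blast
  qed
  then obtain \<eta> w where \<eta>w: "\<And>g. g \<in> H \<Longrightarrow> g = pure_tensor (w g) \<and> weight_vectors D Vs (\<eta> g) (w g) \<and> sum_list (\<eta> g) = \<kappa>"
    by metis
  have finH: "finite H" using G(1) by (simp add: H_def)
  obtain e and N :: nat where e: "bij_betw e {..<N} H"
    using ex_bij_betw_nat_finite[OF finH] by (auto simp: lessThan_atLeast0)
  have "y = (\<Sum>n<N. u (e n) *\<^sub>C pure_tensor (w (e n)))"
    unfolding u sum.reindex_bij_betw[OF e, symmetric]
    using \<eta>w bij_betwE[OF e] by (intro sum.cong) auto
  then show ?thesis using \<eta>w bij_betwE[OF e]
    by (intro exI[of _ N] exI[of _ "\<lambda>n. u (e n)"] exI[of _ "\<lambda>n. \<eta> (e n)"] exI[of _ "\<lambda>n. w (e n)"]) auto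
qed

end

section \<open>The fusion operator\<close>

lemma (in vertex_step) tens_id_combination:
  assumes f: "uq_linear M1 (tens_mod M0 (tens_mod V unit_mod)) f"
    and g: "\<And>a. a \<in> A \<Longrightarrow> uq_linear M1 (tens_mod M0 (tens_mod V unit_mod)) (g a)"
    and eq: "\<And>x. x \<in> car M1 \<Longrightarrow> f x = (\<Sum>a\<in>A. c a *\<^sub>C g a x)"
    and y: "y \<in> car (tens_mod M1 X)"
  shows "tens_id M1 X f y = (\<Sum>a\<in>A. c a *\<^sub>C tens_id M1 X (g a) y)"
proof (rule linear_on_tens_space_eqI[where X = "car M1" and Y = "car X" and f = "tens_id M1 X f"
    and g = "\<lambda>y. \<Sum>a\<in>A. c a *\<^sub>C tens_id M1 X (g a) y"])
  show "linear_on (tens_space (car M1) (car X)) (tens_id M1 X f)"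
    using linear_tens_id[OF f] by simp
  have "linear_on (tens_space (car M1) (car X)) (tens_id M1 X (g a))" if "a \<in> A" for a
    using linear_tens_id[OF g[OF that]] by simp
  then show "linear_on (tens_space (car M1) (car X)) (\<lambda>y. \<Sum>a\<in>A. c a *\<^sub>C tens_id M1 X (g a) y)"
    by (intro linear_on_setsum linear_on_cmult)
  show "y \<in> tens_space (car M1) (car X)" using y by simp
  fix x t assume xt: "x \<in> car M1" "t \<in> car X"
  have "tapp 2 (\<Sum>a\<in>A. c a *\<^sub>C g a x) t = (\<Sum>a\<in>A. tapp 2 (c a *\<^sub>C g a x) t)"
    by (rule linear_on_sum[OF linear_tapp_left[of UNIV]]) auto
  also have "\<dots> = (\<Sum>a\<in>A. c a *\<^sub>C tapp 2 (g a x) t)" by (simp add: tapp_scale_left)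
  also have "\<dots> = (\<Sum>a\<in>A. c a *\<^sub>C tens_id M1 X (g a) (x \<otimes> t))"
    using xt by (intro sum.cong) (simp_all add: tens_id_tcons[OF g])
  finally show "tens_id M1 X f (x \<otimes> t) = (\<Sum>a\<in>A. c a *\<^sub>C tens_id M1 X (g a) (x \<otimes> t))"
    using xt by (simp add: tens_id_tcons[OF f] eq)
qed

context verma_family
begin

text \<open>Both sides are intertwiners with the same leading term. All vectors must have the same
  weight \<nu>, because the target module depends on \<nu>.\<close>

lemma phi_combination:
  assumes V: "V \<in> M_fd D" and \<kappa>: "\<kappa> \<in> L" and \<nu>: "\<nu> \<in> L" and u: "\<And>a. a \<in> A \<Longrightarrow> u a \<in> wspace D V \<nu>"
    and v: "v = (\<Sum>a\<in>A. c a *\<^sub>C u a)" and x: "x \<in> car (M (lam - \<kappa>))"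
  shows "phi D M m (lam - \<kappa>) V \<nu> v x = (\<Sum>a\<in>A. c a *\<^sub>C phi D M m (lam - \<kappa>) V \<nu> (u a) x)"
proof -
  interpret onefold D V by (intro onefold.intro M_fd_premodule V)
  interpret MT: irreducible_verma_tensor D "lam - (\<kappa> + \<nu>)" "M (lam - (\<kappa> + \<nu>))" "m (lam - (\<kappa> + \<nu>))" "tens_mod V unit_mod"
    by (rule irreducible_tensor_at[OF weight_lattice_add[OF \<kappa> \<nu>] VU.premodule_tens])
  interpret M1: verma D "lam - \<kappa>" "M (lam - \<kappa>)" "m (lam - \<kappa>)" by (rule verma_at)
  have vw: "v \<in> wspace D V \<nu>" unfolding v
    using u by (intro cvec.subspace_sum[OF V.subspace_wspace] cvec.subspace_scale[OF V.subspace_wspace])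
  note uq = uq_linear_phi[OF V \<kappa> \<nu>] and ld = ldr_phi[OF V \<kappa> \<nu>, unfolded MT.mstar_id_eq]
  show ?thesis
  proof (rule MT.homomorphism_unique[OF verma_at uq[OF vw] _ _ x])
    show "uq_linear (M (lam - \<kappa>)) MT.XT (\<lambda>x. \<Sum>a\<in>A. c a *\<^sub>C phi D M m (lam - \<kappa>) V \<nu> (u a) x)"
      by (rule uq_linear_sum[OF premodule_at MT.premodule_tens uq[OF u]])
    have inX: "phi D M m (lam - \<kappa>) V \<nu> (u a) (m (lam - \<kappa>)) \<in> car MT.XT" if "a \<in> A" for a
      by (rule uq_linear_in[OF uq[OF u[OF that]] M1.m_in])
    have "MT.lead (\<Sum>a\<in>A. c a *\<^sub>C phi D M m (lam - \<kappa>) V \<nu> (u a) (m (lam - \<kappa>))) =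
        (\<Sum>a\<in>A. MT.lead (c a *\<^sub>C phi D M m (lam - \<kappa>) V \<nu> (u a) (m (lam - \<kappa>))))"
      by (rule linear_on_sum[OF MT.linear_test MT.XT.subspace_car]) (rule MT.XT.scale_in[OF inX])
    also have "\<dots> = (\<Sum>a\<in>A. c a *\<^sub>C (u a \<otimes> tunit))"
      using ld[OF u] linear_on_scale[OF MT.linear_test inX] by (intro sum.cong) simp_all
    also have "\<dots> = v \<otimes> tunit" by (simp add: v tcons_sum_left tcons_scale_left)
    finally show "MT.lead (phi D M m (lam - \<kappa>) V \<nu> v (m (lam - \<kappa>))) =
        MT.lead (\<Sum>a\<in>A. c a *\<^sub>C phi D M m (lam - \<kappa>) V \<nu> (u a) (m (lam - \<kappa>)))"
      using ld[OF vw] by simp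
  qed
qed

text \<open>The source of triangularity: the empty word contributes \<open>v \<otimes> t\<close>,
  and every longer word lowers v by \<open>F_w\<close>. The computation is the equivariance of
  \<open>phi\<close> followed by \<open>lead_F_word\<close>.\<close>

lemma ldr_tens_id_word:
  assumes V: "V \<in> M_fd D" and \<kappa>: "\<kappa> \<in> L" and \<nu>: "\<nu> \<in> L" and v: "v \<in> wspace D V \<nu>" and X: "premodule D X"
    and t: "t \<in> car X"
  shows "ldr (\<kappa> + \<nu>) (tens_mod V X) (tens_id (M (lam - \<kappa>)) X (phi D M m (lam - \<kappa>) V \<nu> v)
      (foldr (\<lambda>i. act (M (lam - \<kappa>)) (GF i)) w (m (lam - \<kappa>)) \<otimes> t))
    = qw D (lam - (\<kappa> + \<nu>)) (- wt w) *\<^sub>C (foldr (\<lambda>i. act V (GF i)) w v \<otimes> t)"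
proof -
  interpret S: vertex_step D "M (lam - \<kappa>)" "M (lam - (\<kappa> + \<nu>))" V X
    by (intro vertex_stepI V X)
  have \<kappa>\<nu>: "\<kappa> + \<nu> \<in> L" by (rule weight_lattice_add[OF \<kappa> \<nu>])
  interpret M1: verma D "lam - \<kappa>" "M (lam - \<kappa>)" "m (lam - \<kappa>)" by (rule verma_at)
  interpret M0: irreducible_verma D "lam - (\<kappa> + \<nu>)" "M (lam - (\<kappa> + \<nu>))" "m (lam - (\<kappa> + \<nu>))"
    by (rule irreducible_at[OF \<kappa>\<nu>])
  interpret M0V: irreducible_verma_tensor D "lam - (\<kappa> + \<nu>)" "M (lam - (\<kappa> + \<nu>))" "m (lam - (\<kappa> + \<nu>))" "tens_mod V unit_mod"
    by (rule irreducible_tensor_at[OF \<kappa>\<nu> S.VU.premodule_tens])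
  interpret M0VX: irreducible_verma_tensor D "lam - (\<kappa> + \<nu>)" "M (lam - (\<kappa> + \<nu>))" "m (lam - (\<kappa> + \<nu>))" "tens_mod V X"
    by (rule irreducible_tensor_at[OF \<kappa>\<nu> S.VX.premodule_tens])
  let ?\<phi> = "phi D M m (lam - \<kappa>) V \<nu> v"
  note uq = uq_linear_phi[OF V \<kappa> \<nu> v]
  have vV: "v \<in> car V" using v by (simp add: wspace_iff)
  \<comment> \<open>The leading term affects the Verma factor only, so it commutes with appending t;
    the tensor that remains in front of t has one factor instead of two.\<close>
  have lead_tapp: "M0VX.lead (tapp 2 z t) = tapp 1 (M0V.lead z) t" if z: "z \<in> car S.M0V.XT" for z
  proof (rule S.M0V_eqI[OF z])
    show "linear_on (car S.M0V.XT) (\<lambda>z. M0VX.lead (tapp 2 z t))"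
      by (rule linear_on_compose[OF S.linear_tapp_left _ M0VX.linear_test]) (use S.tapp_in t in blast)
    show "linear_on (car S.M0V.XT) (\<lambda>z. tapp 1 (M0V.lead z) t)"
      by (rule S.linear_tapp_compose[OF M0V.linear_test])
    fix a b assume ab: "a \<in> car (M (lam - (\<kappa> + \<nu>)))" "b \<in> car V"
    have "M0VX.lead (tapp 2 (a \<otimes> (b \<otimes> tunit)) t) = M0.chi a *\<^sub>C (b \<otimes> t)"
      unfolding tapp_2 using ab t by (simp add: M0VX.test_tcons tens_space_tcons)
    moreover have "M0V.lead (a \<otimes> (b \<otimes> tunit)) = M0.chi a *\<^sub>C (b \<otimes> tunit)"
      using ab S.onefold_in by (simp add: M0V.test_tcons)
    ultimately show "M0VX.lead (tapp 2 (a \<otimes> (b \<otimes> tunit)) t) = tapp 1 (M0V.lead (a \<otimes> (b \<otimes> tunit))) t"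
      by (simp only: tapp_scale_left tapp_1)
  qed
  have F: "?\<phi> (foldr (\<lambda>i. act (M (lam - \<kappa>)) (GF i)) w (m (lam - \<kappa>))) =
      foldr (\<lambda>i. act S.M0V.XT (GF i)) w (?\<phi> (m (lam - \<kappa>)))"
    by (rule uq_linear_word[OF premodule_at uq M1.m_in])
  have \<phi>m: "?\<phi> (m (lam - \<kappa>)) \<in> car S.M0V.XT" by (rule uq_linear_in[OF uq M1.m_in])
  define z where "z = foldr (\<lambda>i. act S.M0V.XT (GF i)) w (?\<phi> (m (lam - \<kappa>)))"
  have z: "z \<in> car S.M0V.XT" unfolding z_def by (rule S.M0V.XT.word_map_in[OF \<phi>m])
  have 1: "tens_id (M (lam - \<kappa>)) X ?\<phi> (foldr (\<lambda>i. act (M (lam - \<kappa>)) (GF i)) w (m (lam - \<kappa>)) \<otimes> t) = tapp 2 z t"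
    unfolding z_def F[symmetric] by (rule S.tens_id_tcons[OF uq S.M1.word_map_in[OF M1.m_in] t])
  have "M0V.lead (?\<phi> (m (lam - \<kappa>))) = v \<otimes> tunit"
    using ldr_phi[OF V \<kappa> \<nu> v] unfolding M0V.mstar_id_eq .
  then have "M0V.lead z = qw D (lam - (\<kappa> + \<nu>)) (- wt w) *\<^sub>C (foldr (\<lambda>i. act V (GF i)) w v \<otimes> tunit)"
    unfolding z_def M0V.lead_F_word[OF \<phi>m] by (simp only: S.act_word_onefold[OF vV])
  then have "tapp 1 (M0V.lead z) t = qw D (lam - (\<kappa> + \<nu>)) (- wt w) *\<^sub>C (foldr (\<lambda>i. act V (GF i)) w v \<otimes> t)"
    by (simp only: tapp_scale_left tapp_1)
  then show ?thesis unfolding 1 M0VX.mstar_id_eq lead_tapp[OF z] .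
qed

text \<open>Pure tensors satisfy many linear relations, so it is not evident that a linear map with
  these values exists. Stating the specification as a predicate separates that question, settled by
  \<open>fusion_map_exists\<close>, from the identification with \<open>fusion\<close> in
  \<open>fusion_eq\<close>.\<close>

definition fusion_map :: "('i, 'v) uqmod list \<Rightarrow> ('v tens \<Rightarrow> 'v tens) \<Rightarrow> bool" where
  "fusion_map Vs J \<longleftrightarrow> linear_on (car (tensor Vs)) J \<and>
    (\<forall>\<nu>s vs. weight_vectors D Vs \<nu>s vs \<longrightarrow> J (pure_tensor vs) = ldr (sum_list \<nu>s) (tensor Vs) (sing Vs \<nu>s vs))"

lemma pure_weight: "set Vs \<subseteq> M_fd D \<Longrightarrow> weight_vectors D Vs \<nu>s vs \<Longrightarrow> pure_tensor vs \<in> wspace D (tensor Vs) (sum_list \<nu>s)"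
  using M_fd_premodule by (intro pure_tensor_weight[OF D]) auto

lemma pure_in: "set Vs \<subseteq> M_fd D \<Longrightarrow> weight_vectors D Vs \<nu>s vs \<Longrightarrow> pure_tensor vs \<in> car (tensor Vs)"
  using pure_weight by (auto simp: wspace_iff)

context
  fixes Vs :: "('i, 'v) uqmod list" and J :: "'v tens \<Rightarrow> 'v tens"
  assumes Vs: "set Vs \<subseteq> M_fd D" and J: "fusion_map Vs J"
begin

interpretation X: premodule D "tensor Vs" by (rule premodule_tensor_fd[OF Vs])

lemma fusion_map_linear: "linear_on (car (tensor Vs)) J"
  and fusion_map_pure: "weight_vectors D Vs \<nu>s vs \<Longrightarrow> J (pure_tensor vs) = ldr (sum_list \<nu>s) (tensor Vs) (sing Vs \<nu>s vs)"
  using J by (auto simp: fusion_map_def)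

lemma fusion_map_pure_weight: "weight_vectors D Vs \<nu>s vs \<Longrightarrow> J (pure_tensor vs) \<in> wspace D (tensor Vs) (sum_list \<nu>s)"
  unfolding fusion_map_pure
  by (intro ldr_weight weight_lattice_sum_list X.premodule_axioms sing_in sing_K Vs weight_vectors_lattice)

lemma fusion_map_sum:
  assumes "\<And>n. n \<in> A \<Longrightarrow> weight_vectors D Vs (\<eta> n) (w n)"
  shows "J (\<Sum>n\<in>A. c n *\<^sub>C pure_tensor (w n)) = (\<Sum>n\<in>A. c n *\<^sub>C J (pure_tensor (w n)))"
  using pure_in[OF Vs assms] by (subst linear_on_sum[OF fusion_map_linear X.subspace_car])
    (auto simp: linear_on_scale[OF fusion_map_linear])

lemma fusion_map_weight:
  assumes "y \<in> wspace D (tensor Vs) \<kappa>"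
  shows "J y \<in> wspace D (tensor Vs) \<kappa>"
proof -
  obtain N :: nat and c \<eta> w where w: "\<And>n. n < N \<Longrightarrow> weight_vectors D Vs (\<eta> n) (w n) \<and> sum_list (\<eta> n) = \<kappa>"
    and y: "y = (\<Sum>n<N. c n *\<^sub>C pure_tensor (w n))"
    using weight_expansion[OF Vs assms] by blast
  have "J y = (\<Sum>n<N. c n *\<^sub>C J (pure_tensor (w n)))"
    unfolding y using w by (intro fusion_map_sum) auto
  also have "\<dots> \<in> wspace D (tensor Vs) \<kappa>"
  proof (intro cvec.subspace_sum[OF X.subspace_wspace] cvec.subspace_scale[OF X.subspace_wspace])
    show "J (pure_tensor (w n)) \<in> wspace D (tensor Vs) \<kappa>" if "n \<in> {..<N}" for n
      using fusion_map_pure_weight[of "\<eta> n" "w n"] w[of n] that by auto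
  qed
  finally show ?thesis .
qed

lemma pure_span:
  obtains G where "finite G" "\<And>g. g \<in> G \<Longrightarrow> \<exists>\<nu>s vs. g = pure_tensor vs \<and> weight_vectors D Vs \<nu>s vs"
    "\<And>g. g \<in> G \<Longrightarrow> \<exists>\<kappa>. g \<in> wspace D (tensor Vs) \<kappa>" "car (tensor Vs) = cvec.span G"
proof -
  obtain G where G: "finite G" "G \<subseteq> {pure_tensor vs |\<nu>s vs. weight_vectors D Vs \<nu>s vs}" "car (tensor Vs) = cvec.span G"
    using tensor_spanning[OF D Vs] by blast
  have 1: "\<exists>\<nu>s vs. g = pure_tensor vs \<and> weight_vectors D Vs \<nu>s vs" if "g \<in> G" for g
    using G(2) that by blast
  then have "\<exists>\<kappa>. g \<in> wspace D (tensor Vs) \<kappa>" if "g \<in> G" for g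
    using pure_weight[OF Vs] that by blast
  then show thesis using that G 1 by blast
qed

text \<open>J preserves weights, so a surjective J is surjective on each weight space: the target is
  spanned by images of weight vectors, and by \<open>span_weight_part\<close> only those of weight
  \<kappa> are involved.\<close>

lemma fusion_map_weight_lift:
  assumes surj: "car (tensor Vs) \<subseteq> J ` car (tensor Vs)" and t: "t \<in> wspace D (tensor Vs) \<kappa>"
  shows "\<exists>y\<in>wspace D (tensor Vs) \<kappa>. J y = t"
proof -
  obtain G where G: "\<And>g. g \<in> G \<Longrightarrow> \<exists>\<kappa>. g \<in> wspace D (tensor Vs) \<kappa>" "car (tensor Vs) = cvec.span G"
    using pure_span by metis
  let ?W = "wspace D (tensor Vs) \<kappa>"
  have "J ` car (tensor Vs) = cvec.span (J ` G)"
    using linear_on_image_span[of G J] fusion_map_linear G(2) by simp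
  then have "t \<in> cvec.span (J ` G)" using surj t by (auto simp: wspace_iff)
  moreover have "J ` G \<subseteq> (\<Union>\<kappa>. wspace D (tensor Vs) \<kappa>)" using G(1) fusion_map_weight by blast
  ultimately have t': "t \<in> cvec.span (J ` G \<inter> ?W)" using t by (intro X.span_weight_part)
  have W: "cvec.span ?W = ?W" using cvec.span_eq_iff[of ?W] X.subspace_wspace by simp
  have "?W \<subseteq> car (tensor Vs)" by (auto simp: wspace_iff)
  then have "linear_on (cvec.span ?W) J" unfolding W by (rule linear_on_subset[OF fusion_map_linear])
  then have sub: "J ` ?W = cvec.span (J ` ?W)" using linear_on_image_span[of ?W J] W by simp
  have "J ` G \<inter> ?W \<subseteq> J ` ?W"
  proof
    fix z assume z: "z \<in> J ` G \<inter> ?W"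
    then obtain g \<pi> where g: "z = J g" "g \<in> wspace D (tensor Vs) \<pi>" using G(1) by blast
    show "z \<in> J ` ?W"
    proof (cases "z = 0")
      case True
      have "0 \<in> J ` ?W" using cvec.span_zero[of "J ` ?W"] sub by simp
      then show ?thesis using True by simp
    next
      case False
      then have "\<pi> = \<kappa>" using X.wspace_unique[of z \<pi> \<kappa>] fusion_map_weight[OF g(2)] z g by auto
      then show ?thesis using g by blast
    qed
  qed
  then have "cvec.span (J ` G \<inter> ?W) \<subseteq> J ` ?W" using sub cvec.span_mono by metis
  then show ?thesis using t' by blast
qed

text \<open>Singular vectors are determined by their leading terms, which depend linearly on the pure tensors.\<close>

lemma sing_combination:
  assumes w: "\<And>n. n \<in> A \<Longrightarrow> weight_vectors D Vs (\<eta> n) (w n) \<and> sum_list (\<eta> n) = sum_list \<nu>s"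
    and vs: "weight_vectors D Vs \<nu>s vs" and eq: "pure_tensor vs = (\<Sum>n\<in>A. c n *\<^sub>C pure_tensor (w n))"
  shows "sing Vs \<nu>s vs = (\<Sum>n\<in>A. c n *\<^sub>C sing Vs (\<eta> n) (w n))"
proof -
  have \<kappa>: "sum_list \<nu>s \<in> L" by (rule weight_vectors_lattice[OF vs])
  interpret MT: irreducible_verma_tensor D "lam - sum_list \<nu>s" "M (lam - sum_list \<nu>s)" "m (lam - sum_list \<nu>s)" "tensor Vs"
    by (rule irreducible_tensor_at[OF \<kappa> X.premodule_axioms])
  have uq: "uq_linear (M lam) MT.XT (vertex_op D M m lam Vs (\<eta> n) (w n))" if "n \<in> A" for n
    using uq_linear_vertex_op[OF Vs, of "\<eta> n" "w n"] w[OF that] by simp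
  have inXT: "sing Vs (\<eta> n) (w n) \<in> car MT.XT" if "n \<in> A" for n
    using sing_in[OF Vs, of "\<eta> n" "w n"] w[OF that] by simp
  show ?thesis
  proof (rule MT.homomorphism_unique[OF verma_at uq_linear_vertex_op[OF Vs vs] uq_linear_sum[OF premodule_at MT.premodule_tens uq]])
    show "m lam \<in> car (M lam)" by (rule verma.m_in[OF verma_at])
    have "MT.lead (\<Sum>n\<in>A. c n *\<^sub>C sing Vs (\<eta> n) (w n)) = (\<Sum>n\<in>A. MT.lead (c n *\<^sub>C sing Vs (\<eta> n) (w n)))"
      by (rule linear_on_sum[OF MT.linear_test MT.XT.subspace_car]) (rule MT.XT.scale_in[OF inXT])
    also have "\<dots> = (\<Sum>n\<in>A. c n *\<^sub>C J (pure_tensor (w n)))"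
    proof (rule sum.cong)
      fix n assume n: "n \<in> A"
      have "J (pure_tensor (w n)) = MT.lead (sing Vs (\<eta> n) (w n))"
        using fusion_map_pure[of "\<eta> n" "w n"] w[OF n] by (simp add: MT.mstar_id_eq)
      then show "MT.lead (c n *\<^sub>C sing Vs (\<eta> n) (w n)) = c n *\<^sub>C J (pure_tensor (w n))"
        using linear_on_scale[OF MT.linear_test inXT[OF n]] by simp
    qed simp
    also have "\<dots> = J (pure_tensor vs)" unfolding eq using w by (intro fusion_map_sum[symmetric]) auto
    finally show "MT.lead (sing Vs \<nu>s vs) = MT.lead (\<Sum>n\<in>A. c n *\<^sub>C sing Vs (\<eta> n) (w n))"
      by (simp add: fusion_map_pure[OF vs] MT.mstar_id_eq)
  qed
qed

end

lemma fusion_map_Nil: "fusion_map [] (\<lambda>x. x)"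
proof -
  interpret U: premodule D "unit_mod :: ('i, 'v) tens_uqmod" by (rule premodule_unit[OF D])
  interpret MT: irreducible_verma_tensor D "lam - 0" "M (lam - 0)" "m (lam - 0)" "unit_mod :: ('i, 'v) tens_uqmod"
    by (rule irreducible_tensor_at[OF weight_lattice_0 U.premodule_axioms])
  have "MT.lead (m lam \<otimes> tunit) = tunit"
    using MT.test_tcons[of "m lam" tunit "[]"] MT.m_in MT.chi_m by (simp add: cvec.span_base scaleC_one)
  then show ?thesis by (simp add: fusion_map_def linear_on_id MT.mstar_id_eq[simplified])
qed

end

text \<open>The image of a finite basis spans, so by the exchange bound it has as many elements as
  the basis and is independent.\<close>

lemma surjective_on_span_imp_inj_on:
  assumes G: "finite G" and J: "linear_on (cvec.span G) J" "cvec.span G \<subseteq> J ` cvec.span G"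
  shows "inj_on J (cvec.span G)"
proof -
  obtain B where B: "B \<subseteq> G" "cvec.independent B" "G \<subseteq> cvec.span B"
    using cvec.maximal_independent_subset[of G] by blast
  have finB: "finite B" using B(1) G finite_subset by blast
  have span: "cvec.span G = cvec.span B"
    using B cvec.span_mono[of B G] cvec.span_minimal[of G "cvec.span B"] by auto
  note lin = J(1)[unfolded span]
  have spanJ: "cvec.span B \<subseteq> cvec.span (J ` B)" using J(2) linear_on_image_span[OF lin] span by simp
  then have BJ: "B \<subseteq> cvec.span (J ` B)" using cvec.span_superset[of B] by blast
  have "card B \<le> card (J ` B)" using cvec.independent_span_bound[OF _ B(2) BJ] finB by simp
  then have card: "card (J ` B) = card B" using card_image_le[OF finB, of J] by simp
  then have injB: "inj_on J B" using finB by (simp add: eq_card_imp_inj_on)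
  have ind: "cvec.independent (J ` B)"
  proof
    assume "cvec.dependent (J ` B)"
    then obtain a where a: "a \<in> J ` B" "a \<in> cvec.span (J ` B - {a})" unfolding cvec.dependent_def by blast
    then have "cvec.span (J ` B - {a}) = cvec.span (J ` B)" using cvec.span_redundant[of a "J ` B - {a}"] by (simp add: insert_absorb)
    then have "card B \<le> card (J ` B - {a})"
      using cvec.independent_span_bound[OF _ B(2), of "J ` B - {a}"] BJ finB by simp
    moreover have "card (J ` B - {a}) < card (J ` B)" using a(1) finB by (intro card_Diff1_less) auto
    ultimately show False using card by simp
  qed
  have zero: "x = 0" if x: "x \<in> cvec.span B" "J x = 0" for x
  proof -
    obtain u where u: "x = (\<Sum>b\<in>B. u b *\<^sub>C b)" using x(1) cvec.span_finite[OF finB] by auto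
    have "J x = (\<Sum>b\<in>B. J (u b *\<^sub>C b))"
      unfolding u by (rule linear_on_sum[OF lin]) (auto intro: cvec.span_scale cvec.span_base)
    also have "\<dots> = (\<Sum>b\<in>B. u b *\<^sub>C J b)"
      by (intro sum.cong) (auto simp: linear_on_scale[OF lin] cvec.span_base)
    also have "\<dots> = (\<Sum>c\<in>J ` B. u (the_inv_into B J c) *\<^sub>C c)"
      by (simp add: sum.reindex[OF injB] the_inv_into_f_f[OF injB])
    finally have "(\<Sum>c\<in>J ` B. u (the_inv_into B J c) *\<^sub>C c) = 0" using x(2) by simp
    then have "\<forall>c\<in>J ` B. u (the_inv_into B J c) = 0"
      using ind finB cvec.dependent_finite[of "J ` B"] by auto
    then have "u b = 0" if "b \<in> B" for b using that the_inv_into_f_f[OF injB that] by fastforce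
    then show ?thesis unfolding u by simp
  qed
  show ?thesis
  proof (rule inj_onI)
    fix x y assume xy: "x \<in> cvec.span G" "y \<in> cvec.span G" "J x = J y"
    have "J (x - y) = J x - J y" by (rule linear_on_diff[OF J(1) cvec.subspace_span xy(1,2)])
    then have J0: "J (x - y) = 0" using xy(3) by simp
    have "x - y \<in> cvec.span B" using cvec.span_diff[OF xy(1,2)] by (simp only: span)
    from zero[OF this J0] show "x = y" by simp
  qed
qed

section \<open>Existence and surjectivity of the fusion operator\<close>

context verma_family
begin

lemma linear_ldr:
  assumes "\<kappa> \<in> L" "premodule D T"
  shows "linear_on (car (tens_mod (M (lam - \<kappa>)) T)) (ldr \<kappa> T)"
proof -
  interpret MT: irreducible_verma_tensor D "lam - \<kappa>" "M (lam - \<kappa>)" "m (lam - \<kappa>)" T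
    by (rule irreducible_tensor_at[OF assms])
  show ?thesis unfolding MT.mstar_id_eq by (rule MT.linear_test)
qed

lemma sing_Cons: "sing (V # Vs) (\<nu> # \<nu>s) (v # vs) = tens_id (M (lam - sum_list \<nu>s)) (tensor Vs)
    (phi D M m (lam - sum_list \<nu>s) V \<nu> v) (sing Vs \<nu>s vs)"
  by (simp add: Let_def)

text \<open>The map is prescribed on tensors of basis weight vectors and extended bilinearly. That
  it has the right value on every pure tensor of weight vectors follows from
  \<open>phi_combination\<close> in the first factor and \<open>sing_combination\<close> in the
  rest.\<close>

lemma fusion_map_Cons:
  assumes V: "V \<in> M_fd D" and Vs: "set Vs \<subseteq> M_fd D" and J': "fusion_map Vs J'"
  shows "\<exists>J. fusion_map (V # Vs) J"
proof -
  let ?X = "tensor Vs"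
  interpret VX: premodule_pair D V ?X
    by (intro premodule_pair.intro M_fd_premodule[OF V] premodule_tensor_fd[OF Vs])
  obtain GV where GV: "finite GV" "GV \<subseteq> (\<Union>\<mu>\<in>L. wspace D V \<mu>)" "car V = cvec.span GV"
    using M_fd_spanning[OF V] by blast
  have GV': "GV \<subseteq> (\<Union>\<mu>. wspace D V \<mu>)" using GV(2) by blast
  obtain B and r :: "'v \<Rightarrow> 'v \<Rightarrow> complex" where "weight_coordinates D V GV B r"
    using VX.X.weight_basis[OF GV(1) GV' GV(3)] by blast
  note B = weight_coordinatesD[OF this]
  have "\<exists>\<nu>. \<nu> \<in> L \<and> b \<in> wspace D V \<nu>" if "b \<in> B" for b using that B(2) GV(2) by blast
  then obtain \<omega> where \<omega>: "\<And>b. b \<in> B \<Longrightarrow> \<omega> b \<in> L \<and> b \<in> wspace D V (\<omega> b)" by metis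
  obtain GX where GX: "finite GX" "\<And>g. g \<in> GX \<Longrightarrow> \<exists>\<nu>s vs. g = pure_tensor vs \<and> weight_vectors D Vs \<nu>s vs"
    "\<And>g. g \<in> GX \<Longrightarrow> \<exists>\<kappa>. g \<in> wspace D ?X \<kappa>" "car ?X = cvec.span GX"
    using pure_span[OF Vs J'] by metis
  have GX': "GX \<subseteq> (\<Union>\<mu>. wspace D ?X \<mu>)" using GX(3) by blast
  obtain C and r' :: "'v tens \<Rightarrow> 'v tens \<Rightarrow> complex" where "weight_coordinates D ?X GX C r'"
    using VX.T.weight_basis[OF GX(1) GX' GX(4)] by blast
  note C = weight_coordinatesD[OF this]
  have "\<exists>\<nu>s vs. g = pure_tensor vs \<and> weight_vectors D Vs \<nu>s vs" if "g \<in> C" for g using that C(2) GX(2) by blast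
  then obtain \<eta> w where \<eta>w: "\<And>c. c \<in> C \<Longrightarrow> c = pure_tensor (w c) \<and> weight_vectors D Vs (\<eta> c) (w c)" by metis
  \<comment> \<open>The prescribed image of the basis tensor \<open>b \<otimes> c\<close>, with the
    weight \<open>\<omega> b\<close> and the factorization \<open>w c\<close> chosen once and for
    all.\<close>
  define Z where "Z b c = ldr (sum_list (\<eta> c) + \<omega> b) (tens_mod V ?X)
    (tens_id (M (lam - sum_list (\<eta> c))) ?X (phi D M m (lam - sum_list (\<eta> c)) V (\<omega> b) b) (sing Vs (\<eta> c) (w c)))" for b c
  define \<beta> where "\<beta> v t = (\<Sum>b\<in>B. \<Sum>c\<in>C. (r b v * r' c t) *\<^sub>C Z b c)" for v t
  have bil: "bilinear_on (car V) (car ?X) \<beta>"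
  proof -
    have "linear_on (car ?X) (\<lambda>t. z * r' c t)" for z c
      using linear_on_cmult[OF C(3)[of c], of z] by (simp add: scaleC_complex)
    moreover have "linear_on (car V) (\<lambda>v. r b v * z)" for z b
      using linear_on_cmult[OF B(3)[of b], of z] by (simp add: scaleC_complex mult.commute)
    ultimately show ?thesis unfolding bilinear_on_def \<beta>_def
      by (intro conjI ballI linear_on_setsum linear_on_scaled)
  qed
  define J where "J = tens_lift (car V) (car ?X) \<beta>"
  have "fusion_map (V # Vs) J"
    unfolding fusion_map_def
  proof (intro conjI allI impI)
    show "linear_on (car (tensor (V # Vs))) J"
      unfolding J_def using linear_on_tens_lift[OF VX.X.subspace_car VX.T.subspace_car bil] by simp
    fix \<nu>s0 vs0 assume "weight_vectors D (V # Vs) \<nu>s0 vs0"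
    then obtain \<nu> \<nu>s v vs where eq: "\<nu>s0 = \<nu> # \<nu>s" "vs0 = v # vs" and \<nu>: "\<nu> \<in> L" and v: "v \<in> wspace D V \<nu>"
      and vs: "weight_vectors D Vs \<nu>s vs" by (auto simp: weight_vectors_Cons)
    define t where "t = pure_tensor vs"
    define \<kappa> where "\<kappa> = sum_list \<nu>s"
    have \<kappa>: "\<kappa> \<in> L" unfolding \<kappa>_def by (rule weight_vectors_lattice[OF vs])
    have \<kappa>\<nu>: "\<kappa> + \<nu> \<in> L" by (rule weight_lattice_add[OF \<kappa> \<nu>])
    have t: "t \<in> wspace D ?X \<kappa>" unfolding t_def \<kappa>_def by (rule pure_weight[OF Vs vs])
    have vV: "v \<in> car V" and tX: "t \<in> car ?X" using v t by (auto simp: wspace_iff)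
    \<comment> \<open>Basis vectors with nonzero coordinates have the weights \<nu> and \<kappa> of
      v and t. On them all vertex operators have the same source and target, so linear combinations
      make sense.\<close>
    define B' where "B' = {b \<in> B. r b v \<noteq> 0}"
    define C' where "C' = {c \<in> C. r' c t \<noteq> 0}"
    have fin: "finite B'" "finite C'" using B(1) C(1) by (auto simp: B'_def C'_def)
    have B': "b \<in> wspace D V \<nu>" "\<omega> b = \<nu>" if "b \<in> B'" for b
    proof -
      show 1: "b \<in> wspace D V \<nu>" using B(5)[OF v] that by (auto simp: B'_def)
      show "\<omega> b = \<nu>" using VX.X.wspace_unique[of b "\<omega> b" \<nu>] \<omega>[of b] 1 that B(2) by (auto simp: B'_def)
    qed
    have C': "c = pure_tensor (w c)" "weight_vectors D Vs (\<eta> c) (w c)" "sum_list (\<eta> c) = \<kappa>" if "c \<in> C'" for c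
    proof -
      have cC: "c \<in> C" using that by (simp add: C'_def)
      show 1: "c = pure_tensor (w c)" "weight_vectors D Vs (\<eta> c) (w c)" using \<eta>w[OF cC] by auto
      have "c \<in> wspace D ?X \<kappa>" using C(5)[OF t] that by (auto simp: C'_def)
      moreover have "c \<in> wspace D ?X (sum_list (\<eta> c))" using pure_weight[OF Vs 1(2)] 1(1) by simp
      ultimately show "sum_list (\<eta> c) = \<kappa>" using VX.T.wspace_unique[of c "sum_list (\<eta> c)" \<kappa>] C(2) cC by auto
    qed
    have v_sum: "v = (\<Sum>b\<in>B'. r b v *\<^sub>C b)"
      using B(1) B(4)[OF vV] sum.mono_neutral_right[of B B' "\<lambda>b. r b v *\<^sub>C b"] by (auto simp: B'_def)
    have "t = (\<Sum>c\<in>C'. r' c t *\<^sub>C c)"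
      using C(1) C(4)[OF tX] sum.mono_neutral_right[of C C' "\<lambda>c. r' c t *\<^sub>C c"] by (auto simp: C'_def)
    then have t_sum: "pure_tensor vs = (\<Sum>c\<in>C'. r' c t *\<^sub>C pure_tensor (w c))"
      using C'(1) by (simp add: t_def[symmetric])
    define S where "S c = sing Vs (\<eta> c) (w c)" for c
    have sing_sum: "sing Vs \<nu>s vs = (\<Sum>c\<in>C'. r' c t *\<^sub>C S c)"
      unfolding S_def using C' by (intro sing_combination[OF Vs J' _ vs t_sum]) (auto simp: \<kappa>_def)
    interpret St: vertex_step D "M (lam - \<kappa>)" "M (lam - (\<kappa> + \<nu>))" V ?X
      by (intro vertex_stepI V premodule_tensor_fd Vs)
    have S_in: "S c \<in> car St.M1X.XT" if "c \<in> C'" for c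
      using sing_in[OF Vs C'(2)[OF that]] C'(3)[OF that] by (simp only: S_def)
    have sing_in': "sing Vs \<nu>s vs \<in> car St.M1X.XT" using sing_in[OF Vs vs] by (simp only: \<kappa>_def)
    let ?tid = "\<lambda>b. tens_id (M (lam - \<kappa>)) ?X (phi D M m (lam - \<kappa>) V \<nu> b)"
    let ?l = "ldr (\<kappa> + \<nu>) (tens_mod V ?X)"
    note uq = uq_linear_phi[OF V \<kappa> \<nu>]
    have tid_lin: "linear_on (car St.M1X.XT) (?tid b)" and tid_in: "y \<in> car St.M1X.XT \<Longrightarrow> ?tid b y \<in> car St.M0VX.XT"
      if "b \<in> B'" for b y
      using St.linear_tens_id[OF uq[OF B'(1)[OF that]]] St.tens_id_subset[OF uq[OF B'(1)[OF that]]] by blast+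
    have l_lin: "linear_on (car St.M0VX.XT) ?l"
      by (rule linear_ldr[OF \<kappa>\<nu> VX.premodule_tens])
    have tid_v: "?tid v y = (\<Sum>b\<in>B'. r b v *\<^sub>C ?tid b y)" if "y \<in> car St.M1X.XT" for y
    proof (rule St.tens_id_combination[OF uq[OF v] _ _ that])
      show "uq_linear (M (lam - \<kappa>)) St.M0V.XT (phi D M m (lam - \<kappa>) V \<nu> b)" if "b \<in> B'" for b
        by (rule uq[OF B'(1)[OF that]])
      show "phi D M m (lam - \<kappa>) V \<nu> v x = (\<Sum>b\<in>B'. r b v *\<^sub>C phi D M m (lam - \<kappa>) V \<nu> b x)"
        if "x \<in> car (M (lam - \<kappa>))" for x
        by (rule phi_combination[OF V \<kappa> \<nu> B'(1) v_sum that])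
    qed
    have tid_S: "?tid b (sing Vs \<nu>s vs) = (\<Sum>c\<in>C'. r' c t *\<^sub>C ?tid b (S c))" if "b \<in> B'" for b
      unfolding sing_sum using S_in
      by (subst linear_on_sum[OF tid_lin[OF that] St.M1X.XT.subspace_car])
        (auto simp: linear_on_scale[OF tid_lin[OF that]] simp del: St.M1X.car_tens)
    have l_sum: "?l (\<Sum>a\<in>A. c a *\<^sub>C y a) = (\<Sum>a\<in>A. c a *\<^sub>C ?l (y a))" if "\<And>a. a \<in> A \<Longrightarrow> y a \<in> car St.M0VX.XT"
      for A :: "'z set" and c y
      using that by (subst linear_on_sum[OF l_lin St.M0VX.XT.subspace_car])
        (auto simp: linear_on_scale[OF l_lin] simp del: St.M0VX.car_tens)
    have "?l (?tid v (sing Vs \<nu>s vs)) = (\<Sum>b\<in>B'. r b v *\<^sub>C ?l (?tid b (sing Vs \<nu>s vs)))"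
      unfolding tid_v[OF sing_in'] by (rule l_sum) (rule tid_in[OF _ sing_in'])
    also have "\<dots> = (\<Sum>b\<in>B'. r b v *\<^sub>C (\<Sum>c\<in>C'. r' c t *\<^sub>C ?l (?tid b (S c))))"
    proof (rule sum.cong)
      fix b assume b: "b \<in> B'"
      have "?l (?tid b (sing Vs \<nu>s vs)) = (\<Sum>c\<in>C'. r' c t *\<^sub>C ?l (?tid b (S c)))"
        unfolding tid_S[OF b] by (rule l_sum) (rule tid_in[OF b S_in])
      then show "r b v *\<^sub>C ?l (?tid b (sing Vs \<nu>s vs)) = r b v *\<^sub>C (\<Sum>c\<in>C'. r' c t *\<^sub>C ?l (?tid b (S c)))" by simp
    qed simp
    also have "\<dots> = (\<Sum>b\<in>B'. \<Sum>c\<in>C'. (r b v * r' c t) *\<^sub>C Z b c)"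
    proof (intro sum.cong refl)
      fix b assume b: "b \<in> B'"
      have "Z b c = ?l (?tid b (S c))" if "c \<in> C'" for c
        by (simp only: Z_def S_def B'(2)[OF b] C'(3)[OF that])
      then show "r b v *\<^sub>C (\<Sum>c\<in>C'. r' c t *\<^sub>C ?l (?tid b (S c))) = (\<Sum>c\<in>C'. (r b v * r' c t) *\<^sub>C Z b c)"
        by (simp add: cvec.scale_sum_right scaleC_scaleC)
    qed
    also have "\<dots> = (\<Sum>b\<in>B'. \<Sum>c\<in>C. (r b v * r' c t) *\<^sub>C Z b c)"
      using C(1) by (intro sum.cong refl sum.mono_neutral_left) (auto simp: C'_def)
    also have "\<dots> = \<beta> v t"
      unfolding \<beta>_def using B(1) by (intro sum.mono_neutral_left) (auto simp: B'_def)
    also have "\<dots> = J (v \<otimes> t)"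
      unfolding J_def by (rule tens_lift_tcons[OF VX.X.subspace_car VX.T.subspace_car bil vV tX, symmetric])
    finally show "J (pure_tensor vs0) = ldr (sum_list \<nu>s0) (tensor (V # Vs)) (sing (V # Vs) \<nu>s0 vs0)"
      unfolding eq sing_Cons tensor_simps pure_tensor_simps sum_list.Cons \<kappa>_def[symmetric] t_def[symmetric]
        add.commute[of \<nu> \<kappa>] by (rule sym)
  qed
  then show ?thesis by blast
qed

end

context verma_family
begin

text \<open>The fusion operator is triangular: \<open>J (v \<otimes> y)\<close> is \<open>v \<otimes> J' y\<close> plus terms whose second factors have
  strictly higher weight.\<close>

lemma fusion_map_surjective_Cons:
  assumes V: "V \<in> M_fd D" and Vs: "set Vs \<subseteq> M_fd D" and J': "fusion_map Vs J'"
    and surj: "car (tensor Vs) \<subseteq> J' ` car (tensor Vs)" and J: "fusion_map (V # Vs) J"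
  shows "car (tensor (V # Vs)) \<subseteq> J ` car (tensor (V # Vs))"
proof -
  let ?X = "tensor Vs"
  let ?I = "J ` car (tensor (V # Vs))"
  have VVs: "set (V # Vs) \<subseteq> M_fd D" using V Vs by simp
  have X: "premodule D ?X" by (rule premodule_tensor_fd[OF Vs])
  interpret VX: premodule_pair D V ?X
    by (intro premodule_pair.intro M_fd_premodule[OF V] X)
  have carX: "car (tensor (V # Vs)) = tens_space (car V) (car ?X)" by simp
  note J_lin = fusion_map_linear[OF VVs J]
  have spanI: "cvec.span (car (tensor (V # Vs))) = car (tensor (V # Vs))"
    using VX.XT.subspace_car by (simp add: cvec.span_eq_iff)
  have "?I = cvec.span ?I"
    using linear_on_image_span[of "car (tensor (V # Vs))" J, unfolded spanI, OF J_lin] .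
  then have I: "cvec.subspace ?I" using cvec.subspace_span[of ?I] by argo
  obtain GV where GV: "finite GV" "GV \<subseteq> (\<Union>\<mu>\<in>L. wspace D V \<mu>)" "car V = cvec.span GV"
    using M_fd_spanning[OF V] by blast
  obtain G where G: "finite G" "\<And>g. g \<in> G \<Longrightarrow> \<exists>\<nu>s vs. g = pure_tensor vs \<and> weight_vectors D Vs \<nu>s vs"
    "\<And>g. g \<in> G \<Longrightarrow> \<exists>\<kappa>. g \<in> wspace D ?X \<kappa>" "car ?X = cvec.span G"
    using pure_span[OF Vs J'] by metis
  have G': "G \<subseteq> (\<Union>\<mu>. wspace D ?X \<mu>)" using G(3) by blast
  define P where "P = {\<kappa>. wspace D ?X \<kappa> \<noteq> {0}}"
  have finP: "finite P" unfolding P_def by (rule VX.T.finite_weights[OF G(1) G' G(4)])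
  define \<rho> where "\<rho> \<kappa> = Re (\<Sum>i\<in>UNIV. \<kappa> $ i)" for \<kappa> :: "'i weight"
  have \<rho>_wt: "\<rho> (\<kappa> + wt w) = \<rho> \<kappa> + real (length w)" for \<kappa> w
    by (simp add: \<rho>_def sum.distrib wt_coordinate_sum)
  \<comment> \<open>Descending induction on the weight of the second factor: a weight of larger
    height has fewer weights of P above it.\<close>
  have main: "\<forall>t\<in>wspace D ?X \<kappa>. \<forall>v\<in>car V. v \<otimes> t \<in> ?I" for \<kappa>
  proof (induction "card {\<pi>\<in>P. \<rho> \<pi> > \<rho> \<kappa>}" arbitrary: \<kappa> rule: less_induct)
    case less
    show ?case
    proof
      fix t assume t: "t \<in> wspace D ?X \<kappa>"
      have sub: "cvec.subspace {v. v \<otimes> t \<in> ?I}"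
        by (rule cvec.subspaceI)
          (auto simp: tcons_add_left tcons_scale_left cvec.subspace_0[OF I] intro: cvec.subspace_add[OF I] cvec.subspace_scale[OF I] simp del: tensor_simps)
      have "v \<otimes> t \<in> ?I" if vG: "v \<in> GV" for v
      proof (cases "t = 0")
        case True
        then show ?thesis using cvec.subspace_0[OF I] by simp
      next
        case False
        obtain \<nu> where \<nu>: "\<nu> \<in> L" and v: "v \<in> wspace D V \<nu>" using vG GV(2) by blast
        \<comment> \<open>Since y has weight \<kappa>, the singular vectors of the pure tensors in
          its expansion lie in one module and add up to a single vector s with leading term
          t.\<close>
        obtain y where y: "y \<in> wspace D ?X \<kappa>" "J' y = t"
          using fusion_map_weight_lift[OF Vs J' surj t] by blast
        obtain N :: nat and c \<eta> w where w: "\<And>n. n < N \<Longrightarrow> weight_vectors D Vs (\<eta> n) (w n) \<and> sum_list (\<eta> n) = \<kappa>"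
          and y_sum: "y = (\<Sum>n<N. c n *\<^sub>C pure_tensor (w n))"
          using weight_expansion[OF Vs y(1)] by blast
        have w': "weight_vectors D Vs (\<eta> n) (w n)" "sum_list (\<eta> n) = \<kappa>" if "n \<in> {..<N}" for n using w that by auto
        have "N \<noteq> 0"
        proof
          assume "N = 0"
          then have "y = 0" using y_sum by simp
          then show False using y(2) False linear_on_zero[OF fusion_map_linear[OF Vs J'] VX.T.subspace_car] by simp
        qed
        then have \<kappa>: "\<kappa> \<in> L" using w[of 0] weight_vectors_lattice[of D Vs "\<eta> 0" "w 0"] by simp
        have \<kappa>\<nu>: "\<kappa> + \<nu> \<in> L" by (rule weight_lattice_add[OF \<kappa> \<nu>])
        interpret St: vertex_step D "M (lam - \<kappa>)" "M (lam - (\<kappa> + \<nu>))" V ?X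
          by (intro vertex_stepI V X)
        interpret M1X: irreducible_verma_tensor D "lam - \<kappa>" "M (lam - \<kappa>)" "m (lam - \<kappa>)" ?X
          by (rule irreducible_tensor_at[OF \<kappa> X])
        let ?tid = "tens_id (M (lam - \<kappa>)) ?X (phi D M m (lam - \<kappa>) V \<nu> v)"
        let ?l = "ldr (\<kappa> + \<nu>) (tens_mod V ?X)"
        note uq = uq_linear_phi[OF V \<kappa> \<nu> v]
        define S where "S n = sing Vs (\<eta> n) (w n)" for n
        have S_in: "S n \<in> car St.M1X.XT" if "n \<in> {..<N}" for n
          using sing_in[OF Vs w'(1)[OF that]] w'(2)[OF that] by (simp only: S_def)
        define s where "s = (\<Sum>n<N. c n *\<^sub>C S n)"
        have s_in: "s \<in> car St.M1X.XT"
          unfolding s_def by (intro St.M1X.XT.sum_in St.M1X.XT.scale_in S_in)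
        have s_K: "act St.M1X.XT (GK h) s = qw D lam h *\<^sub>C s" for h
        proof -
          have "act St.M1X.XT (GK h) (c n *\<^sub>C S n) = qw D lam h *\<^sub>C (c n *\<^sub>C S n)" if "n \<in> {..<N}" for n
            using sing_K[OF Vs w'(1)[OF that], of h] St.M1X.XT.act_scale[OF S_in[OF that], of "GK h" "c n"]
            unfolding w'(2)[OF that] S_def[symmetric] by (simp add: scaleC_scaleC mult.commute)
          then show ?thesis unfolding s_def cvec.scale_sum_right
            by (subst St.M1X.XT.act_sum) (auto intro!: St.M1X.XT.scale_in S_in simp del: St.M1X.car_tens)
        qed
        have lead_s: "M1X.lead s = t"
        proof -
          have "M1X.lead s = (\<Sum>n<N. M1X.lead (c n *\<^sub>C S n))"
            unfolding s_def by (rule linear_on_sum[OF M1X.linear_test St.M1X.XT.subspace_car]) (rule St.M1X.XT.scale_in[OF S_in])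
          also have "\<dots> = (\<Sum>n<N. c n *\<^sub>C J' (pure_tensor (w n)))"
          proof (rule sum.cong)
            fix n assume n: "n \<in> {..<N}"
            have "J' (pure_tensor (w n)) = M1X.lead (S n)"
              using fusion_map_pure[OF Vs J' w'(1)[OF n]] w'(2)[OF n] by (simp only: S_def M1X.mstar_id_eq)
            then show "M1X.lead (c n *\<^sub>C S n) = c n *\<^sub>C J' (pure_tensor (w n))"
              using linear_on_scale[OF M1X.linear_test S_in[OF n]] by simp
          qed simp
          also have "\<dots> = J' y" unfolding y_sum using w'(1) by (intro fusion_map_sum[OF Vs J', symmetric]) auto
          finally show ?thesis using y(2) by simp
        qed
        have tid_lin: "linear_on (car St.M1X.XT) ?tid" by (rule St.linear_tens_id[OF uq])
        have tid_in: "?tid ` car St.M1X.XT \<subseteq> car St.M0VX.XT" by (rule St.tens_id_subset[OF uq])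
        have lt_lin: "linear_on (car St.M1X.XT) (\<lambda>y. ?l (?tid y))"
          by (rule linear_on_compose[OF tid_lin tid_in linear_ldr[OF \<kappa>\<nu> VX.premodule_tens]])
        have Jy: "J (v \<otimes> y) = ?l (?tid s)"
        proof -
          have vy: "v \<otimes> y = (\<Sum>n<N. c n *\<^sub>C pure_tensor (v # w n))"
            unfolding y_sum using linear_on_sum[OF bilinear_on_right[OF bilinear_on_tcons[of UNIV UNIV], of v], of "{..<N}" "\<lambda>n. c n *\<^sub>C pure_tensor (w n)"]
            by (simp add: tcons_scale_right)
          have "J (v \<otimes> y) = (\<Sum>n<N. c n *\<^sub>C J (pure_tensor (v # w n)))"
            unfolding vy using w'(1) v \<nu>
            by (intro fusion_map_sum[OF VVs J, where \<eta> = "\<lambda>n. \<nu> # \<eta> n"]) (auto simp: weight_vectors_Cons)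
          also have "\<dots> = (\<Sum>n<N. c n *\<^sub>C ?l (?tid (S n)))"
          proof (rule sum.cong)
            fix n assume n: "n \<in> {..<N}"
            have "weight_vectors D (V # Vs) (\<nu> # \<eta> n) (v # w n)"
              using w'(1)[OF n] v \<nu> by (auto simp: weight_vectors_Cons)
            then have "J (pure_tensor (v # w n)) = ?l (?tid (S n))"
              using fusion_map_pure[OF VVs J] unfolding sing_Cons sum_list.Cons tensor_simps w'(2)[OF n] S_def add.commute[of \<nu> \<kappa>]
              by (simp only: sing_Cons sum_list.Cons tensor_simps w'(2)[OF n] S_def add.commute[of \<nu> \<kappa>])
            then show "c n *\<^sub>C J (pure_tensor (v # w n)) = c n *\<^sub>C ?l (?tid (S n))" by simp
          qed simp
          also have "\<dots> = (\<Sum>n<N. ?l (?tid (c n *\<^sub>C S n)))"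
            using linear_on_scale[OF lt_lin S_in] by (intro sum.cong) simp_all
          also have "\<dots> = ?l (?tid s)"
            unfolding s_def by (rule linear_on_sum[OF lt_lin St.M1X.XT.subspace_car, symmetric]) (rule St.M1X.XT.scale_in[OF S_in])
          finally show ?thesis .
        qed
        \<comment> \<open>R is the off-diagonal part. On \<open>F_u m \<otimes> b\<close> it
          vanishes for empty u, and for other u it is a multiple of
          \<open>F_u v \<otimes> b\<close>.\<close>
        define R where "R y = ?l (?tid y) - v \<otimes> M1X.lead y" for y
        have R_lin: "linear_on (car St.M1X.XT) R"
          unfolding R_def
          by (intro linear_on_minus lt_lin linear_on_compose[OF M1X.linear_test subset_UNIV bilinear_on_right[OF bilinear_on_tcons UNIV_I]])
        let ?G2 = "{a \<otimes> b |a b. a \<in> range (\<lambda>w. foldr (\<lambda>i. act (M (lam - \<kappa>)) (GF i)) w (m (lam - \<kappa>))) \<and> b \<in> G}"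
        have carM1X: "car St.M1X.XT = cvec.span ?G2"
          unfolding St.M1X.car_tens M1X.car_span G(4) by (rule tens_space_span[OF D])
        have G2w: "foldr (\<lambda>i. act (M (lam - \<kappa>)) (GF i)) u (m (lam - \<kappa>)) \<otimes> b \<in> wspace D St.M1X.XT (lam - \<kappa> - wt u + \<pi>)"
          if b: "b \<in> wspace D ?X \<pi>" for u b \<pi>
        proof -
          have bX: "b \<in> car ?X" "\<And>h. act ?X (GK h) b = qw D \<pi> h *\<^sub>C b" using b by (auto simp: wspace_iff)
          have uM: "foldr (\<lambda>i. act (M (lam - \<kappa>)) (GF i)) u (m (lam - \<kappa>)) \<in> car (M (lam - \<kappa>))" by (intro St.M1.word_map_in M1X.m_in)
          show ?thesis unfolding wspace_iff using St.M1X.act_tens[OF uM bX(1)] tens_space_tcons[OF uM bX(1)]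
            by (simp add: bX(2) M1X.K_Fm tcons_scale_left tcons_scale_right scaleC_scaleC qw_add_left D)
        qed
        have RI: "R x \<in> ?I" if x: "x \<in> ?G2 \<inter> wspace D St.M1X.XT lam" for x
        proof -
          obtain u b where x_eq: "x = foldr (\<lambda>i. act (M (lam - \<kappa>)) (GF i)) u (m (lam - \<kappa>)) \<otimes> b" and b: "b \<in> G"
            using x by blast
          obtain \<pi> where \<pi>: "b \<in> wspace D ?X \<pi>" using G(3)[OF b] by blast
          have bX: "b \<in> car ?X" using \<pi> by (simp add: wspace_iff)
          show ?thesis
          proof (cases "x = 0")
            case True
            then show ?thesis using linear_on_zero[OF R_lin St.M1X.XT.subspace_car] cvec.subspace_0[OF I] by simp
          next
            case False
            then have "lam - \<kappa> - wt u + \<pi> = lam"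
              using St.M1X.XT.wspace_unique[OF G2w[OF \<pi>, of u], of lam] x x_eq by simp
            \<comment> \<open>This is the strict increase of weight for nonempty u: in a summand of
              weight lam, what the first factor loses is gained by the second.\<close>
            then have \<pi>_eq: "\<pi> = \<kappa> + wt u" by (simp add: algebra_simps)
            have Rx: "R x = qw D (lam - (\<kappa> + \<nu>)) (- wt u) *\<^sub>C (foldr (\<lambda>i. act V (GF i)) u v \<otimes> b) -
                v \<otimes> (M1X.chi (foldr (\<lambda>i. act (M (lam - \<kappa>)) (GF i)) u (m (lam - \<kappa>))) *\<^sub>C b)"
              unfolding R_def x_eq ldr_tens_id_word[OF V \<kappa> \<nu> v X bX] using bX
              by (simp add: M1X.test_tcons St.M1.word_map_in M1X.m_in)
            show ?thesis
            proof (cases u)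
              case Nil
              then have "R x = 0" unfolding Rx by (simp add: scaleC_one D)
              then show ?thesis using cvec.subspace_0[OF I] by simp
            next
              case (Cons i u')
              have chi0: "M1X.chi (foldr (\<lambda>i. act (M (lam - \<kappa>)) (GF i)) u (m (lam - \<kappa>))) = 0"
                unfolding Cons by (simp add: M1X.chi_F St.M1.word_map_in M1X.m_in)
              have "b \<noteq> 0" using False x_eq by auto
              then have "\<pi> \<in> P" using \<pi> by (auto simp: P_def)
              moreover have "\<rho> \<pi> > \<rho> \<kappa>" unfolding \<pi>_eq \<rho>_wt by (simp add: Cons)
              ultimately have "{\<pi>'\<in>P. \<rho> \<pi>' > \<rho> \<pi>} \<subset> {\<pi>'\<in>P. \<rho> \<pi>' > \<rho> \<kappa>}" by auto
              then have "card {\<pi>'\<in>P. \<rho> \<pi>' > \<rho> \<pi>} < card {\<pi>'\<in>P. \<rho> \<pi>' > \<rho> \<kappa>}"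
                using finP by (intro psubset_card_mono) auto
              then have "\<forall>t\<in>wspace D ?X \<pi>. \<forall>v\<in>car V. v \<otimes> t \<in> ?I" by (rule less.hyps)
              moreover have "foldr (\<lambda>i. act V (GF i)) u v \<in> car V" using v by (intro VX.X.word_map_in) (simp add: wspace_iff)
              ultimately have "foldr (\<lambda>i. act V (GF i)) u v \<otimes> b \<in> ?I" using \<pi> by blast
              then show ?thesis unfolding Rx chi0 using cvec.subspace_scale[OF I] by simp
            qed
          qed
        qed
        \<comment> \<open>As s has weight lam, only generators of that weight occur in it, and these
          are the ones treated in \<open>RI\<close>.\<close>
        have "s \<in> cvec.span (?G2 \<inter> wspace D St.M1X.XT lam)"
        proof (rule St.M1X.XT.span_weight_part)
          show "?G2 \<subseteq> (\<Union>\<kappa>. wspace D St.M1X.XT \<kappa>)"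
          proof
            fix x assume "x \<in> ?G2"
            then obtain u b where x: "x = foldr (\<lambda>i. act (M (lam - \<kappa>)) (GF i)) u (m (lam - \<kappa>)) \<otimes> b" and b: "b \<in> G"
              by blast
            obtain \<pi> where "b \<in> wspace D ?X \<pi>" using G(3)[OF b] by blast
            then show "x \<in> (\<Union>\<kappa>. wspace D St.M1X.XT \<kappa>)" unfolding x
              using G2w[of b \<pi> u] by (intro UN_I[OF UNIV_I])
          qed
          show "s \<in> cvec.span ?G2" using s_in carM1X by simp
          show "s \<in> wspace D St.M1X.XT lam" using s_in s_K by (simp only: wspace_iff) blast
        qed
        moreover have "R ` cvec.span (?G2 \<inter> wspace D St.M1X.XT lam) \<subseteq> ?I"
        proof (rule linear_on_span_image[OF _ _ I])
          show "linear_on (cvec.span (?G2 \<inter> wspace D St.M1X.XT lam)) R"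
            by (rule linear_on_subset[OF R_lin]) (unfold carM1X, rule cvec.span_mono, blast)
          show "R ` (?G2 \<inter> wspace D St.M1X.XT lam) \<subseteq> ?I" using RI by blast
        qed
        ultimately have "R s \<in> ?I" by blast
        moreover have "J (v \<otimes> y) \<in> ?I"
          using y(1) v unfolding carX by (intro imageI tens_space_tcons) (auto simp: wspace_iff)
        moreover have "v \<otimes> t = J (v \<otimes> y) - R s" by (simp add: Jy R_def lead_s)
        ultimately show ?thesis using cvec.subspace_diff[OF I] by simp
      qed
      then have "cvec.span GV \<subseteq> {v. v \<otimes> t \<in> ?I}" using sub by (intro cvec.span_minimal) auto
      then show "\<forall>v\<in>car V. v \<otimes> t \<in> ?I" using GV(3) by blast
    qed
  qed
  have all: "v \<otimes> t \<in> ?I" if v: "v \<in> car V" and t: "t \<in> car ?X" for v t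
  proof -
    have "cvec.subspace {t. v \<otimes> t \<in> ?I}"
      by (rule cvec.subspaceI)
        (auto simp: tcons_add_right tcons_scale_right cvec.subspace_0[OF I] intro: cvec.subspace_add[OF I] cvec.subspace_scale[OF I] simp del: tensor_simps)
    then have "cvec.span G \<subseteq> {t. v \<otimes> t \<in> ?I}" using main v G(3) by (intro cvec.span_minimal) blast+
    then show ?thesis using t G(4) by blast
  qed
  have "tens_space (car V) (car ?X) \<subseteq> ?I"
    unfolding tens_space_def using all by (intro cvec.span_minimal[OF _ I]) auto
  then show ?thesis unfolding carX .
qed

lemma fusion_map_exists:
  assumes "set Vs \<subseteq> M_fd D"
  shows "\<exists>J. fusion_map Vs J \<and> car (tensor Vs) \<subseteq> J ` car (tensor Vs)"
  using assms
proof (induction Vs)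
  case Nil
  show ?case using fusion_map_Nil by (intro exI[of _ "\<lambda>x. x"]) auto
next
  case (Cons V Vs)
  then obtain J' where J': "fusion_map Vs J'" "car (tensor Vs) \<subseteq> J' ` car (tensor Vs)" by auto
  have VVs: "V \<in> M_fd D" "set Vs \<subseteq> M_fd D" using Cons.prems by auto
  obtain J where "fusion_map (V # Vs) J" using fusion_map_Cons[OF VVs J'(1)] by blast
  then show ?case using fusion_map_surjective_Cons[OF VVs J'] by blast
qed

section \<open>Invertibility, identification with \<open>fusion\<close>, and composition with
  A\<close>

lemma fusion_map_injective:
  assumes Vs: "set Vs \<subseteq> M_fd D" and J: "fusion_map Vs J" "car (tensor Vs) \<subseteq> J ` car (tensor Vs)"
  shows "inj_on J (car (tensor Vs))"
proof -
  obtain G where "finite G" "car (tensor Vs) = cvec.span G"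
    using tensor_spanning[OF D Vs] by blast
  then show ?thesis
    using surjective_on_span_imp_inj_on[of G J] fusion_map_linear[OF Vs J(1)] J(2) by simp
qed

lemma fusion_eq:
  assumes Vs: "set Vs \<subseteq> M_fd D" and J: "fusion_map Vs J" and x: "x \<in> car (tensor Vs)"
  shows "fusion D M m Vs lam x = J x"
proof -
  interpret X: premodule D "tensor Vs" by (rule premodule_tensor_fd[OF Vs])
  let ?J = "restrict J (car (tensor Vs))"
  let ?P = "\<lambda>j. j \<in> extensional (car (tensor Vs)) \<and> linear_on (car (tensor Vs)) j \<and>
     (\<forall>\<nu>s vs. weight_vectors D Vs \<nu>s vs \<longrightarrow>
        j (pure_tensor vs) =
          (let lam0 = lam - sum_list \<nu>s in
           mstar_id D lam0 (M lam0) (m lam0) (tensor Vs) (vertex_op D M m lam Vs \<nu>s vs (m lam))))"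
  have lin: "linear_on (car (tensor Vs)) ?J"
    using fusion_map_linear[OF Vs J] linear_on_cong[OF X.subspace_car, of ?J J] by simp
  have PJ: "?P ?J"
    using lin fusion_map_pure[OF Vs J] pure_in[OF Vs] by (auto simp: Let_def)
  obtain G where G: "\<And>g. g \<in> G \<Longrightarrow> \<exists>\<nu>s vs. g = pure_tensor vs \<and> weight_vectors D Vs \<nu>s vs" "car (tensor Vs) = cvec.span G"
    using pure_span[OF Vs J] by metis
  have uniq: "j = ?J" if Pj: "?P j" for j
  proof (rule extensionalityI[of j "car (tensor Vs)"])
    show "j \<in> extensional (car (tensor Vs))" using Pj by blast
    show "?J \<in> extensional (car (tensor Vs))" by simp
    fix x assume x: "x \<in> car (tensor Vs)"
    have lj: "linear_on (car (tensor Vs)) j" using Pj by blast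
    show "j x = ?J x"
    proof (rule linear_on_span_eqI[where G = G and f = j and g = ?J])
      show "linear_on (cvec.span G) j" "linear_on (cvec.span G) ?J" "x \<in> cvec.span G"
        using lj lin x unfolding G(2) by blast+
      fix g assume "g \<in> G"
      then obtain \<nu>s vs where "g = pure_tensor vs" "weight_vectors D Vs \<nu>s vs" using G(1) by blast
      then show "j g = ?J g" using Pj PJ by metis
    qed
  qed
  have "fusion D M m Vs lam = ?J"
    unfolding fusion_def by (rule the_equality) (fact PJ, fact uniq)
  then show ?thesis using x by simp
qed

lemma uq_linear_id_tens:
  assumes X: "premodule D X" and Y: "premodule D Y" and A: "uq_linear X Y A" and \<kappa>: "\<kappa> \<in> L"
  shows "uq_linear (tens_mod (M (lam - \<kappa>)) X) (tens_mod (M (lam - \<kappa>)) Y) (id_tens (M (lam - \<kappa>)) X A)"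
    and "y \<in> car (tens_mod (M (lam - \<kappa>)) X) \<Longrightarrow> ldr \<kappa> Y (id_tens (M (lam - \<kappa>)) X A y) = A (ldr \<kappa> X y)"
proof -
  interpret MX: irreducible_verma_tensor D "lam - \<kappa>" "M (lam - \<kappa>)" "m (lam - \<kappa>)" X
    by (rule irreducible_tensor_at[OF \<kappa> X])
  interpret MY: irreducible_verma_tensor D "lam - \<kappa>" "M (lam - \<kappa>)" "m (lam - \<kappa>)" Y
    by (rule irreducible_tensor_at[OF \<kappa> Y])
  let ?M = "M (lam - \<kappa>)"
  let ?f = "id_tens ?M X A"
  have A_lin: "linear_on (car X) A" and A_in: "\<And>t. t \<in> car X \<Longrightarrow> A t \<in> car Y"
    and A_act: "\<And>t g. t \<in> car X \<Longrightarrow> A (act X g t) = act Y g (A t)"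
    using uq_linear_linear[OF A] uq_linear_in[OF A] uq_linear_act[OF A] by blast+
  have bil: "bilinear_on (car ?M) (car X) (\<lambda>x t. x \<otimes> A t)"
    unfolding bilinear_on_def
  proof (intro conjI ballI)
    show "linear_on (car X) (\<lambda>t. x \<otimes> A t)" for x
      by (rule linear_on_compose[OF A_lin subset_UNIV bilinear_on_right[OF bilinear_on_tcons UNIV_I]])
    show "linear_on (car ?M) (\<lambda>x. x \<otimes> A t)" for t
      by (rule bilinear_on_left[OF bilinear_on_tcons UNIV_I])
  qed
  have f_tcons: "?f (x \<otimes> t) = x \<otimes> A t" if "x \<in> car ?M" "t \<in> car X" for x t
    unfolding id_tens_def by (rule tens_lift_tcons[OF MX.subspace_car MX.T.subspace_car bil that])
  have f_lin: "linear_on (car (tens_mod ?M X)) ?f"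
    unfolding id_tens_def MX.car_tens by (rule linear_on_tens_lift[OF MX.subspace_car MX.T.subspace_car bil])
  have f_in: "?f ` car (tens_mod ?M X) \<subseteq> car (tens_mod ?M Y)"
  proof (rule MX.tens_image_subset[OF f_lin])
    show "?f (x \<otimes> t) \<in> car (tens_mod ?M Y)" if "x \<in> car ?M" "t \<in> car X" for x t
      using that A_in by (simp add: f_tcons tens_space_tcons)
  qed (rule MY.XT.subspace_car)
  show "uq_linear (tens_mod ?M X) (tens_mod ?M Y) ?f"
    unfolding uq_linear_def
  proof (intro conjI allI ballI)
    fix g y assume y: "y \<in> car (tens_mod ?M X)"
    show "?f (act (tens_mod ?M X) g y) = act (tens_mod ?M Y) g (?f y)"
    proof (rule MX.tens_eqI[OF y])
      show "linear_on (car (tens_mod ?M X)) (\<lambda>y. ?f (act (tens_mod ?M X) g y))"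
        by (rule linear_on_compose[OF MX.linear_act_tens MX.act_tens_subset f_lin])
      show "linear_on (car (tens_mod ?M X)) (\<lambda>y. act (tens_mod ?M Y) g (?f y))"
        by (rule linear_on_compose[OF f_lin f_in MY.linear_act_tens])
      fix x t assume "x \<in> car ?M" "t \<in> car X"
      then show "?f (act (tens_mod ?M X) g (x \<otimes> t)) = act (tens_mod ?M Y) g (?f (x \<otimes> t))"
        by (cases g) (simp_all add: f_tcons A_in A_act MX.act_tens MY.act_tens tens_space_tcons linear_on_add[OF f_lin])
    qed
  qed (fact f_lin f_in)+
  have "MY.lead (?f y) = A (MX.lead y)" if y: "y \<in> car (tens_mod ?M X)"
  proof (rule MX.tens_eqI[OF y])
    show "linear_on (car (tens_mod ?M X)) (\<lambda>y. MY.lead (?f y))"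
      by (rule linear_on_compose[OF f_lin f_in MY.linear_test])
    show "linear_on (car (tens_mod ?M X)) (\<lambda>y. A (MX.lead y))"
      by (rule linear_on_compose[OF MX.linear_test _ A_lin]) (use MX.test_in in blast)
    fix x t assume "x \<in> car ?M" "t \<in> car X"
    then show "MY.lead (?f (x \<otimes> t)) = A (MX.lead (x \<otimes> t))"
      by (simp add: f_tcons A_in MX.test_tcons MY.test_tcons linear_on_scale[OF A_lin])
  qed
  then show "y \<in> car (tens_mod ?M X) \<Longrightarrow> ldr \<kappa> Y (?f y) = A (ldr \<kappa> X y)"
    unfolding MX.mstar_id_eq MY.mstar_id_eq .
qed

lemma homogeneous_expansion_exists:
  assumes Ws: "set Ws \<subseteq> M_fd D" "Ws \<noteq> []" and y: "y \<in> wspace D (tensor Ws) \<kappa>"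
  shows "\<exists>N \<eta> w. homogeneous_expansion D Ws \<kappa> y N \<eta> w"
proof -
  obtain N :: nat and c \<eta> w where w: "\<And>n. n < N \<Longrightarrow> weight_vectors D Ws (\<eta> n) (w n) \<and> sum_list (\<eta> n) = \<kappa>"
    and y: "y = (\<Sum>n<N. c n *\<^sub>C pure_tensor (w n))"
    using weight_expansion[OF Ws(1) y] by blast
  obtain W Ws' where W: "Ws = W # Ws'" using Ws(2) by (cases Ws) auto
  interpret W: premodule D W using Ws(1) W by (intro M_fd_premodule) auto
  \<comment> \<open>The coefficients are absorbed into the first vectors; this is where a nonempty
    tuple is required.\<close>
  define w' where "w' n = (c n *\<^sub>C hd (w n)) # tl (w n)" for n
  have "weight_vectors D Ws (\<eta> n) (w' n) \<and> pure_tensor (w' n) = c n *\<^sub>C pure_tensor (w n)" if n: "n < N" for n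
  proof -
    obtain \<nu> \<nu>s v vs where "\<eta> n = \<nu> # \<nu>s" "w n = v # vs" "\<nu> \<in> L" "v \<in> wspace D W \<nu>" "weight_vectors D Ws' \<nu>s vs"
      using w[OF n] by (auto simp: W weight_vectors_Cons)
    then show ?thesis
      by (simp add: w'_def W weight_vectors_Cons tcons_scale_left cvec.subspace_scale[OF W.subspace_wspace])
  qed
  then have "homogeneous_expansion D Ws \<kappa> y N \<eta> w'"
    using w by (simp add: homogeneous_expansion_def y)
  then show ?thesis by blast
qed

lemma conjugated_fusion_vertex_op:
  assumes Vs: "set Vs \<subseteq> M_fd D" and Ws: "set Ws \<subseteq> M_fd D" "Ws \<noteq> []" and vs: "weight_vectors D Vs \<nu>s vs"
    and A: "uq_linear (tensor Vs) (tensor Ws) A"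
  defines "z \<equiv> conj_fusion D M m Vs Ws A lam (pure_tensor vs)"
  shows "\<exists>N \<eta> w. homogeneous_expansion D Ws (sum_list \<nu>s) z N \<eta> w"
    and "homogeneous_expansion D Ws (sum_list \<nu>s) z N \<eta> w \<Longrightarrow> x \<in> car (M lam) \<Longrightarrow>
      id_tens (M (lam - sum_list \<nu>s)) (tensor Vs) A (vertex_op D M m lam Vs \<nu>s vs x) =
      (\<Sum>n<N. vertex_op D M m lam Ws (\<eta> n) (w n) x)"
proof -
  let ?X = "tensor Vs" and ?Y = "tensor Ws" and ?\<kappa> = "sum_list \<nu>s"
  have X: "premodule D ?X" and Y: "premodule D ?Y" using premodule_tensor_fd Vs Ws(1) by blast+
  interpret X: premodule D ?X by (rule X)
  have \<kappa>: "?\<kappa> \<in> L" by (rule weight_vectors_lattice[OF vs])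
  interpret MY: irreducible_verma_tensor D "lam - ?\<kappa>" "M (lam - ?\<kappa>)" "m (lam - ?\<kappa>)" ?Y
    by (rule irreducible_tensor_at[OF \<kappa> Y])
  obtain JV where JV: "fusion_map Vs JV" using fusion_map_exists[OF Vs] by blast
  obtain JW where JW: "fusion_map Ws JW" "car ?Y \<subseteq> JW ` car ?Y" using fusion_map_exists[OF Ws(1)] by blast
  have inj: "inj_on JW (car ?Y)" by (rule fusion_map_injective[OF Ws(1) JW])
  have fusW: "fusion D M m Ws lam y = JW y" if "y \<in> car ?Y" for y by (rule fusion_eq[OF Ws(1) JW(1) that])
  have pv: "pure_tensor vs \<in> wspace D ?X ?\<kappa>" by (rule pure_weight[OF Vs vs])
  define t where "t = A (JV (pure_tensor vs))"
  have Jp: "JV (pure_tensor vs) \<in> wspace D ?X ?\<kappa>" by (rule fusion_map_weight[OF Vs JV pv])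
  have t: "t \<in> wspace D ?Y ?\<kappa>"
    unfolding wspace_iff t_def
  proof (intro conjI allI)
    have J: "JV (pure_tensor vs) \<in> car ?X" "\<And>h. act ?X (GK h) (JV (pure_tensor vs)) = qw D ?\<kappa> h *\<^sub>C JV (pure_tensor vs)"
      using Jp by (auto simp: wspace_iff)
    show "A (JV (pure_tensor vs)) \<in> car ?Y" by (rule uq_linear_in[OF A J(1)])
    show "act ?Y (GK h) (A (JV (pure_tensor vs))) = qw D ?\<kappa> h *\<^sub>C A (JV (pure_tensor vs))" for h
      using uq_linear_act[OF A J(1), of "GK h"] linear_on_scale[OF uq_linear_linear[OF A] J(1)] J(2) by simp
  qed
  \<comment> \<open>A preserves weights, so t has weight \<open>sum_list \<nu>s\<close> and
    possesses a preimage y of the same weight. By injectivity y is the conjugated vector z, which is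
    therefore homogeneous.\<close>
  obtain y where y: "y \<in> wspace D ?Y ?\<kappa>" "JW y = t"
    using fusion_map_weight_lift[OF Ws(1) JW t] by blast
  have yY: "y \<in> car ?Y" using y by (simp add: wspace_iff)
  have "z = inv_into (car ?Y) (fusion D M m Ws lam) t"
    using pv fusion_eq[OF Vs JV, of "pure_tensor vs"] by (simp add: z_def conj_fusion_def t_def wspace_iff)
  also have "t = fusion D M m Ws lam y" using y fusW[OF yY] by simp
  also have "inv_into (car ?Y) (fusion D M m Ws lam) (fusion D M m Ws lam y) = y"
  proof (rule inv_into_f_f[OF _ yY])
    show "inj_on (fusion D M m Ws lam) (car ?Y)" using inj inj_on_cong[of "car ?Y" "fusion D M m Ws lam" JW] fusW by blast
  qed
  finally have z: "z = y" .
  show "\<exists>N \<eta> w. homogeneous_expansion D Ws (sum_list \<nu>s) z N \<eta> w"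
    unfolding z by (rule homogeneous_expansion_exists[OF Ws y(1)])
  assume he: "homogeneous_expansion D Ws (sum_list \<nu>s) z N \<eta> w" and x: "x \<in> car (M lam)"
  then have w: "\<And>n. n \<in> {..<N} \<Longrightarrow> weight_vectors D Ws (\<eta> n) (w n)" "\<And>n. n \<in> {..<N} \<Longrightarrow> sum_list (\<eta> n) = ?\<kappa>"
    \<comment> \<open>The coefficients 1 bring the sum into the form treated by
      \<open>uq_linear_sum\<close> and \<open>fusion_map_sum\<close>.\<close>
    and yw: "y = (\<Sum>n<N. 1 *\<^sub>C pure_tensor (w n))"
    unfolding homogeneous_expansion_def z by (auto simp: scaleC_one)
  note idA = uq_linear_id_tens[OF X Y A \<kappa>]
  have uqW: "uq_linear (M lam) MY.XT (vertex_op D M m lam Ws (\<eta> n) (w n))" if "n \<in> {..<N}" for n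
    using uq_linear_vertex_op[OF Ws(1) w(1)[OF that]] unfolding w(2)[OF that] .
  have "id_tens (M (lam - ?\<kappa>)) ?X A (vertex_op D M m lam Vs \<nu>s vs x) =
      (\<Sum>n<N. 1 *\<^sub>C vertex_op D M m lam Ws (\<eta> n) (w n) x)"
  proof (rule MY.homomorphism_unique[OF verma_at uq_linear_compose[OF uq_linear_vertex_op[OF Vs vs] idA(1)]
        uq_linear_sum[OF premodule_at MY.premodule_tens uqW] _ x])
    have m_in: "m lam \<in> car (M lam)" by (rule verma.m_in[OF verma_at])
    have inW: "sing Ws (\<eta> n) (w n) \<in> car MY.XT" if "n \<in> {..<N}" for n
      by (rule uq_linear_in[OF uqW[OF that] m_in])
    have "MY.lead (\<Sum>n<N. 1 *\<^sub>C sing Ws (\<eta> n) (w n)) = (\<Sum>n<N. MY.lead (1 *\<^sub>C sing Ws (\<eta> n) (w n)))"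
      by (rule linear_on_sum[OF MY.linear_test MY.XT.subspace_car]) (rule MY.XT.scale_in[OF inW])
    also have "\<dots> = (\<Sum>n<N. 1 *\<^sub>C JW (pure_tensor (w n)))"
    proof (rule sum.cong)
      fix n assume n: "n \<in> {..<N}"
      show "MY.lead (1 *\<^sub>C sing Ws (\<eta> n) (w n)) = 1 *\<^sub>C JW (pure_tensor (w n))"
        using fusion_map_pure[OF Ws(1) JW(1) w(1)[OF n]] w(2)[OF n] by (simp only: scaleC_one MY.mstar_id_eq)
    qed simp
    also have "\<dots> = JW y" unfolding yw using w(1) by (intro fusion_map_sum[OF Ws(1) JW(1), symmetric]) auto
    also have "\<dots> = A (ldr ?\<kappa> ?X (sing Vs \<nu>s vs))" using y(2) fusion_map_pure[OF Vs JV vs] by (simp only: t_def)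
    also have "\<dots> = ldr ?\<kappa> ?Y (id_tens (M (lam - ?\<kappa>)) ?X A (sing Vs \<nu>s vs))"
      by (rule idA(2)[OF sing_in[OF Vs vs], symmetric])
    finally show "MY.lead (id_tens (M (lam - ?\<kappa>)) ?X A (sing Vs \<nu>s vs)) = MY.lead (\<Sum>n<N. 1 *\<^sub>C sing Ws (\<eta> n) (w n))"
      unfolding MY.mstar_id_eq by (rule sym)
  qed
  then show "id_tens (M (lam - ?\<kappa>)) ?X A (vertex_op D M m lam Vs \<nu>s vs x) =
      (\<Sum>n<N. vertex_op D M m lam Ws (\<eta> n) (w n) x)" by (simp only: scaleC_one)
qed

end

theorem theorem3p13:
  fixes D :: "'i::finite qdatum"
    and M :: "'i weight \<Rightarrow> ('i, 'v::cvec) uqmod"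
    and m :: "'i weight \<Rightarrow> 'v"
    and Vs Ws :: "('i, 'v) uqmod list"
    and \<nu>s :: "'i weight list"
    and vs :: "'v list"
    and lam :: "'i weight"
    and A :: "'v tens \<Rightarrow> 'v tens"
  assumes "qdatum D"
    and "\<And>\<mu>. verma_module D \<mu> (M \<mu>) (m \<mu>)"
    and "length Vs \<ge> 1" and "length Ws \<ge> 1"
    and "set Vs \<subseteq> M_fd D" and "set Ws \<subseteq> M_fd D"
    and "weight_vectors D Vs \<nu>s vs"
    and "lam \<in> h_reg D M"
    and "uq_linear (tensor Vs) (tensor Ws) A"
  shows "(\<exists>N \<eta> w. homogeneous_expansion D Ws (sum_list \<nu>s)
            (conj_fusion D M m Vs Ws A lam (pure_tensor vs)) N \<eta> w) \<and>
         (\<forall>N \<eta> w. homogeneous_expansion D Ws (sum_list \<nu>s)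
            (conj_fusion D M m Vs Ws A lam (pure_tensor vs)) N \<eta> w \<longrightarrow>
            (\<forall>x\<in>car (M lam).
               id_tens (M (lam - sum_list \<nu>s)) (tensor Vs) A (vertex_op D M m lam Vs \<nu>s vs x) =
               (\<Sum>n<N. vertex_op D M m lam Ws (\<eta> n) (w n) x)))"
proof -
  interpret verma_family D M m lam
    using assms(1,2,8) by (rule verma_family.intro)
  have Ws: "Ws \<noteq> []" using assms(4) by auto
  note * = conjugated_fusion_vertex_op[OF assms(5,6) Ws assms(7,9)]
  show ?thesis by (intro conjI allI impI ballI *)
qed

end
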